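(* Let $\mathcal F$ be a dimension-one foliation on $\mathbb S^1\times\mathbb L_+$. Then exactly one of the following two alternatives holds: (i) the set $C=\{\alpha\in\mathbb L_+ : \mathbb S^1\times\{\alpha\}\text{ is a leaf of }\mathcal F\}$ is a closed unbounded subset of $\mathbb L_+$; (ii) $\mathcal F$ is ultimately vertical, i.e. there is an ordinal $\alpha\in\omega_1$ such that the restriction of $\mathcal F$ to $\mathbb S^1\times(\alpha,\omega_1)$ is the trivial product foliation by long rays, with leaves $\{x\}\times(\alpha,\omega_1)$, $x\in\mathbb S^1$.
   Context: The closed long ray $\mathbb L_{\ge 0}$ is $\omega_1\times[0,1)$ with the order topology of the lexicographic order; an ordinal $\alpha\in\omega_1$ is identified with $(\alpha,0)$. The long ray is $\mathbb L_+=\mathbb L_{\ge0}\setminus\{0\}$. For $\alpha\in\mathbb L_{\ge 0}$, $(\alpha,\omega_1)=\{x\in\mathbb L_+: x>\alpha\}$. A subset of $\mathbb L_+$ is unbounded if it has no upper bound in $\mathbb L_+$. Foliation: a foliation $\mathcal F$ of dimension $p$ on an $n$-manifold $M$ (connected, Hausdorff, not necessarily metrisable) is a maximal atlas $\{(U_i,\varphi_i)\}_{i\in I}$ on $M$ such that all coordinate changes have the form $\varphi_j\varphi_i^{-1}(x,y)=(g_{i,j}(x,y),h_{i,j}(y))$ for $(x,y)\in\varphi_i(U_i\cap U_j)\subset\mathbb R^p\times\mathbb R^{n-p}$, where $h_{i,j}$ is an embedding of a relevant open subset of $\mathbb R^{n-p}$ into $\mathbb R^{n-p}$ (only continuity is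 required). Components of the sets $\varphi_i^{-1}(\mathbb R^p\times\{y\})$ are called plaques; they form a basis of the leaf topology on $M$, whose path components are the leaves of $\mathcal F$. *)

theory Defs
  imports "HOL-Analysis.Analysis" "HOL-Library.Countable_Set_Type"
begin

section \<open>The first uncountable ordinal\<close>

text \<open>\<open>cardSuc natLeq\<close> is the initial ordinal of the least uncountable cardinal, realised by
  the library as a well-order whose field is a set of sets of naturals.\<close>

typedef omega1 = "Field (cardSuc natLeq)"
  using Field_cardSuc_not_empty[OF natLeq_Card_order] by blast

instantiation omega1 :: wellorder
begin

definition less_eq_omega1 :: "omega1 \<Rightarrow> omega1 \<Rightarrow> bool"
  where "a \<le> b \<longleftrightarrow> (Rep_omega1 a, Rep_omega1 b) \<in> cardSuc natLeq"

definition less_omega1 :: "omega1 \<Rightarrow> omega1 \<Rightarrow> bool"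
  where "(a::omega1) < b \<longleftrightarrow> a \<le> b \<and> a \<noteq> b"

instance
proof -
  let ?r = "cardSuc natLeq"
  have wo: "Well_order ?r"
    using cardSuc_Card_order[OF natLeq_Card_order] by (simp add: card_order_on_def)
  then have refl: "refl_on (Field ?r) ?r" and tr: "trans ?r" and as: "antisym ?r"
    and tot: "total_on (Field ?r) ?r" and wf: "wf (?r - Id)"
    by (auto simp: well_order_on_def linear_order_on_def partial_order_on_def preorder_on_def)
  show "OFCLASS(omega1, wellorder_class)"
  proof
    fix x y z :: omega1
    show as': "x = y" if "x \<le> y" "y \<le> x"
      using that as unfolding less_eq_omega1_def
      by (metis Rep_omega1_inject antisymD)
    show "x < y \<longleftrightarrow> x \<le> y \<and> \<not> y \<le> x"
      unfolding less_omega1_def less_eq_omega1_def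
      using as refl by (metis Rep_omega1 Rep_omega1_inject antisymD refl_onD)
    show "x \<le> x"
      unfolding less_eq_omega1_def using refl by (metis Rep_omega1 refl_onD)
    show "x \<le> z" if "x \<le> y" "y \<le> z"
      using that tr unfolding less_eq_omega1_def by (meson transD)
    show "x \<le> y \<or> y \<le> x"
      unfolding less_eq_omega1_def using tot refl
      by (metis Rep_omega1 refl_onD total_on_def)
  next
    fix P :: "omega1 \<Rightarrow> bool" and a
    assume step: "\<And>x. (\<And>y. y < x \<Longrightarrow> P y) \<Longrightarrow> P x"
    have "wf (inv_image (?r - Id) Rep_omega1)"
      using wf by (rule wf_inv_image)
    then show "P a"
    proof (induction a rule: wf_induct_rule)
      case (less x)
      show ?case
      proof (rule step)
        fix y assume "y < x"
        then show "P y"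
          by (intro less)
            (auto simp: inv_image_def less_omega1_def less_eq_omega1_def Rep_omega1_inject)
      qed
    qed
  qed
qed

end

lemma uncountable_omega1:
  includes cardinal_syntax
  shows "uncountable (UNIV :: omega1 set)"
proof
  let ?r = "cardSuc natLeq"
  assume "countable (UNIV :: omega1 set)"
  moreover have "Field ?r = range Rep_omega1"
    using type_definition.Rep_range[OF type_definition_omega1] by simp
  ultimately have "countable (Field ?r)" by simp
  then have "|Field ?r| \<le>o natLeq"
    using countable_card_le_natLeq by blast
  moreover have "|Field ?r| =o ?r"
    by (rule card_of_Field_ordIso) (rule cardSuc_Card_order[OF natLeq_Card_order])
  ultimately have "?r \<le>o natLeq"
    using ordIso_ordLeq_trans ordIso_symmetric by blast
  then show False
    using cardSuc_greater[OF natLeq_Card_order] not_ordLess_ordLeq by blast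
qed

lemma countable_below_omega1:
  includes cardinal_syntax
  shows "countable {..< a :: omega1}"
proof -
  let ?r = "cardSuc natLeq"
  let ?U = "underS ?r (Rep_omega1 a)"
  have "|?U| <o ?r"
    by (rule card_of_underS[OF cardSuc_Card_order[OF natLeq_Card_order] Rep_omega1])
  then have "|?U| \<le>o natLeq"
    using cardSuc_ordLeq_ordLess[OF natLeq_Card_order card_of_Card_order] by blast
  then have "countable ?U"
    using countable_card_le_natLeq by blast
  moreover have "Rep_omega1 ` {..<a} \<subseteq> ?U"
    by (auto simp: underS_def less_omega1_def less_eq_omega1_def Rep_omega1_inject)
  ultimately have "countable (Rep_omega1 ` {..<a})"
    by (rule countable_subset[rotated])
  then show ?thesis
    by (rule countable_image_inj_on) (simp add: inj_on_def Rep_omega1_inject)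
qed


section \<open>The long ray\<close>

typedef closed_long_ray = "(UNIV :: omega1 set) \<times> {0..<1::real}"
  by (intro exI[of _ "(undefined, 0)"]) simp

instantiation closed_long_ray :: linorder
begin

definition less_eq_closed_long_ray :: "closed_long_ray \<Rightarrow> closed_long_ray \<Rightarrow> bool" where
  "x \<le> y \<longleftrightarrow>
     (let (a, s) = Rep_closed_long_ray x; (b, t) = Rep_closed_long_ray y
      in a < b \<or> a = b \<and> s \<le> t)"

definition less_closed_long_ray :: "closed_long_ray \<Rightarrow> closed_long_ray \<Rightarrow> bool" where
  "x < y \<longleftrightarrow>
     (let (a, s) = Rep_closed_long_ray x; (b, t) = Rep_closed_long_ray y
      in a < b \<or> a = b \<and> s < t)"

instance
proof
  fix x y z :: closed_long_ray
  show "x < y \<longleftrightarrow> x \<le> y \<and> \<not> y \<le> x" "x \<le> x" "x \<le> y \<Longrightarrow> y \<le> z \<Longrightarrow> x \<le> z" "x \<le> y \<or> y \<le> x"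
    by (auto simp: less_eq_closed_long_ray_def less_closed_long_ray_def split: prod.splits)
  show "x \<le> y \<Longrightarrow> y \<le> x \<Longrightarrow> x = y"
    by (auto simp: less_eq_closed_long_ray_def simp flip: Rep_closed_long_ray_inject
        split: prod.splits)
qed

end

instantiation closed_long_ray :: linorder_topology
begin

definition open_closed_long_ray :: "closed_long_ray set \<Rightarrow> bool" where
  "open_closed_long_ray = generate_topology (range (\<lambda>a. {..<a}) \<union> range (\<lambda>a. {a<..}))"

instance
  by standard (rule open_closed_long_ray_def)

end

definition ord_point :: "omega1 \<Rightarrow> closed_long_ray"
  where "ord_point \<alpha> = Abs_closed_long_ray (\<alpha>, 0)"

instantiation closed_long_ray :: zero
begin

definition zero_closed_long_ray :: closed_long_ray
  where "0 = ord_point (LEAST a. True)"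

instance ..

end

definition long_ray :: "closed_long_ray set"
  where "long_ray = UNIV - {0}"

definition long_ray_above :: "closed_long_ray \<Rightarrow> closed_long_ray set"
  where "long_ray_above a = {x \<in> long_ray. a < x}"

definition unbounded_in_long_ray :: "closed_long_ray set \<Rightarrow> bool"
  where "unbounded_in_long_ray C \<longleftrightarrow> \<not> (\<exists>b\<in>long_ray. \<forall>x\<in>C. x \<le> b)"


section \<open>Foliations\<close>

text \<open>A chart is a pair of an open set \<open>U\<close> and a function whose values outside \<open>U\<close> are
  irrelevant. The dimension of the leaves is \<open>DIM('p)\<close> and the codimension is \<open>DIM('q)\<close>.\<close>

type_synonym ('m, 'p, 'q) fchart = "'m set \<times> ('m \<Rightarrow> 'p \<times> 'q)"

definition chart_on :: "'m topology \<Rightarrow> 'm set \<Rightarrow> ('m \<Rightarrow> 'e::euclidean_space) \<Rightarrow> bool" where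
  "chart_on X U \<phi> \<longleftrightarrow>
     openin X U \<and> open (\<phi> ` U) \<and> homeomorphic_map (subtopology X U) (top_of_set (\<phi> ` U)) \<phi>"

definition foliated_change ::
  "('m, 'p::euclidean_space, 'q::euclidean_space) fchart \<Rightarrow> ('m, 'p, 'q) fchart \<Rightarrow> bool" where
  "foliated_change = (\<lambda>(U, \<phi>) (V, \<psi>). \<exists>g h.
     (\<forall>(x, y) \<in> \<phi> ` (U \<inter> V). \<psi> (inv_into U \<phi> (x, y)) = (g (x, y), h y)) \<and>
     embedding_map (top_of_set (snd ` \<phi> ` (U \<inter> V))) euclidean h)"

definition foliated_atlas ::
  "'m topology \<Rightarrow> ('m, 'p::euclidean_space, 'q::euclidean_space) fchart set \<Rightarrow> bool" where
  "foliated_atlas X A \<longleftrightarrow>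
     (\<forall>(U, \<phi>) \<in> A. chart_on X U \<phi>) \<and> (\<Union>(U, \<phi>) \<in> A. U) = topspace X \<and>
     (\<forall>c \<in> A. \<forall>d \<in> A. foliated_change c d)"

definition foliation ::
  "'m topology \<Rightarrow> ('m, 'p::euclidean_space, 'q::euclidean_space) fchart set \<Rightarrow> bool" where
  "foliation X F \<longleftrightarrow>
     connected_space X \<and> Hausdorff_space X \<and> foliated_atlas X F \<and>
     (\<forall>A. foliated_atlas X A \<and> F \<subseteq> A \<longrightarrow> A = F)"

definition plaques ::
  "'m topology \<Rightarrow> ('m, 'p::euclidean_space, 'q::euclidean_space) fchart set \<Rightarrow> 'm set set" where
  "plaques X F =
     (\<Union>(U, \<phi>) \<in> F. \<Union>y. connected_components_of (subtopology X {m \<in> U. snd (\<phi> m) = y}))"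

definition leaf_topology ::
  "'m topology \<Rightarrow> ('m, 'p::euclidean_space, 'q::euclidean_space) fchart set \<Rightarrow> 'm topology" where
  "leaf_topology X F = topology_generated_by (plaques X F)"

definition leaves ::
  "'m topology \<Rightarrow> ('m, 'p::euclidean_space, 'q::euclidean_space) fchart set \<Rightarrow> 'm set set" where
  "leaves X F = path_components_of (leaf_topology X F)"

definition restrict_foliation ::
  "('m, 'p, 'q) fchart set \<Rightarrow> 'm set \<Rightarrow> ('m, 'p, 'q) fchart set" where
  "restrict_foliation F W = {(U, \<phi>) \<in> F. U \<subseteq> W}"

definition vertical_product_chart ::
  "'a::topological_space set \<Rightarrow> 'b::topological_space set \<Rightarrow>
   ('a \<times> 'b, 'p::euclidean_space, 'q::euclidean_space) fchart \<Rightarrow> bool" where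
  "vertical_product_chart S L = (\<lambda>(U, \<phi>). \<exists>A B \<theta> \<psi>. U = A \<times> B \<and>
     chart_on (top_of_set S) A \<theta> \<and> chart_on (top_of_set L) B \<psi> \<and>
     (\<forall>x\<in>A. \<forall>t\<in>B. \<phi> (x, t) = (\<psi> t, \<theta> x)))"

text \<open>The trivial product foliation on \<open>S \<times> L\<close> by the sets \<open>{x} \<times> L\<close> is the one
  given by an atlas of product charts. It is not stated as an equality of maximal atlases: the
  charts of a maximal atlas with domain inside an open set need not form a maximal atlas of that
  set, since \<open>foliated_change\<close> requires one \<open>h\<close> for the whole overlap and is therefore
  not a local condition.\<close>

definition trivial_vertical_foliation ::
  "'a::topological_space set \<Rightarrow> 'b::topological_space set \<Rightarrow>
   ('a \<times> 'b, 'p::euclidean_space, 'q::euclidean_space) fchart set \<Rightarrow> bool" where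
  "trivial_vertical_foliation S L F \<longleftrightarrow>
     foliated_atlas (top_of_set (S \<times> L)) F \<and>
     (\<exists>P \<subseteq> F. foliated_atlas (top_of_set (S \<times> L)) P \<and> (\<forall>c\<in>P. vertical_product_chart S L c))"

abbreviation circle :: "complex set"
  where "circle \<equiv> sphere 0 1"

abbreviation long_cylinder :: "(complex \<times> closed_long_ray) topology"
  where "long_cylinder \<equiv> top_of_set (circle \<times> long_ray)"

definition ultimately_vertical :: "(complex \<times> closed_long_ray, real, real) fchart set \<Rightarrow> bool" where
  "ultimately_vertical F \<longleftrightarrow> (\<exists>\<alpha> :: omega1.
     let L = long_ray_above (ord_point \<alpha>); G = restrict_foliation F (circle \<times> L) in
       trivial_vertical_foliation circle L G \<and>
       leaves (top_of_set (circle \<times> L)) G = {{x} \<times> L | x. x \<in> circle})"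

end

(*
  Near a limit height every circle is covered by boxes contained in foliated charts.
  By compactness and a pressing-down argument there are a height beta and a radius e
  such that, for every arc A of radius e and every alpha > beta, some single chart
  contains A x (beta, alpha).  The transverse coordinates u_alpha of these charts agree
  up to embeddings of the line, so "the points p and q have equal transverse coordinate"
  does not depend on alpha.

  Fix x in A.  Two closed unbounded subsets of the long ray meet.  Hence either s |-> (x, s)
  eventually avoids every value taken by the transverse coordinate below any given height,
  or that coordinate has a cluster value and is eventually constant along {x} x L.  Both
  conditions are closed in x, so by connectedness one of them holds on all of A, and
  countable dense subsets make it uniform in x.  Overlapping arcs share points, so the
  alternative is the same for the whole circle.

  If all coordinates are eventually constant, plaques are eventually locally vertical and
  the charts can be replaced by product charts.  Otherwise choose t_0 < t_1 < ... such that
  above t_(n+1) no value from below t_n recurs.  At the limit t the transverse coordinate is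
  constant on A x {t}, since two different values would give, by the intermediate value
  theorem, a common value at two heights t_n < t_(n+2).  So the set of such t is closed and
  unbounded; intersecting over finitely many arcs yields heights t at which the whole circle
  is a leaf.
*)
theory Submission
  imports Defs
begin

section \<open>The long ray as a linear continuum\<close>

text \<open>The half-line over one point is not second countable, so no chart into the plane
  contains a strip over all heights. This forces a family of charts indexed by the height and a way
  to compare levels across it. The comparison rests on \<open>foliated_change\<close> asking for one
  embedding \<open>h\<close> on the whole overlap, connected or not: two points lying in two common
  charts have equal transverse coordinates in both or in neither. The passage from pointwise to
  uniform statements always has the same source: countably many heights have a common upper bound.
  It is applied to radii shrinking to zero, to convergent sequences and to countable dense sets.
  Closedness of \<open>C\<close> holds for every foliation, so only its unboundedness separates the
  alternatives. They exclude each other because a leaf contains every plaque that it meets, whereas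
  high up every plaque has vertical extent.\<close>

lemma bounded_countable_omega1:
  fixes S :: "omega1 set"
  assumes "countable S"
  shows "\<exists>b. \<forall>a\<in>S. a < b"
proof (rule ccontr)
  assume "\<not> ?thesis"
  then have "\<forall>b. \<exists>a\<in>S. b \<le> a" by (simp add: not_less)
  then have "UNIV = (\<Union>a\<in>S. insert a {..<a})"
    by (fastforce simp: le_less)
  moreover have "countable (\<Union>a\<in>S. insert a {..<a})"
    using assms by (intro countable_UN countable_insert countable_below_omega1) auto
  ultimately show False
    using uncountable_omega1 by simp
qed

definition long_point :: "omega1 \<Rightarrow> real \<Rightarrow> closed_long_ray"
  where "long_point a r = Abs_closed_long_ray (a, r)"

lemma Rep_long_point [simp]: "0 \<le> r \<Longrightarrow> r < 1 \<Longrightarrow> Rep_closed_long_ray (long_point a r) = (a, r)"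
  unfolding long_point_def by (rule Abs_closed_long_ray_inverse) auto

lemma long_point_cases:
  obtains a r where "x = long_point a r" "0 \<le> r" "r < 1"
  by (metis Rep_closed_long_ray Rep_closed_long_ray_inverse atLeastLessThan_iff long_point_def
      mem_Sigma_iff prod.exhaust)

lemma long_point_less [simp]:
  "\<lbrakk>0 \<le> r; r < 1; 0 \<le> s; s < 1\<rbrakk> \<Longrightarrow> long_point a r < long_point b s \<longleftrightarrow> a < b \<or> a = b \<and> r < s"
  by (simp add: less_closed_long_ray_def)

lemma long_point_le [simp]:
  "\<lbrakk>0 \<le> r; r < 1; 0 \<le> s; s < 1\<rbrakk> \<Longrightarrow> long_point a r \<le> long_point b s \<longleftrightarrow> a < b \<or> a = b \<and> r \<le> s"
  by (simp add: less_eq_closed_long_ray_def)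

lemma ord_point_eq: "ord_point a = long_point a 0"
  by (simp add: ord_point_def long_point_def)

lemma zero_le_closed_long_ray [simp]: "(0::closed_long_ray) \<le> x"
proof -
  obtain a r where x: "x = long_point a r" "0 \<le> r" "r < 1" by (rule long_point_cases)
  have "(LEAST a::omega1. True) \<le> a" by (rule Least_le) simp
  then show ?thesis
    using x by (auto simp: zero_closed_long_ray_def ord_point_eq)
qed

text \<open>The well-order supplies the least first coordinate \<open>a\<close> of an upper bound;
  what remains is a supremum of reals over that one ordinal. Some upper bound has the form
  \<open>long_point a r\<close> with \<open>r < 1\<close>, which keeps the real supremum below
  \<open>1\<close>.\<close>

lemma closed_long_ray_lub:
  fixes S :: "closed_long_ray set"
  assumes "S \<noteq> {}" "bdd_above S"
  shows "\<exists>u. (\<forall>x\<in>S. x \<le> u) \<and> (\<forall>v. (\<forall>x\<in>S. x \<le> v) \<longrightarrow> u \<le> v)"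
proof -
  let ?ub = "\<lambda>u. \<forall>x\<in>S. x \<le> u"
  let ?P = "\<lambda>a. \<exists>r. 0 \<le> r \<and> r < 1 \<and> ?ub (long_point a r)"
  define a where "a = (LEAST a. ?P a)"
  obtain u where u: "?ub u" using assms(2) by (auto simp: bdd_above_def)
  obtain a0 r0 where "u = long_point a0 r0" "0 \<le> r0" "r0 < 1" by (rule long_point_cases)
  with u have "?P a0" by auto
  then have "?P a" unfolding a_def by (rule LeastI)
  then obtain r where r: "0 \<le> r" "r < 1" "?ub (long_point a r)" by blast
  have least: "a \<le> b" if "?P b" for b
    unfolding a_def using that by (rule Least_le)
  \<comment> \<open>The added \<open>0\<close> covers the case that no point of \<open>S\<close>
    lies over \<open>a\<close>; the supremum is then the ordinal point at \<open>a\<close>.\<close>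
  define R where "R = insert 0 {s. 0 \<le> s \<and> s < 1 \<and> long_point a s \<in> S}"
  have Rr: "s \<le> r" if "s \<in> R" for s
    using that r by (auto simp: R_def)
  then have bdd: "bdd_above R" by (auto simp: bdd_above_def)
  have s0: "0 \<le> Sup R" by (rule cSup_upper[OF _ bdd]) (simp add: R_def)
  have "Sup R \<le> r" by (rule cSup_least) (use Rr in \<open>auto simp: R_def\<close>)
  then have s1: "Sup R < 1" using r by simp
  show ?thesis
  proof (intro exI[of _ "long_point a (Sup R)"] conjI ballI allI impI)
    fix x assume x: "x \<in> S"
    obtain b s where bs: "x = long_point b s" "0 \<le> s" "s < 1" by (rule long_point_cases)
    have "x \<le> long_point a r" using r x by blast
    then have "b < a \<or> b = a" using bs r by auto
    moreover have "s \<le> Sup R" if "b = a"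
      using that x bs by (intro cSup_upper[OF _ bdd]) (auto simp: R_def)
    ultimately show "x \<le> long_point a (Sup R)" using bs s0 s1 by auto
  next
    fix v assume v: "?ub v"
    obtain b s where bs: "v = long_point b s" "0 \<le> s" "s < 1" by (rule long_point_cases)
    then have "a \<le> b" using v by (intro least) auto
    moreover have "Sup R \<le> s" if "a = b"
    proof (rule cSup_least)
      show "R \<noteq> {}" by (simp add: R_def)
      show "t \<le> s" if "t \<in> R" for t
        using that v bs \<open>a = b\<close> by (auto simp: R_def)
    qed
    ultimately show "long_point a (Sup R) \<le> v" using bs s0 s1 by auto
  qed
qed

instantiation closed_long_ray :: linear_continuum_topology
begin

definition sup_closed_long_ray :: "closed_long_ray \<Rightarrow> closed_long_ray \<Rightarrow> closed_long_ray"
  where "sup_closed_long_ray = max"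

definition inf_closed_long_ray :: "closed_long_ray \<Rightarrow> closed_long_ray \<Rightarrow> closed_long_ray"
  where "inf_closed_long_ray = min"

definition Sup_closed_long_ray :: "closed_long_ray set \<Rightarrow> closed_long_ray"
  where "Sup S = (SOME u. (\<forall>x\<in>(S::closed_long_ray set). x \<le> u) \<and> (\<forall>v. (\<forall>x\<in>S. x \<le> v) \<longrightarrow> u \<le> v))"

text \<open>Since \<open>0\<close> is always a lower bound, infima reduce to completeness from
  above.\<close>

definition Inf_closed_long_ray :: "closed_long_ray set \<Rightarrow> closed_long_ray"
  where "Inf S = Sup {u. \<forall>x\<in>(S::closed_long_ray set). u \<le> x}"

instance
proof
  have Sup: "(\<forall>x\<in>S. x \<le> Sup S) \<and> (\<forall>v. (\<forall>x\<in>S. x \<le> v) \<longrightarrow> Sup S \<le> v)"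
    if "S \<noteq> {}" "bdd_above S" for S :: "closed_long_ray set"
    unfolding Sup_closed_long_ray_def using closed_long_ray_lub[OF that] by (rule someI_ex)
  fix x y z :: closed_long_ray and S :: "closed_long_ray set"
  show "inf x y \<le> x" "inf x y \<le> y" "x \<le> sup x y" "y \<le> sup x y"
    by (auto simp: inf_closed_long_ray_def sup_closed_long_ray_def)
  show "x \<le> inf y z" if "x \<le> y" "x \<le> z"
    using that by (auto simp: inf_closed_long_ray_def)
  show "sup y z \<le> x" if "y \<le> x" "z \<le> x"
    using that by (auto simp: sup_closed_long_ray_def)
  show "x \<le> Sup S" if "x \<in> S" "bdd_above S"
    using Sup[of S] that by auto
  show "Sup S \<le> x" if "S \<noteq> {}" "\<And>y. y \<in> S \<Longrightarrow> y \<le> x"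
    using Sup[of S] that by (auto simp: bdd_above_def)
  let ?L = "{u. \<forall>x\<in>S. u \<le> x}"
  have L: "?L \<noteq> {}" using zero_le_closed_long_ray by blast
  show "Inf S \<le> x" if "x \<in> S" "bdd_below S"
    using Sup[of ?L] L that unfolding Inf_closed_long_ray_def by (auto simp: bdd_above_def)
  show "x \<le> Inf S" if "S \<noteq> {}" "\<And>y. y \<in> S \<Longrightarrow> x \<le> y"
  proof -
    have "bdd_above ?L" using that(1) by (auto simp: bdd_above_def)
    then show ?thesis
      using Sup[of ?L] L that(2) unfolding Inf_closed_long_ray_def by auto
  qed
  show "\<exists>z>x. z < y" if "x < y"
  proof -
    obtain a r where x: "x = long_point a r" "0 \<le> r" "r < 1" by (rule long_point_cases)
    obtain b s where y: "y = long_point b s" "0 \<le> s" "s < 1" by (rule long_point_cases)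
    show ?thesis
    proof (cases "a = b")
      case True
      with that x y have "r < s" by auto
      then show ?thesis
        using x y True by (intro exI[of _ "long_point a ((r + s) / 2)"]) auto
    next
      case False
      with that x y have "a < b" by auto
      then show ?thesis
        using x y by (intro exI[of _ "long_point a ((r + 1) / 2)"]) auto
    qed
  qed
  show "\<exists>a b :: closed_long_ray. a \<noteq> b"
  proof (intro exI)
    have "long_point undefined 0 < long_point undefined (1/2)" by simp
    then show "long_point undefined 0 \<noteq> long_point undefined (1/2)" by (rule less_imp_neq)
  qed
qed

end

lemma ord_point_above_countable:
  fixes S :: "closed_long_ray set"
  assumes "countable S"
  shows "\<exists>\<alpha>. \<forall>x\<in>S. x < ord_point \<alpha>"
proof -
  obtain b where b: "\<forall>a\<in>(fst \<circ> Rep_closed_long_ray) ` S. a < b"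
    using bounded_countable_omega1[OF countable_image[OF assms]] by blast
  have "x < ord_point b" if "x \<in> S" for x
  proof -
    obtain a r where x: "x = long_point a r" "0 \<le> r" "r < 1" by (rule long_point_cases)
    moreover have "fst (Rep_closed_long_ray x) < b" using b that by simp
    ultimately show ?thesis by (simp add: ord_point_eq)
  qed
  then show ?thesis by blast
qed

lemma countable_bounded_long_ray:
  fixes S :: "closed_long_ray set"
  assumes "countable S"
  shows "\<exists>b. \<forall>x\<in>S. x < b"
  using ord_point_above_countable[OF assms] by blast

instance closed_long_ray :: no_top
proof
  fix x :: closed_long_ray
  show "\<exists>y. x < y" using countable_bounded_long_ray[of "{x}"] by auto
qed

lemma long_ray_eq: "long_ray = {0<..}"
  by (auto simp: long_ray_def less_le)

lemma open_long_ray: "open long_ray"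
  by (simp add: long_ray_eq)

lemma greaterThan_subset_long_ray: "{b<..} \<subseteq> long_ray"
  using le_less_trans[OF zero_le_closed_long_ray] by (auto simp: long_ray_eq)

lemma long_ray_above_eq: "long_ray_above a = {a<..}"
  using le_less_trans[OF zero_le_closed_long_ray] by (auto simp: long_ray_above_def long_ray_eq)

section \<open>Countable limits, closed unbounded sets and pressing down\<close>

lemma increasing_limit_long_ray:
  fixes t :: "nat \<Rightarrow> closed_long_ray"
  assumes "\<And>n. t n < t (Suc n)"
  obtains l where "\<And>n. t n < l" "\<And>b. b < l \<Longrightarrow> \<exists>n. b < t n"
proof -
  have bdd: "bdd_above (range t)"
    using countable_bounded_long_ray[of "range t"] by (auto simp: bdd_above_def intro: less_imp_le)
  show thesis
  proof
    fix n
    have "t (Suc n) \<le> Sup (range t)" by (rule cSup_upper) (use bdd in auto)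
    then show "t n < Sup (range t)" using assms[of n] by simp
  next
    fix b assume "b < Sup (range t)"
    then show "\<exists>n. b < t n" by (subst (asm) less_cSup_iff) (use bdd in auto)
  qed
qed

text \<open>Bounds range over the closed ray, which spares membership in \<open>long_ray\<close>;
  the final proof identifies this with \<open>unbounded_in_long_ray\<close> for the set
  \<open>C\<close>.\<close>

definition unbounded_above :: "closed_long_ray set \<Rightarrow> bool"
  where "unbounded_above S \<longleftrightarrow> (\<forall>b. \<exists>x\<in>S. b < x)"

lemma unbounded_above_mono: "unbounded_above S \<Longrightarrow> S \<subseteq> S' \<Longrightarrow> unbounded_above S'"
  unfolding unbounded_above_def by blast

lemma unbounded_above_atLeast_Int:
  assumes "unbounded_above S"
  shows "unbounded_above {s \<in> S. b \<le> s}"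
  unfolding unbounded_above_def
proof
  fix c
  obtain s where "s \<in> S" "max b c < s" using assms unfolding unbounded_above_def by blast
  then show "\<exists>s\<in>{s \<in> S. b \<le> s}. c < s" by auto
qed

text \<open>Countably many bounds have a common upper bound, so a countable union of bounded sets is
  bounded. Contraposed, this selects one piece out of countably many that recurs at arbitrarily
  large heights.\<close>

lemma unbounded_above_union_countable:
  assumes "countable I" "unbounded_above (\<Union>i\<in>I. S i)"
  shows "\<exists>i\<in>I. unbounded_above (S i)"
proof (rule ccontr)
  assume "\<not> ?thesis"
  then have "\<forall>i\<in>I. \<exists>b. \<forall>x\<in>S i. x \<le> b" by (auto simp: unbounded_above_def not_less)
  then obtain b where b: "\<And>i x. i \<in> I \<Longrightarrow> x \<in> S i \<Longrightarrow> x \<le> b i" by metis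
  obtain c where "\<And>i. i \<in> I \<Longrightarrow> b i < c"
    using countable_bounded_long_ray[of "b ` I"] assms(1) by auto
  then have "\<not> c < x" if "x \<in> (\<Union>i\<in>I. S i)" for x
    using that b by (meson UN_E less_le_not_le less_trans not_less)
  then show False using assms(2) by (meson unbounded_above_def)
qed

text \<open>The point \<open>x0\<close> below \<open>l\<close> rules out the least element of the
  ray, which has no left neighbourhood of the form \<open>{b<..l}\<close>.\<close>

lemma closed_limit_long_ray:
  fixes S :: "closed_long_ray set"
  assumes "closed S" "x0 < l" "\<And>b. b < l \<Longrightarrow> \<exists>x\<in>S. b < x \<and> x \<le> l"
  shows "l \<in> S"
proof (rule ccontr)
  assume "l \<notin> S"
  then obtain b where "b < l" "{b<..l} \<subseteq> - S"
    using open_left[of "- S" l x0] assms by auto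
  then show False using assms(3)[of b] by auto
qed

text \<open>A sequence that visits \<open>S\<close> and \<open>T\<close> alternately increases to a
  limit of both, and both are closed. The composite \<open>g \<circ> f\<close> makes one round trip:
  \<open>f (t n)\<close> lies in \<open>S\<close> and \<open>t (Suc n)\<close> in
  \<open>T\<close>.\<close>

lemma unbounded_above_closed_inter:
  assumes S: "closed S" "unbounded_above S" and T: "closed T" "unbounded_above T"
  shows "unbounded_above (S \<inter> T)"
  unfolding unbounded_above_def
proof
  fix b
  obtain f where f: "\<And>x. f x \<in> S" "\<And>x. x < f x" using S(2) unfolding unbounded_above_def by metis
  obtain g where g: "\<And>x. g x \<in> T" "\<And>x. x < g x" using T(2) unfolding unbounded_above_def by metis
  define t where "t n = ((g \<circ> f) ^^ n) b" for n
  have t_Suc: "t (Suc n) = g (f (t n))" for n by (simp add: t_def)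
  have step: "t n < t (Suc n)" for n
    unfolding t_Suc using f(2)[of "t n"] g(2)[of "f (t n)"] by simp
  obtain l where l: "\<And>n. t n < l" "\<And>b. b < l \<Longrightarrow> \<exists>n. b < t n"
    by (rule increasing_limit_long_ray[of t, OF step]) blast
  have "l \<in> S"
  proof (rule closed_limit_long_ray[OF S(1) l(1)[of 0]])
    fix b assume "b < l"
    then obtain n where "b < t n" using l(2) by blast
    then show "\<exists>x\<in>S. b < x \<and> x \<le> l"
      using f g(2)[of "f (t n)"] l(1)[of "Suc n"] t_Suc[of n]
      by (intro bexI[of _ "f (t n)"] conjI less_imp_le) (auto elim: less_trans)
  qed
  moreover have "l \<in> T"
  proof (rule closed_limit_long_ray[OF T(1) l(1)[of 0]])
    fix b assume "b < l"
    then obtain n where "b < t n" using l(2) by blast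
    then show "\<exists>x\<in>T. b < x \<and> x \<le> l"
      using g(1) step[of n] l(1)[of "Suc n"] t_Suc[of n]
      by (intro bexI[of _ "t (Suc n)"] conjI less_imp_le) (auto elim: less_trans)
  qed
  moreover have "b < l" using l(1)[of 0] by (simp add: t_def)
  ultimately show "\<exists>x\<in>S \<inter> T. b < x" by blast
qed

lemma unbounded_above_closed_INT:
  assumes "finite I" "\<And>i. i \<in> I \<Longrightarrow> closed (S i)" "\<And>i. i \<in> I \<Longrightarrow> unbounded_above (S i)"
  shows "unbounded_above (\<Inter>i\<in>I. S i)"
  using assms
proof (induction rule: finite_induct)
  case empty
  show ?case by (auto simp: unbounded_above_def gt_ex)
next
  case (insert i I)
  then show ?case by (simp, intro unbounded_above_closed_inter closed_INT) auto
qed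

text \<open>A form of Fodor's lemma with an extra natural-number parameter. If each set of good
  \<open>a\<close> were bounded by some \<open>g n b\<close>, one could iterate past these bounds.
  The limit \<open>l\<close> of the \<open>t n\<close> has its own good pair, which by
  \<open>mono\<close> coarsens to \<open>(k, t k)\<close> for some \<open>k\<close>; but then
  \<open>l \<le> g k (t k) < t (Suc k) < l\<close>.\<close>

lemma pressing_down_long_ray:
  fixes P :: "nat \<Rightarrow> closed_long_ray \<Rightarrow> closed_long_ray \<Rightarrow> bool"
  assumes mono: "\<And>m n b c a. \<lbrakk>P m b a; m \<le> n; b \<le> c; c < a\<rbrakk> \<Longrightarrow> P n c a"
    and ex: "\<And>a. 0 < a \<Longrightarrow> \<exists>n. \<exists>b<a. P n b a"
  shows "\<exists>n b. unbounded_above {a. P n b a}"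
proof (rule ccontr)
  assume "\<not> ?thesis"
  then have "\<forall>n b. \<exists>c. \<forall>a. P n b a \<longrightarrow> a \<le> c" by (auto simp: unbounded_above_def not_less)
  then obtain g where g: "\<And>n b a. P n b a \<Longrightarrow> a \<le> g n b" by metis
  obtain s :: "closed_long_ray \<Rightarrow> closed_long_ray" where s: "\<And>x. x < s x" using gt_ex by metis
  define t where "t = rec_nat 0 (\<lambda>n x. s (max x (g n x)))"
  have t_Suc: "t (Suc n) = s (max (t n) (g n (t n)))" for n by (simp add: t_def)
  have step: "t n < t (Suc n)" "g n (t n) < t (Suc n)" for n
    using s[of "max (t n) (g n (t n))"] by (auto simp: t_Suc)
  obtain l where l: "\<And>n. t n < l" "\<And>b. b < l \<Longrightarrow> \<exists>n. b < t n"
    by (rule increasing_limit_long_ray[of t, OF step(1)]) blast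
  have inc: "m \<le> n \<Longrightarrow> t m \<le> t n" for m n
    using lift_Suc_mono_le[of t] step(1) by (simp add: less_imp_le)
  have "0 < l" using l(1)[of 0] by (simp add: t_def)
  then obtain m b where b: "b < l" "P m b l" using ex by blast
  then obtain k where "b < t k" using l(2) by blast
  \<comment> \<open>One index has to dominate both the parameter \<open>m\<close> and the height
    \<open>b\<close>, since the sequence passes the bounds \<open>g\<close> only along the diagonal
    \<open>(n, t n)\<close>.\<close>
  then have "b \<le> t (max m k)" using inc[of k "max m k"] by simp
  then have "P (max m k) (t (max m k)) l" using mono[OF b(2)] l(1) by simp
  then have "l \<le> g (max m k) (t (max m k))" by (rule g)
  also have "\<dots> < t (Suc (max m k))" by (rule step)
  finally show False using l(1)[of "Suc (max m k)"] by simp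
qed

section \<open>Foliated atlases and their leaves\<close>

lemma chart_on_inj: "chart_on X U \<phi> \<Longrightarrow> inj_on \<phi> U"
  unfolding chart_on_def
  by (metis homeomorphic_imp_injective_map inf.absorb_iff2 openin_subset topspace_subtopology)

lemma chart_on_openin: "chart_on X U \<phi> \<Longrightarrow> openin X U"
  by (simp add: chart_on_def)

lemma chart_on_subset_topspace: "chart_on X U \<phi> \<Longrightarrow> U \<subseteq> topspace X"
  by (simp add: chart_on_def openin_subset)

lemma chart_on_continuous: "chart_on X U \<phi> \<Longrightarrow> continuous_map (subtopology X U) euclidean \<phi>"
  unfolding chart_on_def
  by (meson homeomorphic_imp_continuous_map continuous_map_into_fulltopology)

lemma chart_on_open_image:
  assumes "chart_on X U \<phi>" "openin X W" "W \<subseteq> U"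
  shows "open (\<phi> ` W)"
proof -
  have "openin (subtopology X U) W"
    using assms(2,3) by (metis inf.absorb_iff2 openin_subtopology_Int2)
  then have "openin (top_of_set (\<phi> ` U)) (\<phi> ` W)"
    using assms(1) unfolding chart_on_def
    by (meson homeomorphic_imp_open_map open_map_def)
  then show ?thesis
    using assms(1) by (meson chart_on_def openin_open_trans)
qed

lemma chart_onI:
  assumes U: "openin X U" and cont: "continuous_map (subtopology X U) euclidean \<phi>"
    and inj: "inj_on \<phi> U"
    and op: "\<And>W. openin X W \<Longrightarrow> W \<subseteq> U \<Longrightarrow> open (\<phi> ` W)"
  shows "chart_on X U \<phi>"
proof -
  have ts: "topspace (subtopology X U) = U"
    using openin_subset[OF U] by auto
  have "homeomorphic_map (subtopology X U) (top_of_set (\<phi> ` U)) \<phi>"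
  proof (rule bijective_open_imp_homeomorphic_map)
    show "continuous_map (subtopology X U) (top_of_set (\<phi> ` U)) \<phi>"
      using cont ts by (auto simp: continuous_map_in_subtopology)
    show "open_map (subtopology X U) (top_of_set (\<phi> ` U)) \<phi>"
      unfolding open_map_def
    proof (intro allI impI)
      fix W assume "openin (subtopology X U) W"
      then have "openin X W" "W \<subseteq> U"
        using U by (auto simp: openin_open_subtopology)
      then show "openin (top_of_set (\<phi> ` U)) (\<phi> ` W)"
        using op by (metis image_mono open_subset)
    qed
  qed (use ts inj in auto)
  then show ?thesis using U op[OF U] by (simp add: chart_on_def)
qed

lemma chart_on_subset:
  assumes "chart_on X U \<phi>" "openin X W" "W \<subseteq> U"
  shows "chart_on X W \<phi>"
proof (rule chart_onI)
  show "continuous_map (subtopology X W) euclidean \<phi>"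
    using chart_on_continuous[OF assms(1)] assms(3) by (rule continuous_map_from_subtopology_mono)
  show "inj_on \<phi> W" using chart_on_inj[OF assms(1)] assms(3) by (rule inj_on_subset)
  show "open (\<phi> ` T)" if "openin X T" "T \<subseteq> W" for T
    using that assms(3) by (intro chart_on_open_image[OF assms(1)]) auto
qed (rule assms(2))

lemma chart_on_inverse:
  assumes "chart_on X U \<phi>"
  shows "continuous_map (top_of_set (\<phi> ` U)) (subtopology X U) (inv_into U \<phi>)"
  unfolding continuous_map_def
proof (intro conjI allI impI)
  have ts: "topspace (subtopology X U) = U"
    using chart_on_subset_topspace[OF assms] by auto
  show "inv_into U \<phi> \<in> topspace (top_of_set (\<phi> ` U)) \<rightarrow> topspace (subtopology X U)"
    by (auto simp: ts inv_into_into simp del: topspace_subtopology)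
  fix W assume W: "openin (subtopology X U) W"
  then have sub: "openin X W" "W \<subseteq> U"
    using openin_open_subtopology[OF chart_on_openin[OF assms]] by auto
  have "{y \<in> topspace (top_of_set (\<phi> ` U)). inv_into U \<phi> y \<in> W} = \<phi> ` W"
    using sub chart_on_inj[OF assms] by (auto simp: image_iff subset_iff)
  then show "openin (top_of_set (\<phi> ` U)) {y \<in> topspace (top_of_set (\<phi> ` U)). inv_into U \<phi> y \<in> W}"
    using chart_on_open_image[OF assms sub] sub(2) by (metis image_mono open_subset)
qed

lemma chart_on_openin_vimage:
  assumes "chart_on X U \<phi>" "open J"
  shows "openin X {m \<in> U. \<phi> m \<in> J}"
proof -
  have "topspace (subtopology X U) = U"
    using chart_on_subset_topspace[OF assms(1)] by auto
  then have "openin (subtopology X U) {m \<in> U. \<phi> m \<in> J}"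
    using openin_continuous_map_preimage[OF chart_on_continuous[OF assms(1)], of J] assms(2)
    by simp
  then show ?thesis
    using openin_open_subtopology[OF chart_on_openin[OF assms(1)]] by simp
qed

lemma embedding_map_subset:
  assumes h: "embedding_map (top_of_set S) euclidean h" and TS: "T \<subseteq> S"
  shows "embedding_map (top_of_set T) euclidean h"
proof -
  have "homeomorphic_map (subtopology (top_of_set S) T) (subtopology (top_of_set (h ` S)) (h ` T)) h"
  proof (rule homeomorphic_map_subtopologies)
    show "homeomorphic_map (top_of_set S) (top_of_set (h ` S)) h"
      using h by (simp add: embedding_map_def)
  qed (use TS in auto)
  then show ?thesis
    using TS by (simp add: embedding_map_def subtopology_subtopology Int_absorb1 image_mono)
qed

text \<open>The leafwise component \<open>g\<close> may be any function, so it can always be read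
  off from \<open>\<psi>\<close> after inverting \<open>\<phi>\<close>; injectivity of
  \<open>\<phi>\<close> makes \<open>inv_into\<close> a true inverse. All content lies in the
  transverse map \<open>h\<close>.\<close>

lemma foliated_change_iff:
  assumes "inj_on \<phi> U"
  shows "foliated_change (U, \<phi>) (V, \<psi>) \<longleftrightarrow>
    (\<exists>h. (\<forall>m\<in>U \<inter> V. snd (\<psi> m) = h (snd (\<phi> m))) \<and>
         embedding_map (top_of_set (snd ` \<phi> ` (U \<inter> V))) euclidean h)"
proof -
  have inv: "inv_into U \<phi> (\<phi> m) = m" if "m \<in> U" for m
    using assms that by simp
  have eq: "(\<exists>g. \<forall>(x, y) \<in> \<phi> ` (U \<inter> V). \<psi> (inv_into U \<phi> (x, y)) = (g (x, y), h y)) \<longleftrightarrow>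
      (\<forall>m\<in>U \<inter> V. snd (\<psi> m) = h (snd (\<phi> m)))" for h
  proof
    assume "\<exists>g. \<forall>(x, y) \<in> \<phi> ` (U \<inter> V). \<psi> (inv_into U \<phi> (x, y)) = (g (x, y), h y)"
    then obtain g where g: "\<And>x y. (x, y) \<in> \<phi> ` (U \<inter> V) \<Longrightarrow> \<psi> (inv_into U \<phi> (x, y)) = (g (x, y), h y)"
      by blast
    show "\<forall>m\<in>U \<inter> V. snd (\<psi> m) = h (snd (\<phi> m))"
    proof
      fix m assume m: "m \<in> U \<inter> V"
      then have "\<psi> (inv_into U \<phi> (fst (\<phi> m), snd (\<phi> m))) = (g (fst (\<phi> m), snd (\<phi> m)), h (snd (\<phi> m)))"
        by (intro g) auto
      then show "snd (\<psi> m) = h (snd (\<phi> m))" using m by (simp add: inv)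
    qed
  next
    assume h: "\<forall>m\<in>U \<inter> V. snd (\<psi> m) = h (snd (\<phi> m))"
    show "\<exists>g. \<forall>(x, y) \<in> \<phi> ` (U \<inter> V). \<psi> (inv_into U \<phi> (x, y)) = (g (x, y), h y)"
    proof (intro exI[of _ "\<lambda>z. fst (\<psi> (inv_into U \<phi> z))"] ballI, clarify)
      fix x y m assume m: "(x, y) = \<phi> m" "m \<in> U" "m \<in> V"
      then have "h y = snd (\<psi> m)" using h by (metis IntI snd_conv)
      then show "\<psi> (inv_into U \<phi> (x, y)) = (fst (\<psi> (inv_into U \<phi> (x, y))), h y)"
        using m by (simp add: inv)
    qed
  qed
  have "foliated_change (U, \<phi>) (V, \<psi>) \<longleftrightarrow>
    (\<exists>h. (\<exists>g. \<forall>(x, y) \<in> \<phi> ` (U \<inter> V). \<psi> (inv_into U \<phi> (x, y)) = (g (x, y), h y)) \<and>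
         embedding_map (top_of_set (snd ` \<phi> ` (U \<inter> V))) euclidean h)"
    unfolding foliated_change_def prod.case by blast
  then show ?thesis by (simp only: eq)
qed

lemma foliated_atlas_chart: "foliated_atlas X F \<Longrightarrow> (U, \<phi>) \<in> F \<Longrightarrow> chart_on X U \<phi>"
  by (auto simp: foliated_atlas_def)

lemma foliated_atlas_cover:
  assumes "foliated_atlas X F" "m \<in> topspace X"
  obtains U \<phi> where "(U, \<phi>) \<in> F" "m \<in> U"
proof -
  have "m \<in> (\<Union>(U, \<phi>)\<in>F. U)" using assms by (simp add: foliated_atlas_def)
  then show thesis using that by auto
qed

lemma foliated_atlas_transition:
  assumes "foliated_atlas X F" "(U, \<phi>) \<in> F" "(V, \<psi>) \<in> F"
  obtains h where "\<And>m. m \<in> U \<Longrightarrow> m \<in> V \<Longrightarrow> snd (\<psi> m) = h (snd (\<phi> m))"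
    and "embedding_map (top_of_set (snd ` \<phi> ` (U \<inter> V))) euclidean h"
proof -
  have "foliated_change (U, \<phi>) (V, \<psi>)"
    using assms unfolding foliated_atlas_def by blast
  then show thesis
    using that foliated_change_iff[OF chart_on_inj[OF foliated_atlas_chart[OF assms(1,2)]]]
    by auto
qed

text \<open>The transition function in each direction carries equal levels to equal levels. As one
  \<open>h\<close> serves the entire overlap, this covers points in different components of
  it.\<close>

lemma foliated_atlas_same_level:
  assumes "foliated_atlas X F" "(U, \<phi>) \<in> F" "(V, \<psi>) \<in> F"
    and "m \<in> U" "m \<in> V" "m' \<in> U" "m' \<in> V"
  shows "snd (\<phi> m) = snd (\<phi> m') \<longleftrightarrow> snd (\<psi> m) = snd (\<psi> m')"
proof -
  have *: "snd (\<psi> m) = snd (\<psi> m')" if "(U, \<phi>) \<in> F" "(V, \<psi>) \<in> F"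
    "m \<in> U" "m \<in> V" "m' \<in> U" "m' \<in> V" "snd (\<phi> m) = snd (\<phi> m')" for U V \<phi> \<psi>
    using foliated_atlas_transition[OF assms(1) that(1,2)] that(3-) by metis
  show ?thesis using * assms by blast
qed

text \<open>\<open>foliated_change\<close> only constrains transverse coordinates, so every transition to or from
  \<open>\<psi>\<close> can reuse the embedding that works for \<open>\<phi>\<close>.\<close>

lemma foliation_refine:
  fixes F :: "('m, 'p::euclidean_space, 'q::euclidean_space) fchart set"
  assumes F: "foliation X F" and U: "(U, \<phi>) \<in> F"
    and W: "chart_on X W \<psi>" "W \<subseteq> U" and eq: "\<And>m. m \<in> W \<Longrightarrow> snd (\<psi> m) = snd (\<phi> m)"
  shows "(W, \<psi>) \<in> F"
proof -
  have at: "foliated_atlas X F" using F by (simp add: foliation_def)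
  have img: "snd ` \<psi> ` (W \<inter> V) = snd ` \<phi> ` (W \<inter> V)" for V
    using eq by (force simp: image_iff)
  have emb: "embedding_map (top_of_set (snd ` \<phi> ` (W \<inter> V))) euclidean h"
    if "embedding_map (top_of_set (snd ` \<phi> ` (U \<inter> V))) euclidean h" for V and h :: "'q \<Rightarrow> 'q"
  proof -
    have sub: "snd ` \<phi> ` (W \<inter> V) \<subseteq> snd ` \<phi> ` (U \<inter> V)" using W(2) by blast
    show ?thesis using embedding_map_subset[OF that sub] .
  qed
  have to_old: "foliated_change (W, \<psi>) (V, \<zeta>)" if V: "(V, \<zeta>) \<in> F" for V \<zeta>
  proof -
    obtain h where h: "\<And>m. m \<in> U \<Longrightarrow> m \<in> V \<Longrightarrow> snd (\<zeta> m) = h (snd (\<phi> m))"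
      "embedding_map (top_of_set (snd ` \<phi> ` (U \<inter> V))) euclidean h"
      by (rule foliated_atlas_transition[OF at U V]) blast
    show ?thesis
      unfolding foliated_change_iff[OF chart_on_inj[OF W(1)]] img
      using h(1) emb[OF h(2)] W(2) eq by (intro exI[of _ h]) auto
  qed
  have from_old: "foliated_change (V, \<zeta>) (W, \<psi>)" if V: "(V, \<zeta>) \<in> F" for V \<zeta>
  proof -
    obtain h where h: "\<And>m. m \<in> V \<Longrightarrow> m \<in> U \<Longrightarrow> snd (\<phi> m) = h (snd (\<zeta> m))"
      "embedding_map (top_of_set (snd ` \<zeta> ` (V \<inter> U))) euclidean h"
      by (rule foliated_atlas_transition[OF at V U]) blast
    have sub: "snd ` \<zeta> ` (V \<inter> W) \<subseteq> snd ` \<zeta> ` (V \<inter> U)" using W(2) by blast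
    have "embedding_map (top_of_set (snd ` \<zeta> ` (V \<inter> W))) euclidean h"
      using h(2) sub by (rule embedding_map_subset)
    then show ?thesis
      unfolding foliated_change_iff[OF chart_on_inj[OF foliated_atlas_chart[OF at V]]]
      using h(1) W(2) eq by (intro exI[of _ h]) auto
  qed
  have self: "foliated_change (W, \<psi>) (W, \<psi>)"
    unfolding foliated_change_iff[OF chart_on_inj[OF W(1)]]
    by (intro exI[of _ id]) (auto simp: embedding_map_def)
  have "foliated_atlas X (insert (W, \<psi>) F)"
    unfolding foliated_atlas_def
  proof (intro conjI)
    show "\<forall>(U, \<phi>)\<in>insert (W, \<psi>) F. chart_on X U \<phi>"
      using at W(1) by (auto simp: foliated_atlas_def)
    have "(\<Union>(U, \<phi>)\<in>F. U) = topspace X" using at by (simp add: foliated_atlas_def)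
    then show "(\<Union>(U, \<phi>)\<in>insert (W, \<psi>) F. U) = topspace X"
      using chart_on_subset_topspace[OF W(1)] by auto
    show "\<forall>c\<in>insert (W, \<psi>) F. \<forall>d\<in>insert (W, \<psi>) F. foliated_change c d"
      using at to_old from_old self by (auto simp: foliated_atlas_def)
  qed
  then have "insert (W, \<psi>) F = F"
    using F unfolding foliation_def by blast
  then show ?thesis by blast
qed

text \<open>Maximality allows chart domains to be shrunk to any open subset; later arguments use
  this to keep plaques inside a prescribed region.\<close>

lemma foliation_restrict:
  assumes F: "foliation X F" and U: "(U, \<phi>) \<in> F" and W: "openin X W" "W \<subseteq> U"
  shows "(W, \<phi>) \<in> F"
proof (rule foliation_refine[OF F U _ W(2)])
  show "chart_on X W \<phi>"
    using chart_on_subset[OF foliated_atlas_chart[OF _ U] W] F by (simp add: foliation_def)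
qed auto

section \<open>Plaques, the leaf topology and the recognition of leaves\<close>

lemma plaque_at:
  assumes "(U, \<phi>) \<in> F" "U \<subseteq> topspace X" "m \<in> U"
  obtains P where "P \<in> plaques X F" "m \<in> P" "P \<subseteq> {m' \<in> U. snd (\<phi> m') = snd (\<phi> m)}"
    "connectedin X P"
    "\<And>C. \<lbrakk>connectedin X C; m \<in> C; C \<subseteq> {m' \<in> U. snd (\<phi> m') = snd (\<phi> m)}\<rbrakk> \<Longrightarrow> C \<subseteq> P"
proof -
  let ?S = "{m' \<in> U. snd (\<phi> m') = snd (\<phi> m)}"
  let ?Y = "subtopology X ?S"
  let ?P = "connected_component_of_set ?Y m"
  have m: "m \<in> topspace ?Y" using assms by auto
  have "?P \<in> connected_components_of ?Y"
    using m by (simp add: connected_component_in_connected_components_of)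
  then have "?P \<in> plaques X F"
    using assms(1) unfolding plaques_def by blast
  moreover have "m \<in> ?P" using m by (simp add: connected_component_of_refl)
  moreover have "?P \<subseteq> ?S"
    using connected_component_of_subset_topspace[of ?Y m] by auto
  moreover have "connectedin X ?P"
    using connectedin_connected_component_of[of ?Y m] by (simp add: connectedin_subtopology)
  moreover have "C \<subseteq> ?P" if "connectedin X C" "m \<in> C" "C \<subseteq> ?S" for C
    using that by (intro connected_component_of_maximal) (auto simp: connectedin_subtopology)
  ultimately show thesis using that by blast
qed

lemma plaques_subset_topspace: "P \<in> plaques X F \<Longrightarrow> P \<subseteq> topspace X"
proof -
  assume "P \<in> plaques X F"
  then obtain S where "P \<in> connected_components_of (subtopology X S)"
    unfolding plaques_def by blast
  then have "P \<subseteq> topspace (subtopology X S)" by (rule connected_components_of_subset)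
  then show ?thesis by auto
qed

lemma topspace_leaf_topology:
  assumes "foliated_atlas X F"
  shows "topspace (leaf_topology X F) = topspace X"
proof -
  have "\<exists>P\<in>plaques X F. m \<in> P" if m: "m \<in> topspace X" for m
  proof -
    obtain U \<phi> where U: "(U, \<phi>) \<in> F" "m \<in> U" using foliated_atlas_cover[OF assms m] .
    obtain P where "P \<in> plaques X F" "m \<in> P"
      by (rule plaque_at[OF U(1) chart_on_subset_topspace[OF foliated_atlas_chart[OF assms U(1)]] U(2)])
    then show ?thesis by blast
  qed
  then show ?thesis
    using plaques_subset_topspace[of _ X F] by (auto simp: leaf_topology_def)
qed

text \<open>The preimage of a plaque of another chart is open: a small connected \<open>N\<close>
  has a connected image on one level of that chart, hence inside one component of the level. Local
  connectedness of the parameter space supplies \<open>N\<close>.\<close>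

lemma continuous_map_into_leaf_topology:
  assumes at: "foliated_atlas X F" and U: "(U, \<phi>) \<in> F" and T: "locally_connected_space T"
    and \<sigma>: "continuous_map T X \<sigma>" "\<And>t. t \<in> topspace T \<Longrightarrow> \<sigma> t \<in> U"
    and y: "\<And>t. t \<in> topspace T \<Longrightarrow> snd (\<phi> (\<sigma> t)) = y"
  shows "continuous_map T (leaf_topology X F) \<sigma>"
  unfolding leaf_topology_def
proof (rule continuous_on_generated_topo)
  show "\<sigma> ` topspace T \<subseteq> \<Union> (plaques X F)"
    using topspace_leaf_topology[OF at] continuous_map_image_subset_topspace[OF \<sigma>(1)]
    by (simp add: leaf_topology_def)
next
  fix P assume "P \<in> plaques X F"
  then obtain V \<psi> z where V: "(V, \<psi>) \<in> F"
    and P: "P \<in> connected_components_of (subtopology X {m \<in> V. snd (\<psi> m) = z})"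
    unfolding plaques_def by blast
  have V_open: "openin X V"
    using V at foliated_atlas_chart chart_on_openin by blast
  have PV: "P \<subseteq> {m \<in> V. snd (\<psi> m) = z}"
    using connected_components_of_subset[OF P] by auto
  show "openin T (\<sigma> -` P \<inter> topspace T)"
  proof (subst openin_subopen, intro ballI)
    fix t assume t: "t \<in> \<sigma> -` P \<inter> topspace T"
    have "openin T {t \<in> topspace T. \<sigma> t \<in> V}"
      using \<sigma>(1) V_open by (rule openin_continuous_map_preimage)
    moreover have "t \<in> {t \<in> topspace T. \<sigma> t \<in> V}" using t PV by auto
    ultimately obtain N where N: "openin T N" "connectedin T N" "t \<in> N"
        "N \<subseteq> {t \<in> topspace T. \<sigma> t \<in> V}"
      using T unfolding locally_connected_space by meson
    have level: "snd (\<psi> (\<sigma> s)) = z" if "s \<in> N" for s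
    proof -
      have "snd (\<psi> (\<sigma> s)) = snd (\<psi> (\<sigma> t))"
        using that N t \<sigma>(2) y foliated_atlas_same_level[OF at U V, of "\<sigma> s" "\<sigma> t"] by auto
      then show ?thesis using t PV by auto
    qed
    have "connectedin X (\<sigma> ` N)"
      using \<sigma>(1) N(2) by (rule connectedin_continuous_map_image)
    then have "connectedin (subtopology X {m \<in> V. snd (\<psi> m) = z}) (\<sigma> ` N)"
      using N(4) level by (auto simp: connectedin_subtopology)
    then have "\<sigma> ` N \<subseteq> P"
      using connected_components_of_maximal[OF P] N(3) t by (auto simp: disjnt_iff)
    then show "\<exists>N. openin T N \<and> t \<in> N \<and> N \<subseteq> \<sigma> -` P \<inter> topspace T"
      using N by blast
  qed
qed

text \<open>Leaves are one-dimensional, so \<open>fst \<circ> \<phi>\<close> maps a plaque onto a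
  real interval. The segment between two leafwise coordinates, at the fixed level \<open>y\<close>,
  lifts through the inverse chart to a path inside the plaque.\<close>

lemma path_connectedin_plaque:
  fixes F :: "('m, real, 'q::euclidean_space) fchart set"
  assumes at: "foliated_atlas X F" and P: "P \<in> plaques X F"
  shows "path_connectedin (leaf_topology X F) P"
proof -
  obtain U \<phi> y where U: "(U, \<phi>) \<in> F"
    and P': "P \<in> connected_components_of (subtopology X {m \<in> U. snd (\<phi> m) = y})"
    using P unfolding plaques_def by blast
  have ch: "chart_on X U \<phi>" using at U by (rule foliated_atlas_chart)
  have PU: "P \<subseteq> {m \<in> U. snd (\<phi> m) = y}"
    using connected_components_of_subset[OF P'] by auto
  have "connectedin X P"
    using connectedin_connected_components_of[OF P'] by (simp add: connectedin_subtopology)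
  then have "connectedin (subtopology X U) P" using PU by (auto simp: connectedin_subtopology)
  then have "connectedin euclidean ((fst \<circ> \<phi>) ` P)"
    by (rule connectedin_continuous_map_image[rotated])
       (rule continuous_map_compose[OF chart_on_continuous[OF ch]],
        simp add: continuous_on_fst)
  then have int: "is_interval ((fst \<circ> \<phi>) ` P)" by (simp add: is_interval_connected_1)
  show ?thesis
    unfolding path_connectedin
  proof (intro conjI ballI)
    show "P \<subseteq> topspace (leaf_topology X F)"
      using plaques_subset_topspace[OF P] topspace_leaf_topology[OF at] by simp
    fix p q assume pq: "p \<in> P" "q \<in> P"
    define c where "c \<tau> = ((1 - \<tau>) * fst (\<phi> p) + \<tau> * fst (\<phi> q), y)" for \<tau> :: real
    have c: "c \<tau> \<in> \<phi> ` P" if "\<tau> \<in> {0..1}" for \<tau>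
    proof -
      have "(1 - \<tau>) * fst (\<phi> p) + \<tau> * fst (\<phi> q) \<in> (fst \<circ> \<phi>) ` P"
        using that pq int is_interval_convex_1[of "(fst \<circ> \<phi>) ` P"]
          convexD[of "(fst \<circ> \<phi>) ` P" "fst (\<phi> p)" "fst (\<phi> q)" "1 - \<tau>" \<tau>] by auto
      then obtain m where m: "m \<in> P" "(1 - \<tau>) * fst (\<phi> p) + \<tau> * fst (\<phi> q) = fst (\<phi> m)" by auto
      then have "c \<tau> = \<phi> m" using PU by (auto simp: c_def prod_eq_iff)
      then show ?thesis using m by blast
    qed
    define \<sigma> where "\<sigma> = inv_into U \<phi> \<circ> c"
    have \<sigma>P: "\<sigma> \<tau> \<in> P" if "\<tau> \<in> {0..1}" for \<tau>
      using c[OF that] PU chart_on_inj[OF ch] by (auto simp: \<sigma>_def subset_iff)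
    have "continuous_map (top_of_set {0..1}) (top_of_set (\<phi> ` U)) c"
      using c PU unfolding c_def by (fastforce intro!: continuous_intros)
    then have "continuous_map (top_of_set {0..1}) (subtopology X U) \<sigma>"
      unfolding \<sigma>_def using chart_on_inverse[OF ch] by (rule continuous_map_compose)
    then have "continuous_map (top_of_set {0..1}) X \<sigma>"
      by (rule continuous_map_into_fulltopology)
    then have "continuous_map (top_of_set {0..1}) (leaf_topology X F) \<sigma>"
    proof (rule continuous_map_into_leaf_topology[OF at U, rotated])
      show "locally_connected_space (top_of_set {0..1::real})"
        by (rule locally_path_connected_imp_locally_connected_space)
           (simp add: locally_path_connected_is_realinterval)
      show "\<sigma> \<tau> \<in> U" "snd (\<phi> (\<sigma> \<tau>)) = y" if "\<tau> \<in> topspace (top_of_set {0..1})" for \<tau>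
        using \<sigma>P[of \<tau>] that PU by auto
    qed
    moreover have "\<sigma> ` {0..1} \<subseteq> P" using \<sigma>P by blast
    moreover have "c 0 = \<phi> p" "c 1 = \<phi> q"
      using pq PU by (auto simp: c_def prod_eq_iff)
    then have "\<sigma> 0 = p" "\<sigma> 1 = q"
      using pq PU chart_on_inj[OF ch] by (auto simp: \<sigma>_def)
    ultimately show "\<exists>g. pathin (leaf_topology X F) g \<and> g \<in> {0..1} \<rightarrow> P \<and> g 0 = p \<and> g 1 = q"
      by (auto simp: pathin_def)
  qed
qed

lemma plaque_subset_leaf:
  fixes F :: "('m, real, 'q::euclidean_space) fchart set"
  assumes "foliated_atlas X F" "P \<in> plaques X F" "L \<in> leaves X F" "m \<in> P" "m \<in> L"
  shows "P \<subseteq> L"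
proof (rule path_components_of_maximal)
  show "L \<in> path_components_of (leaf_topology X F)" using assms(3) by (simp add: leaves_def)
  show "path_connectedin (leaf_topology X F) P" using assms(1,2) by (rule path_connectedin_plaque)
  show "\<not> disjnt L P" using assms(4,5) by (auto simp: disjnt_iff)
qed

text \<open>Both inclusions are connectedness arguments, so no path along \<open>Z\<close> has to be
  built. Plaques lie in single leaves, which splits \<open>Z\<close> into relatively open parts
  inside and outside the leaf of \<open>z0\<close>; and \<open>Z\<close> is clopen for the leaf
  topology, so that leaf cannot escape from \<open>Z\<close>.\<close>

lemma leaf_of_plaques:
  fixes F :: "('m, real, 'q::euclidean_space) fchart set"
  assumes at: "foliated_atlas X F" and Z: "connectedin X Z" "Z \<noteq> {}"
    and inside: "\<And>z. z \<in> Z \<Longrightarrow> \<exists>P\<in>plaques X F. z \<in> P \<and> P \<subseteq> Z \<and> openin (subtopology X Z) P"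
    and outside: "\<And>z. z \<in> topspace X - Z \<Longrightarrow> \<exists>P\<in>plaques X F. z \<in> P \<and> P \<inter> Z = {}"
  shows "Z \<in> leaves X F"
proof -
  let ?L = "leaf_topology X F"
  have ZX: "Z \<subseteq> topspace X" using Z(1) by (rule connectedin_subset_topspace)
  have tL: "topspace ?L = topspace X" by (rule topspace_leaf_topology[OF at])
  have plaque_open: "openin ?L P" if "P \<in> plaques X F" for P
    using that unfolding leaf_topology_def by (rule topology_generated_by_Basis)
  obtain z0 where z0: "z0 \<in> Z" using Z(2) by blast
  let ?K = "path_component_of_set ?L z0"
  have K: "?K \<in> leaves X F"
    using z0 ZX tL by (auto simp: leaves_def path_component_in_path_components_of)
  have z0K: "z0 \<in> ?K" using z0 ZX tL by (auto simp: path_component_of_refl)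
  have "Z \<subseteq> ?K"
  proof -
    have near: "\<exists>N. openin (subtopology X Z) N \<and> z \<in> N \<and> (N \<subseteq> ?K \<or> N \<inter> ?K = {})"
      if "z \<in> Z" for z
    proof -
      obtain P where P: "P \<in> plaques X F" "z \<in> P" "openin (subtopology X Z) P"
        using inside \<open>z \<in> Z\<close> by blast
      moreover have "P \<subseteq> ?K \<or> P \<inter> ?K = {}"
        using plaque_subset_leaf[OF at P(1) K] by blast
      ultimately show ?thesis by blast
    qed
    have "openin (subtopology X Z) (Z \<inter> ?K)"
    proof (subst openin_subopen, intro ballI)
      fix z assume "z \<in> Z \<inter> ?K"
      then obtain N where "openin (subtopology X Z) N" "z \<in> N" "N \<subseteq> ?K"
        using near by blast
      then show "\<exists>N. openin (subtopology X Z) N \<and> z \<in> N \<and> N \<subseteq> Z \<inter> ?K"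
        using openin_subset by fastforce
    qed
    moreover have "openin (subtopology X Z) (Z - ?K)"
    proof (subst openin_subopen, intro ballI)
      fix z assume "z \<in> Z - ?K"
      then obtain N where "openin (subtopology X Z) N" "z \<in> N" "N \<inter> ?K = {}"
        using near by blast
      then show "\<exists>N. openin (subtopology X Z) N \<and> z \<in> N \<and> N \<subseteq> Z - ?K"
        using openin_subset by fastforce
    qed
    moreover have "connected_space (subtopology X Z)"
      using Z(1) by (simp add: connectedin_def)
    ultimately have "\<not> (Z \<inter> ?K \<noteq> {} \<and> Z - ?K \<noteq> {})"
      using ZX unfolding connected_space_def
      by (metis (no_types, lifting) Int_Diff_Un Int_Diff_disjoint inf.absorb_iff2 subset_refl
          topspace_subtopology)
    then show ?thesis using z0 z0K by blast
  qed
  moreover have "?K \<subseteq> Z"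
  proof -
    have "openin ?L Z"
    proof (subst openin_subopen, intro ballI)
      fix z assume "z \<in> Z"
      then show "\<exists>N. openin ?L N \<and> z \<in> N \<and> N \<subseteq> Z" using inside plaque_open by blast
    qed
    moreover have "openin ?L (topspace X - Z)"
    proof (subst openin_subopen, intro ballI)
      fix z assume "z \<in> topspace X - Z"
      then obtain P where "P \<in> plaques X F" "z \<in> P" "P \<inter> Z = {}" using outside by blast
      then show "\<exists>N. openin ?L N \<and> z \<in> N \<and> N \<subseteq> topspace X - Z"
        using plaque_open[of P] plaques_subset_topspace[of P X F] by blast
    qed
    ultimately have "closedin ?L Z" "openin ?L Z"
      using ZX tL by (auto simp: closedin_def)
    moreover have "connectedin ?L ?K"
      by (intro path_connectedin_imp_connectedin path_connectedin_path_component_of)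
    ultimately show ?thesis
      using connectedin_clopen_cases[of ?L ?K Z] z0 z0K by (auto simp: disjnt_iff)
  qed
  ultimately have "Z = ?K" by blast
  then show ?thesis using K by simp
qed

lemma leaves_cover:
  assumes "foliated_atlas X F" "L \<in> leaves X F" "\<And>m. m \<in> topspace X \<Longrightarrow> \<exists>Z\<in>\<Z>. m \<in> Z"
    "\<Z> \<subseteq> leaves X F"
  shows "L \<in> \<Z>"
proof -
  obtain m where m: "m \<in> L"
    using assms(2) nonempty_path_components_of unfolding leaves_def by blast
  then have "m \<in> topspace X"
    using assms(2) path_components_of_subset topspace_leaf_topology[OF assms(1)]
    unfolding leaves_def by blast
  then obtain Z where Z: "Z \<in> \<Z>" "m \<in> Z" using assms(3) by blast
  then have "Z = L"
    using assms(2,4) m path_components_of_overlap[of Z "leaf_topology X F" L]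
    unfolding leaves_def by blast
  then show ?thesis using Z by simp
qed

section \<open>Transverse coordinates along a strip\<close>

text \<open>One point is chosen from each member of a countable base of \<open>A\<close>. Heights
  attached to the points of \<open>D\<close> have a common bound, and a relatively open set that
  misses \<open>D\<close> is empty.\<close>

lemma countable_dense_subset:
  fixes A :: "'a::second_countable_topology set"
  obtains D where "countable D" "D \<subseteq> A"
    "\<And>W. openin (top_of_set A) W \<Longrightarrow> W \<noteq> {} \<Longrightarrow> \<exists>d\<in>D. d \<in> W"
proof -
  obtain \<B> where \<B>: "countable \<B>" "{} \<notin> \<B>" "\<And>C. C \<in> \<B> \<Longrightarrow> openin (top_of_set A) C"
    "\<And>T. openin (top_of_set A) T \<Longrightarrow> \<exists>\<U>. \<U> \<subseteq> \<B> \<and> T = \<Union>\<U>"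
    using subset_second_countable[of A] by blast
  have some: "(SOME x. x \<in> C) \<in> C" if "C \<in> \<B>" for C
    using that \<B>(2) by (metis all_not_in_conv someI_ex)
  show thesis
  proof
    show "countable ((\<lambda>C. SOME x. x \<in> C) ` \<B>)" using \<B>(1) by simp
    show "(\<lambda>C. SOME x. x \<in> C) ` \<B> \<subseteq> A"
      using some \<B>(3) openin_imp_subset by blast
    fix W assume W: "openin (top_of_set A) W" "W \<noteq> {}"
    then obtain \<U> where "\<U> \<subseteq> \<B>" "W = \<Union>\<U>" using \<B>(4) by blast
    then obtain C where "C \<in> \<B>" "C \<subseteq> W" using W(2) by blast
    then show "\<exists>d\<in>(\<lambda>C. SOME x. x \<in> C) ` \<B>. d \<in> W" using some by blast
  qed
qed

text \<open>The strip is \<open>A \<times> {\<beta><..}\<close>, and \<open>u \<alpha>\<close> is the transverse coordinate of a chart whose domain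
  contains \<open>A \<times> {\<beta><..<\<alpha>}\<close>. No single chart need contain the whole strip.\<close>

locale foliated_strip =
  fixes A :: "'a::{metric_space, second_countable_topology} set"
    and \<beta> :: closed_long_ray
    and u :: "closed_long_ray \<Rightarrow> 'a \<times> closed_long_ray \<Rightarrow> real"
  assumes connected_A: "connected A"
    and continuous_u: "\<And>\<alpha>. \<beta> < \<alpha> \<Longrightarrow> continuous_on (A \<times> {\<beta><..<\<alpha>}) (u \<alpha>)"
    and open_u: "\<And>\<alpha>. \<beta> < \<alpha> \<Longrightarrow> open (u \<alpha> ` (A \<times> {\<beta><..<\<alpha>}))"
    and transition: "\<And>\<alpha> \<gamma>. \<beta> < \<alpha> \<Longrightarrow> \<alpha> \<le> \<gamma> \<Longrightarrow>
      \<exists>h. continuous_on (u \<alpha> ` (A \<times> {\<beta><..<\<alpha>})) h \<and> inj_on h (u \<alpha> ` (A \<times> {\<beta><..<\<alpha>})) \<and>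
          (\<forall>p\<in>A \<times> {\<beta><..<\<alpha>}. u \<gamma> p = h (u \<alpha> p))"
begin

definition T :: "closed_long_ray \<Rightarrow> ('a \<times> closed_long_ray) set"
  where "T \<alpha> = A \<times> {\<beta><..<\<alpha>}"

lemma T_iff [simp]: "(x, s) \<in> T \<alpha> \<longleftrightarrow> x \<in> A \<and> \<beta> < s \<and> s < \<alpha>"
  by (auto simp: T_def)

lemma T_mono: "\<alpha> \<le> \<gamma> \<Longrightarrow> T \<alpha> \<subseteq> T \<gamma>"
  by (auto simp: T_def)

lemma T_transition:
  assumes "\<beta> < \<alpha>" "\<alpha> \<le> \<gamma>"
  obtains h where "continuous_on (u \<alpha> ` T \<alpha>) h" "inj_on h (u \<alpha> ` T \<alpha>)"
    "\<And>p. p \<in> T \<alpha> \<Longrightarrow> u \<gamma> p = h (u \<alpha> p)"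
  using transition[OF assms] unfolding T_def by blast

lemma u_eq_mono:
  assumes "p \<in> T \<alpha>" "q \<in> T \<alpha>" "\<alpha> \<le> \<gamma>"
  shows "u \<alpha> p = u \<alpha> q \<longleftrightarrow> u \<gamma> p = u \<gamma> q"
proof -
  have "\<beta> < \<alpha>" using assms(1) by (cases p) auto
  then obtain h where "inj_on h (u \<alpha> ` T \<alpha>)" "\<And>p. p \<in> T \<alpha> \<Longrightarrow> u \<gamma> p = h (u \<alpha> p)"
    using T_transition assms(3) by metis
  then show ?thesis using assms(1,2) by (simp add: inj_on_eq_iff)
qed

lemma u_eq_iff:
  assumes "p \<in> T \<alpha>" "q \<in> T \<alpha>" "p \<in> T \<gamma>" "q \<in> T \<gamma>"
  shows "u \<alpha> p = u \<alpha> q \<longleftrightarrow> u \<gamma> p = u \<gamma> q"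
  using u_eq_mono[of p \<alpha> q \<gamma>] u_eq_mono[of p \<gamma> q \<alpha>] assms by (metis linear)

text \<open>The points of the strip whose transverse coordinate, compared in a larger chart, lies in the
  part \<open>S\<close> of the image of \<open>u \<alpha>\<close>.\<close>

definition vis :: "closed_long_ray \<Rightarrow> real set \<Rightarrow> ('a \<times> closed_long_ray) set"
  where "vis \<alpha> S = {p. \<exists>\<gamma>\<ge>\<alpha>. p \<in> T \<gamma> \<and> (\<exists>q\<in>T \<alpha>. u \<alpha> q \<in> S \<and> u \<gamma> p = u \<gamma> q)}"

lemma vis_iff:
  assumes "p \<in> T \<gamma>" "\<alpha> \<le> \<gamma>"
  shows "p \<in> vis \<alpha> S \<longleftrightarrow> (\<exists>q\<in>T \<alpha>. u \<alpha> q \<in> S \<and> u \<gamma> p = u \<gamma> q)"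
proof
  assume "p \<in> vis \<alpha> S"
  then obtain \<gamma>' q where "\<alpha> \<le> \<gamma>'" "p \<in> T \<gamma>'" "q \<in> T \<alpha>" "u \<alpha> q \<in> S" "u \<gamma>' p = u \<gamma>' q"
    by (auto simp: vis_def)
  moreover from this have "u \<gamma> p = u \<gamma> q"
    using assms T_mono[of \<alpha> \<gamma>] T_mono[of \<alpha> \<gamma>'] u_eq_iff[of p \<gamma>' q \<gamma>] by blast
  ultimately show "\<exists>q\<in>T \<alpha>. u \<alpha> q \<in> S \<and> u \<gamma> p = u \<gamma> q" by blast
qed (use assms in \<open>auto simp: vis_def\<close>)

lemma vis_mono: "S \<subseteq> S' \<Longrightarrow> vis \<alpha> S \<subseteq> vis \<alpha> S'"
  by (auto simp: vis_def)

lemma vis_Union: "vis \<alpha> (\<Union>i\<in>I. S i) = (\<Union>i\<in>I. vis \<alpha> (S i))"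
  unfolding vis_def by blast

lemma vis_UNIV_iff:
  assumes "p \<in> T \<gamma>" "\<alpha> \<le> \<gamma>"
  shows "p \<in> vis \<alpha> UNIV \<longleftrightarrow> (\<exists>q\<in>T \<alpha>. u \<gamma> p = u \<gamma> q)"
  using vis_iff[OF assms] by simp

lemma vis_image: "vis \<alpha> (u \<alpha> ` T \<alpha>) = vis \<alpha> UNIV"
  unfolding vis_def by blast

text \<open>Inside \<open>T \<gamma>\<close> the visible set is cut out by the values of
  \<open>u \<gamma>\<close> in the image of \<open>S\<close> under the transition \<open>h\<close>
  from \<open>u \<alpha>\<close> to \<open>u \<gamma>\<close>. Topological questions about
  \<open>vis\<close> thus become questions about images under a continuous injection on an open set
  of reals.\<close>

lemma vis_slice:
  assumes "\<beta> < \<alpha>" "\<alpha> \<le> \<gamma>" "S \<subseteq> u \<alpha> ` T \<alpha>"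
  obtains h where "inj_on h (u \<alpha> ` T \<alpha>)" "continuous_on (u \<alpha> ` T \<alpha>) h"
    "T \<gamma> \<inter> vis \<alpha> S = T \<gamma> \<inter> u \<gamma> -` (h ` S)"
proof -
  obtain h where h: "continuous_on (u \<alpha> ` T \<alpha>) h" "inj_on h (u \<alpha> ` T \<alpha>)"
    "\<And>p. p \<in> T \<alpha> \<Longrightarrow> u \<gamma> p = h (u \<alpha> p)"
    using T_transition[OF assms(1,2)] by metis
  have "p \<in> vis \<alpha> S \<longleftrightarrow> u \<gamma> p \<in> h ` S" if "p \<in> T \<gamma>" for p
    unfolding vis_iff[OF that assms(2)] using h(3) assms(3) by (auto simp: image_iff subset_iff; metis)
  then show thesis using that[OF h(2,1)] by blast
qed

lemma T_open: "openin (top_of_set (A \<times> {\<beta><..})) (T \<gamma>)"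
proof -
  have "T \<gamma> = (A \<times> {\<beta><..}) \<inter> (UNIV \<times> {..<\<gamma>})" by (auto simp: T_def)
  moreover have "open (UNIV \<times> {..<\<gamma>} :: ('a \<times> closed_long_ray) set)" by (intro open_Times) auto
  ultimately show ?thesis by (metis openin_open)
qed

text \<open>Each point of the strip lies in the open part \<open>T \<gamma>\<close> for some large
  \<open>\<gamma>\<close>, so openness can be tested chart by chart.\<close>

lemma openin_strip:
  assumes "V \<subseteq> A \<times> {\<beta><..}" "\<beta> < \<alpha>"
    "\<And>\<gamma>. \<alpha> \<le> \<gamma> \<Longrightarrow> openin (top_of_set (T \<gamma>)) (T \<gamma> \<inter> V)"
  shows "openin (top_of_set (A \<times> {\<beta><..})) V"
proof (subst openin_subopen, intro ballI)
  fix p assume p: "p \<in> V"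
  obtain \<gamma> where "max \<alpha> (snd p) < \<gamma>" using gt_ex by blast
  then have \<gamma>: "\<alpha> \<le> \<gamma>" "p \<in> T \<gamma>" using p assms(1) by (cases p; auto)+
  then show "\<exists>N. openin (top_of_set (A \<times> {\<beta><..})) N \<and> p \<in> N \<and> N \<subseteq> V"
    using assms(3)[OF \<gamma>(1)] T_open[of \<gamma>] p by (meson IntI inf_le2 openin_trans)
qed

lemma vis_subset: "vis \<alpha> S \<subseteq> A \<times> {\<beta><..}"
  by (auto simp: vis_def T_def)

text \<open>The transition is continuous and injective on an open set of reals, so by invariance of
  domain it maps open sets to open sets.\<close>

lemma vis_open:
  assumes "\<beta> < \<alpha>" "open S" "S \<subseteq> u \<alpha> ` T \<alpha>"
  shows "openin (top_of_set (A \<times> {\<beta><..})) (vis \<alpha> S)"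
proof (rule openin_strip[OF vis_subset assms(1)])
  fix \<gamma> assume \<gamma>: "\<alpha> \<le> \<gamma>"
  then have "\<beta> < \<gamma>" using assms(1) by simp
  obtain h where h: "inj_on h (u \<alpha> ` T \<alpha>)" "continuous_on (u \<alpha> ` T \<alpha>) h"
    "T \<gamma> \<inter> vis \<alpha> S = T \<gamma> \<inter> u \<gamma> -` (h ` S)"
    using vis_slice[OF assms(1) \<gamma> assms(3)] by metis
  have "open (h ` S)"
    using h assms(2,3) by (intro invariance_of_domain) (auto intro: continuous_on_subset inj_on_subset)
  then show "openin (top_of_set (T \<gamma>)) (T \<gamma> \<inter> vis \<alpha> S)"
    unfolding h(3) using continuous_u[OF \<open>\<beta> < \<gamma>\<close>]
    by (intro continuous_openin_preimage_gen) (simp add: T_def)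
qed

lemma vis_UNIV_open:
  assumes "\<beta> < \<alpha>"
  shows "openin (top_of_set (A \<times> {\<beta><..})) (vis \<alpha> UNIV)"
proof -
  have "open (u \<alpha> ` T \<alpha>)" using open_u[OF assms] by (simp add: T_def)
  then show ?thesis using vis_open[OF assms, of "u \<alpha> ` T \<alpha>"] unfolding vis_image by simp
qed

text \<open>Compactness survives transport: the image of \<open>S\<close> is compact and so closed
  in the line, whereas the image of a merely relatively closed set could accumulate outside the
  range of the transition.\<close>

lemma vis_compact_complement:
  assumes "\<beta> < \<alpha>" "compact S" "S \<subseteq> u \<alpha> ` T \<alpha>"
  shows "openin (top_of_set (A \<times> {\<beta><..})) (A \<times> {\<beta><..} - vis \<alpha> S)"
proof (rule openin_strip[OF Diff_subset assms(1)])
  fix \<gamma> assume \<gamma>: "\<alpha> \<le> \<gamma>"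
  then have "\<beta> < \<gamma>" using assms(1) by simp
  obtain h where h: "continuous_on (u \<alpha> ` T \<alpha>) h"
    "T \<gamma> \<inter> vis \<alpha> S = T \<gamma> \<inter> u \<gamma> -` (h ` S)"
    using vis_slice[OF assms(1) \<gamma> assms(3)] by metis
  have "closed (h ` S)"
    using h(1) assms(2,3) by (intro compact_imp_closed compact_continuous_image)
      (auto intro: continuous_on_subset)
  then have "open (- (h ` S))" by (simp add: open_Compl)
  then have "openin (top_of_set (T \<gamma>)) (T \<gamma> \<inter> u \<gamma> -` (- (h ` S)))"
    using continuous_u[OF \<open>\<beta> < \<gamma>\<close>]
    by (intro continuous_openin_preimage_gen) (simp add: T_def)
  moreover have "T \<gamma> \<inter> (A \<times> {\<beta><..} - vis \<alpha> S) = T \<gamma> \<inter> u \<gamma> -` (- (h ` S))"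
    using h(2) by (auto simp: T_def)
  ultimately show "openin (top_of_set (T \<gamma>)) (T \<gamma> \<inter> (A \<times> {\<beta><..} - vis \<alpha> S))" by simp
qed

lemma open_vertical_slice:
  assumes "openin (top_of_set (A \<times> {\<beta><..})) V" "x \<in> A"
  shows "open {s. \<beta> < s \<and> (x, s) \<in> V}"
proof -
  obtain O' where O': "open O'" "V = (A \<times> {\<beta><..}) \<inter> O'"
    using assms(1) by (auto simp: openin_open)
  have "open ((\<lambda>s. (x, s)) -` O')"
    by (rule open_vimage[OF O'(1)]) (intro continuous_intros)
  moreover have "{s. \<beta> < s \<and> (x, s) \<in> V} = {\<beta><..} \<inter> (\<lambda>s. (x, s)) -` O'"
    using O'(2) assms(2) by auto
  ultimately show ?thesis by (simp only:) (intro open_Int open_greaterThan)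
qed

lemma open_horizontal_slice:
  assumes "openin (top_of_set (A \<times> {\<beta><..})) V" "\<beta> < s"
  shows "openin (top_of_set A) {x \<in> A. (x, s) \<in> V}"
proof -
  obtain O' where O': "open O'" "V = (A \<times> {\<beta><..}) \<inter> O'"
    using assms(1) by (auto simp: openin_open)
  have "open ((\<lambda>x. (x, s)) -` O')"
    by (rule open_vimage[OF O'(1)]) (intro continuous_intros)
  moreover have "{x \<in> A. (x, s) \<in> V} = A \<inter> (\<lambda>x. (x, s)) -` O'"
    using O'(2) assms(2) by auto
  ultimately show ?thesis by (metis openin_open)
qed

text \<open>Heights at which the fibre meets \<open>vis \<alpha> K\<close> and heights at which it
  misses \<open>vis \<alpha> N\<close> form disjoint closed sets. The first set is unbounded, so the
  second is bounded, because closed unbounded sets intersect. Truncation at \<open>\<alpha>\<close>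
  makes both closed in the whole ray.\<close>

lemma eventually_vis:
  assumes "\<beta> < \<alpha>" "x \<in> A" "compact K" "K \<subseteq> N" "open N" "N \<subseteq> u \<alpha> ` T \<alpha>"
    and unb: "unbounded_above {s. (x, s) \<in> vis \<alpha> K}"
  shows "\<exists>b\<ge>\<beta>. \<forall>s>b. (x, s) \<in> vis \<alpha> N"
proof -
  let ?K = "{s. \<alpha> \<le> s \<and> (x, s) \<in> vis \<alpha> K}"
  let ?N = "{s. \<alpha> \<le> s \<and> (x, s) \<notin> vis \<alpha> N}"
  have "?K = {\<alpha>..} - {s. \<beta> < s \<and> (x, s) \<in> A \<times> {\<beta><..} - vis \<alpha> K}"
    using assms(1,2) by auto
  moreover have "open {s. \<beta> < s \<and> (x, s) \<in> A \<times> {\<beta><..} - vis \<alpha> K}"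
    using assms by (intro open_vertical_slice vis_compact_complement) auto
  ultimately have "closed ?K" by (simp add: closed_Diff)
  moreover have "?N = {\<alpha>..} - {s. \<beta> < s \<and> (x, s) \<in> vis \<alpha> N}"
    using assms(1) by auto
  then have "closed ?N"
    using open_vertical_slice[OF vis_open[OF assms(1,5,6)] assms(2)] by (simp add: closed_Diff)
  moreover have "unbounded_above ?K"
    using unbounded_above_atLeast_Int[OF unb, of \<alpha>] by (simp add: conj_commute)
  moreover have "?K \<inter> ?N = {}" using vis_mono[OF assms(4)] by blast
  ultimately have "\<not> unbounded_above ?N"
    using unbounded_above_closed_inter[of ?K ?N] by (auto simp: unbounded_above_def)
  then obtain b where b: "\<forall>s\<in>?N. s \<le> b" by (auto simp: unbounded_above_def not_less)
  show ?thesis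
  proof (intro exI[of _ "max \<alpha> b"] conjI allI impI)
    show "\<beta> \<le> max \<alpha> b" using assms(1) by (simp add: le_max_iff_disj less_imp_le)
    show "(x, s) \<in> vis \<alpha> N" if "max \<alpha> b < s" for s
    proof (rule ccontr)
      assume "(x, s) \<notin> vis \<alpha> N"
      then have "s \<le> b" using b that by (simp add: less_imp_le)
      then show False using that leD by auto
    qed
  qed
qed

section \<open>Eventually vertical fibres\<close>

definition vertical_beyond :: "closed_long_ray \<Rightarrow> 'a \<Rightarrow> bool"
  where "vertical_beyond b x \<longleftrightarrow> \<beta> \<le> b \<and>
    (\<forall>s s' \<gamma>. b < s \<and> b < s' \<and> s < \<gamma> \<and> s' < \<gamma> \<longrightarrow> u \<gamma> (x, s) = u \<gamma> (x, s'))"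

definition ev_vertical :: "'a \<Rightarrow> bool"
  where "ev_vertical x \<longleftrightarrow> (\<exists>b. vertical_beyond b x)"

lemma vertical_beyond_mono: "vertical_beyond b x \<Longrightarrow> b \<le> c \<Longrightarrow> vertical_beyond c x"
  unfolding vertical_beyond_def by (meson le_less_trans order_trans)

lemma vertical_beyondI:
  assumes x: "x \<in> A" and b: "\<beta> \<le> b"
    and eq: "\<And>s s'. \<lbrakk>b < s; b < s'\<rbrakk> \<Longrightarrow> \<exists>\<gamma>. s < \<gamma> \<and> s' < \<gamma> \<and> u \<gamma> (x, s) = u \<gamma> (x, s')"
  shows "vertical_beyond b x"
  unfolding vertical_beyond_def
proof (intro conjI allI impI b)
  fix s s' \<gamma> assume s: "b < s \<and> b < s' \<and> s < \<gamma> \<and> s' < \<gamma>"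
  then obtain \<gamma>' where "s < \<gamma>'" "s' < \<gamma>'" "u \<gamma>' (x, s) = u \<gamma>' (x, s')" using eq by blast
  then show "u \<gamma> (x, s) = u \<gamma> (x, s')"
    using u_eq_iff[of "(x, s)" \<gamma>' "(x, s')" \<gamma>] s x b by auto
qed

text \<open>The half-line is too long to oscillate. Unboundedly many visits cluster at some value
  \<open>c\<close>; for each of countably many radii the fibre eventually stays within that distance
  of \<open>c\<close>; beyond a common bound \<open>B\<close> it takes the value \<open>c\<close>
  itself.\<close>

lemma visits_imp_ev_vertical:
  assumes \<alpha>: "\<beta> < \<alpha>" and x: "x \<in> A" and unb: "unbounded_above {s. (x, s) \<in> vis \<alpha> UNIV}"
  shows "ev_vertical x"
proof -
  let ?Q = "u \<alpha> ` T \<alpha>"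
  have Q: "open ?Q" using open_u[OF \<alpha>] by (simp add: T_def)
  \<comment> \<open>If each \<open>c\<close> had a ball visited only at bounded heights, countably
    many of these balls would cover the image by Lindelof's theorem, and all visits together would
    be bounded.\<close>
  have "\<exists>c\<in>?Q. \<forall>\<epsilon>>0. unbounded_above {s. (x, s) \<in> vis \<alpha> (ball c \<epsilon>)}"
  proof (rule ccontr)
    assume "\<not> ?thesis"
    then obtain \<epsilon> where \<epsilon>: "\<And>c. c \<in> ?Q \<Longrightarrow> 0 < \<epsilon> c \<and> \<not> unbounded_above {s. (x, s) \<in> vis \<alpha> (ball c (\<epsilon> c))}"
      by metis
    obtain \<G> where \<G>: "\<G> \<subseteq> (\<lambda>c. ball c (\<epsilon> c)) ` ?Q" "countable \<G>"
      "\<Union>\<G> = \<Union>((\<lambda>c. ball c (\<epsilon> c)) ` ?Q)"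
      using Lindelof[of "(\<lambda>c. ball c (\<epsilon> c)) ` ?Q"] by auto
    have "?Q \<subseteq> \<Union>\<G>" unfolding \<G>(3) using \<epsilon> centre_in_ball by blast
    then have "vis \<alpha> UNIV \<subseteq> (\<Union>G\<in>\<G>. vis \<alpha> G)"
      using vis_mono[of ?Q "\<Union>\<G>" \<alpha>] vis_Union[of \<alpha> "\<lambda>G. G" \<G>] by (simp add: vis_image)
    then have "{s. (x, s) \<in> vis \<alpha> UNIV} \<subseteq> (\<Union>G\<in>\<G>. {s. (x, s) \<in> vis \<alpha> G})" by blast
    with unb have "unbounded_above (\<Union>G\<in>\<G>. {s. (x, s) \<in> vis \<alpha> G})"
      by (rule unbounded_above_mono)
    then obtain G where "G \<in> \<G>" "unbounded_above {s. (x, s) \<in> vis \<alpha> G}"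
      using unbounded_above_union_countable[OF \<G>(2)] by blast
    then show False using \<G>(1) \<epsilon> by blast
  qed
  then obtain c where c: "c \<in> ?Q" "\<And>\<epsilon>. 0 < \<epsilon> \<Longrightarrow> unbounded_above {s. (x, s) \<in> vis \<alpha> (ball c \<epsilon>)}"
    by blast
  obtain \<delta> where \<delta>: "0 < \<delta>" "ball c \<delta> \<subseteq> ?Q" using Q c(1) openE by blast
  \<comment> \<open>The closed ball of radius \<open>\<epsilon> / 2\<close> is compact and fits
    between the open ball that is visited unboundedly often and the target
    \<open>ball c \<epsilon>\<close>; the bound \<open>\<epsilon> \<le> \<delta>\<close> keeps
    everything in the image of \<open>u \<alpha>\<close>.\<close>
  have "\<exists>b\<ge>\<beta>. \<forall>s>b. (x, s) \<in> vis \<alpha> (ball c \<epsilon>)" if "0 < \<epsilon>" "\<epsilon> \<le> \<delta>" for \<epsilon>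
  proof (rule eventually_vis[OF \<alpha> x, of "cball c (\<epsilon> / 2)"])
    show "ball c \<epsilon> \<subseteq> ?Q" using \<delta> that by (meson subset_ball subset_trans)
    show "unbounded_above {s. (x, s) \<in> vis \<alpha> (cball c (\<epsilon> / 2))}"
    proof (rule unbounded_above_mono)
      show "unbounded_above {s. (x, s) \<in> vis \<alpha> (ball c (\<epsilon> / 2))}" using c(2) that by simp
    qed (use vis_mono[OF ball_subset_cball] in blast)
  qed (use that in auto)
  then have "\<forall>n. \<exists>b\<ge>\<beta>. \<forall>s>b. (x, s) \<in> vis \<alpha> (ball c (\<delta> / (real n + 1)))"
    using \<delta>(1) by (simp add: field_simps)
  then obtain b where b: "\<And>n s. b n < s \<Longrightarrow> (x, s) \<in> vis \<alpha> (ball c (\<delta> / (real n + 1)))"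
    by metis
  obtain B where B: "\<And>n. b n < B" "\<beta> < B"
    using countable_bounded_long_ray[of "insert \<beta> (range b)"] by auto
  obtain q where q: "q \<in> T \<alpha>" "c = u \<alpha> q" using c(1) by blast
  have val: "u \<gamma> (x, s) = u \<gamma> q" if s: "B < s" "s < \<gamma>" "\<alpha> \<le> \<gamma>" for s \<gamma>
  proof -
    have xs: "(x, s) \<in> T \<gamma>" using x s B by auto
    have "(x, s) \<in> vis \<alpha> UNIV"
      using b[of 0 s] s(1) B(1)[of 0] vis_mono[OF subset_UNIV] by (meson less_trans subsetD)
    then obtain p where p: "p \<in> T \<alpha>" "u \<gamma> (x, s) = u \<gamma> p"
      unfolding vis_UNIV_iff[OF xs s(3)] by blast
    have "dist c (u \<alpha> p) < \<delta> / (real n + 1)" for n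
    proof -
      have "(x, s) \<in> vis \<alpha> (ball c (\<delta> / (real n + 1)))" using b B(1) s(1) less_trans by blast
      then obtain p' where p': "p' \<in> T \<alpha>" "u \<alpha> p' \<in> ball c (\<delta> / (real n + 1))" "u \<gamma> (x, s) = u \<gamma> p'"
        unfolding vis_iff[OF xs s(3)] by blast
      then have "u \<alpha> p = u \<alpha> p'" using p u_eq_mono[OF p(1) p'(1) s(3)] by simp
      then show ?thesis using p'(2) by simp
    qed
    moreover have "(\<lambda>n. \<delta> / (real n + 1)) \<longlonglongrightarrow> 0" using LIMSEQ_Suc[OF lim_const_over_n[of \<delta>]] by (simp add: add.commute)
    ultimately have "dist c (u \<alpha> p) \<le> 0"
      by (intro LIMSEQ_le_const[of "\<lambda>n. \<delta> / (real n + 1)"]) (auto intro: less_imp_le)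
    then have "u \<alpha> p = u \<alpha> q" using q(2) by simp
    then show ?thesis using p u_eq_mono[OF p(1) q(1) s(3)] by simp
  qed
  have "vertical_beyond B x"
  proof (rule vertical_beyondI[OF x])
    fix s s' assume s: "B < s" "B < s'"
    obtain \<gamma> where "max \<alpha> (max s s') < \<gamma>" using gt_ex by blast
    then show "\<exists>\<gamma>. s < \<gamma> \<and> s' < \<gamma> \<and> u \<gamma> (x, s) = u \<gamma> (x, s')"
      using val[of s \<gamma>] val[of s' \<gamma>] s by (intro exI[of _ \<gamma>]) auto
  qed (use B in auto)
  then show ?thesis by (auto simp: ev_vertical_def)
qed

lemma not_ev_vertical_escapes:
  assumes "\<beta> < \<alpha>" "x \<in> A" "\<not> ev_vertical x"
  shows "\<exists>b. \<forall>s>b. (x, s) \<notin> vis \<alpha> UNIV"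
  using visits_imp_ev_vertical[OF assms(1,2)] assms(3) unfolding unbounded_above_def by auto

lemma u_horizontal_limit:
  assumes "f \<longlonglongrightarrow> x" "\<And>n. f n \<in> A" "x \<in> A" "\<beta> < s" "s < \<gamma>"
  shows "(\<lambda>n. u \<gamma> (f n, s)) \<longlonglongrightarrow> u \<gamma> (x, s)"
proof (rule continuous_on_tendsto_compose[where s = "T \<gamma>"])
  show "continuous_on (T \<gamma>) (u \<gamma>)" using continuous_u[of \<gamma>] assms(4,5) by (auto simp: T_def)
  show "(\<lambda>n. (f n, s)) \<longlonglongrightarrow> (x, s)" by (intro tendsto_intros assms(1))
qed (use assms in auto)

text \<open>A sequence brings only countably many bounds, so a common \<open>B\<close> exists before
  the limit is taken; beyond \<open>B\<close>, equality of two coordinates passes to the limit in a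
  fixed chart.\<close>

lemma ev_vertical_limit:
  assumes f: "f \<longlonglongrightarrow> x" "\<And>n. f n \<in> A" "x \<in> A" and c: "\<And>n. ev_vertical (f n)"
  shows "ev_vertical x"
proof -
  obtain b where b: "\<And>n. vertical_beyond (b n) (f n)" using c unfolding ev_vertical_def by metis
  obtain B where B: "\<And>n. b n < B" using countable_bounded_long_ray[of "range b"] by auto
  have vB: "vertical_beyond B (f n)" for n
    using vertical_beyond_mono[OF b] B less_imp_le by blast
  have \<beta>B: "\<beta> \<le> B" using vB[of 0] by (simp add: vertical_beyond_def)
  have "vertical_beyond B x"
    unfolding vertical_beyond_def
  proof (intro conjI allI impI \<beta>B)
    fix s s' \<gamma> assume s: "B < s \<and> B < s' \<and> s < \<gamma> \<and> s' < \<gamma>"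
    then have \<beta>s: "\<beta> < s" "\<beta> < s'" using \<beta>B by auto
    have "u \<gamma> (f n, s) = u \<gamma> (f n, s')" for n
      using vB[of n] s unfolding vertical_beyond_def by blast
    then have "(\<lambda>n. u \<gamma> (f n, s)) \<longlonglongrightarrow> u \<gamma> (x, s')"
      using u_horizontal_limit[OF f \<beta>s(2), of \<gamma>] s by simp
    then show "u \<gamma> (x, s) = u \<gamma> (x, s')"
      using u_horizontal_limit[OF f \<beta>s(1), of \<gamma>] s LIMSEQ_unique by blast
  qed
  then show ?thesis by (auto simp: ev_vertical_def)
qed

lemma vertical_beyond_visits:
  assumes "vertical_beyond b x" "x \<in> A" "b < s0" "s0 < \<alpha>" "b < s"
  shows "(x, s) \<in> vis \<alpha> UNIV"
proof -
  have \<beta>: "\<beta> \<le> b" using assms(1) by (simp add: vertical_beyond_def)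
  obtain \<gamma> where \<gamma>: "max s \<alpha> < \<gamma>" using gt_ex by blast
  have "u \<gamma> (x, s) = u \<gamma> (x, s0)"
    using assms(1,3,4,5) \<gamma> unfolding vertical_beyond_def
    by (meson less_trans max_less_iff_conj)
  moreover have "(x, s) \<in> T \<gamma>" "(x, s0) \<in> T \<alpha>" using assms \<beta> \<gamma> by auto
  ultimately show ?thesis using vis_UNIV_iff[of "(x, s)" \<gamma> \<alpha>] \<gamma> by auto
qed

text \<open>If \<open>x\<close> were eventually vertical, its fibre would stay in
  \<open>vis \<alpha> UNIV\<close> at every height above \<open>b\<close>. Visibility is open in the
  horizontal direction, so at a height \<open>s\<close> beyond the escape heights of all
  \<open>f n\<close>, some \<open>f n\<close> would still be visible.\<close>

lemma not_ev_vertical_limit: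
  assumes f: "f \<longlonglongrightarrow> x" "\<And>n. f n \<in> A" "x \<in> A" and c: "\<And>n. \<not> ev_vertical (f n)"
  shows "\<not> ev_vertical x"
proof
  assume "ev_vertical x"
  then obtain b where b: "vertical_beyond b x" by (auto simp: ev_vertical_def)
  obtain s0 where s0: "b < s0" using gt_ex by blast
  obtain \<alpha> where \<alpha>: "s0 < \<alpha>" using gt_ex by blast
  have \<beta>: "\<beta> \<le> b" using b by (simp add: vertical_beyond_def)
  have \<beta>\<alpha>: "\<beta> < \<alpha>" using \<beta> s0 \<alpha> by auto
  have "\<forall>n. \<exists>d. \<forall>s>d. (f n, s) \<notin> vis \<alpha> UNIV"
    using not_ev_vertical_escapes[OF \<beta>\<alpha> f(2) c] by blast
  then obtain d where d: "\<And>n s. d n < s \<Longrightarrow> (f n, s) \<notin> vis \<alpha> UNIV" by metis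
  obtain s where s: "\<And>n. d n < s" "b < s"
    using countable_bounded_long_ray[of "insert b (range d)"] by auto
  have "openin (top_of_set A) {x \<in> A. (x, s) \<in> vis \<alpha> UNIV}"
    using s(2) \<beta> by (intro open_horizontal_slice vis_UNIV_open \<beta>\<alpha>) simp
  then obtain O' where O': "open O'" "{x \<in> A. (x, s) \<in> vis \<alpha> UNIV} = A \<inter> O'"
    by (auto simp: openin_open)
  have "x \<in> O'" using vertical_beyond_visits[OF b f(3) s0 \<alpha> s(2)] O'(2) f(3) by blast
  then have "\<forall>\<^sub>F n in sequentially. f n \<in> O'" using f(1) O'(1) by (rule topological_tendstoD[rotated 2])
  then obtain n where "f n \<in> O'" by (auto simp: eventually_sequentially)
  then show False using d[OF s(1)] O'(2) f(2) by blast
qed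

lemma closedin_sequentially:
  assumes "S \<subseteq> A" "\<And>f x. \<lbrakk>f \<longlonglongrightarrow> x; \<And>n. f n \<in> S; x \<in> A\<rbrakk> \<Longrightarrow> x \<in> S"
  shows "closedin (top_of_set A) S"
  unfolding closedin_limpt
proof (intro conjI allI impI assms(1))
  fix x assume x: "x islimpt S \<and> x \<in> A"
  then obtain f where "\<And>n. f n \<in> S - {x}" "f \<longlonglongrightarrow> x" unfolding islimpt_sequential by blast
  then show "x \<in> S" using assms(2)[of f x] x by blast
qed

lemma ev_vertical_all:
  assumes "x \<in> A" "ev_vertical x" "y \<in> A"
  shows "ev_vertical y"
proof -
  let ?C = "{x \<in> A. ev_vertical x}"
  have "closedin (top_of_set A) ?C"
    using ev_vertical_limit by (intro closedin_sequentially) auto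
  moreover have "closedin (top_of_set A) (A - ?C)"
    using not_ev_vertical_limit by (intro closedin_sequentially) auto
  then have "openin (top_of_set A) ?C"
    by (simp add: openin_closedin_eq)
  ultimately have "?C = {} \<or> ?C = A" using connected_A unfolding connected_clopen by blast
  then show ?thesis using assms by blast
qed

lemma ev_vertical_uniform:
  assumes "\<And>x. x \<in> A \<Longrightarrow> ev_vertical x"
  shows "\<exists>b. \<forall>x\<in>A. vertical_beyond b x"
proof -
  obtain D where D: "countable D" "D \<subseteq> A"
    "\<And>W. openin (top_of_set A) W \<Longrightarrow> W \<noteq> {} \<Longrightarrow> \<exists>d\<in>D. d \<in> W"
    using countable_dense_subset by blast
  obtain b where b: "\<And>x. x \<in> D \<Longrightarrow> vertical_beyond (b x) x"
    using assms D(2) unfolding ev_vertical_def by (metis subsetD)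
  obtain B where B: "\<And>x. x \<in> D \<Longrightarrow> b x < B" "\<beta> < B"
    using countable_bounded_long_ray[of "insert \<beta> (b ` D)"] D(1) by auto
  have vB: "vertical_beyond B x" if "x \<in> D" for x
    using vertical_beyond_mono[OF b[OF that]] B(1)[OF that] by simp
  have "vertical_beyond B x" if x: "x \<in> A" for x
    unfolding vertical_beyond_def
  proof (intro conjI allI impI)
    show "\<beta> \<le> B" using B(2) by simp
    fix s s' \<gamma> assume s: "B < s \<and> B < s' \<and> s < \<gamma> \<and> s' < \<gamma>"
    have cont: "continuous_on A (\<lambda>x. u \<gamma> (x, t))" if "\<beta> < t" "t < \<gamma>" for t
    proof (rule continuous_on_compose2[OF continuous_u])
      show "\<beta> < \<gamma>" using that by simp
    qed (use that in \<open>auto intro!: continuous_intros\<close>)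
    have \<beta>s: "\<beta> < s" "\<beta> < s'" using s B(2) by auto
    \<comment> \<open>The points where the two coordinates differ form a relatively open set that
      misses \<open>D\<close>.\<close>
    let ?W = "A \<inter> (\<lambda>x. u \<gamma> (x, s) - u \<gamma> (x, s')) -` (- {0})"
    have "openin (top_of_set A) ?W"
      using cont \<beta>s s by (intro continuous_openin_preimage_gen continuous_intros) auto
    moreover have "x \<notin> ?W" if "x \<in> D" for x
      using vB[OF that] s unfolding vertical_beyond_def by auto
    ultimately have "?W = {}" using D(3) by blast
    then show "u \<gamma> (x, s) = u \<gamma> (x, s')" using x by auto
  qed
  then show ?thesis by blast
qed

section \<open>Heights at which the transverse coordinate is constant\<close>

definition horizontal_at :: "closed_long_ray \<Rightarrow> bool"
  where "horizontal_at t \<longleftrightarrow> (\<forall>\<gamma>>t. \<forall>x\<in>A. \<forall>y\<in>A. u \<gamma> (x, t) = u \<gamma> (y, t))"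

text \<open>A failure at \<open>t\<close> is an inequality between two continuous functions of the
  height in one chart, hence persists nearby. The lower cut \<open>b\<close>, strictly above
  \<open>\<beta>\<close>, turns relative closedness into closedness in the ray.\<close>

lemma closed_horizontal_at:
  assumes "\<beta> < b"
  shows "closed {t. b \<le> t \<and> horizontal_at t}"
proof -
  have "open {t. \<beta> < t \<and> \<not> horizontal_at t}"
  proof (subst open_subopen, intro ballI)
    fix t assume t: "t \<in> {t. \<beta> < t \<and> \<not> horizontal_at t}"
    then obtain \<gamma> x y where \<gamma>: "\<beta> < t" "t < \<gamma>" "x \<in> A" "y \<in> A" "u \<gamma> (x, t) \<noteq> u \<gamma> (y, t)"
      by (auto simp: horizontal_at_def)
    have cont: "continuous_on {\<beta><..<\<gamma>} (\<lambda>t. u \<gamma> (z, t))" if "z \<in> A" for z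
    proof (rule continuous_on_compose2[OF continuous_u])
      show "\<beta> < \<gamma>" using \<gamma> by simp
    qed (use that in \<open>auto intro!: continuous_intros\<close>)
    let ?W = "{\<beta><..<\<gamma>} \<inter> (\<lambda>t. u \<gamma> (x, t) - u \<gamma> (y, t)) -` (- {0})"
    have "openin (top_of_set {\<beta><..<\<gamma>}) ?W"
      using cont \<gamma> by (intro continuous_openin_preimage_gen continuous_intros) auto
    then have "open ?W" by (rule openin_open_trans) simp
    then show "\<exists>W. open W \<and> t \<in> W \<and> W \<subseteq> {t. \<beta> < t \<and> \<not> horizontal_at t}"
    proof (intro exI conjI subsetI)
      show "t \<in> ?W" using \<gamma> by simp
      fix t' assume "t' \<in> ?W"
      then have t': "\<beta> < t'" "t' < \<gamma>" "u \<gamma> (x, t') \<noteq> u \<gamma> (y, t')" by auto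
      then have "\<not> horizontal_at t'" using \<gamma>(3,4) unfolding horizontal_at_def by blast
      then show "t' \<in> {t. \<beta> < t \<and> \<not> horizontal_at t}" using t' by simp
    qed
  qed
  moreover have "{t. b \<le> t \<and> horizontal_at t} = {b..} - {t. \<beta> < t \<and> \<not> horizontal_at t}"
    using assms by auto
  ultimately show ?thesis by (simp add: closed_Diff)
qed

lemma escape_uniform:
  assumes \<alpha>: "\<beta> < \<alpha>" and esc: "\<And>x. x \<in> A \<Longrightarrow> \<not> ev_vertical x"
  shows "\<exists>b. \<forall>s>b. \<forall>x\<in>A. (x, s) \<notin> vis \<alpha> UNIV"
proof -
  obtain D where D: "countable D" "D \<subseteq> A"
    "\<And>W. openin (top_of_set A) W \<Longrightarrow> W \<noteq> {} \<Longrightarrow> \<exists>d\<in>D. d \<in> W"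
    using countable_dense_subset by blast
  have "\<forall>x\<in>D. \<exists>b. \<forall>s>b. (x, s) \<notin> vis \<alpha> UNIV"
    using not_ev_vertical_escapes[OF \<alpha>] esc D(2) by blast
  then obtain b where b: "\<And>x s. x \<in> D \<Longrightarrow> b x < s \<Longrightarrow> (x, s) \<notin> vis \<alpha> UNIV" by metis
  obtain B where B: "\<And>x. x \<in> D \<Longrightarrow> b x < B" "\<beta> < B"
    using countable_bounded_long_ray[of "insert \<beta> (b ` D)"] D(1) by auto
  have "(x, s) \<notin> vis \<alpha> UNIV" if s: "B < s" and x: "x \<in> A" for x s
  proof
    assume "(x, s) \<in> vis \<alpha> UNIV"
    then have "{x \<in> A. (x, s) \<in> vis \<alpha> UNIV} \<noteq> {}" using x by blast
    moreover have "openin (top_of_set A) {x \<in> A. (x, s) \<in> vis \<alpha> UNIV}"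
      using s B(2) by (intro open_horizontal_slice vis_UNIV_open \<alpha>) simp
    ultimately obtain d where "d \<in> D" "(d, s) \<in> vis \<alpha> UNIV" using D(3) by blast
    then show False using b B(1) s less_trans by blast
  qed
  then show ?thesis by blast
qed

lemma unbounded_above_horizontal_at:
  assumes esc: "\<And>x. x \<in> A \<Longrightarrow> \<not> ev_vertical x" and c: "\<beta> < c"
  shows "unbounded_above {t. c \<le> t \<and> horizontal_at t}"
  unfolding unbounded_above_def
proof
  fix a
  \<comment> \<open>The bound is enlarged past \<open>\<alpha>\<close> so that iteration increases,
    and strictly past the old bound so that the height \<open>g \<alpha>\<close> itself already
    counts as escaped.\<close>
  have "\<exists>b>\<alpha>. \<forall>s\<ge>b. \<forall>x\<in>A. (x, s) \<notin> vis \<alpha> UNIV" if \<alpha>: "\<beta> < \<alpha>" for \<alpha>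
  proof -
    obtain b where b: "\<forall>s>b. \<forall>x\<in>A. (x, s) \<notin> vis \<alpha> UNIV" using escape_uniform[OF \<alpha> esc] by blast
    obtain b' where "max b \<alpha> < b'" using gt_ex by blast
    then show ?thesis using b by (intro exI[of _ b']) auto
  qed
  then obtain g where g: "\<And>\<alpha>. \<beta> < \<alpha> \<Longrightarrow> \<alpha> < g \<alpha>"
    "\<And>\<alpha> s x. \<lbrakk>\<beta> < \<alpha>; g \<alpha> \<le> s; x \<in> A\<rbrakk> \<Longrightarrow> (x, s) \<notin> vis \<alpha> UNIV" by metis
  define t where "t n = (g ^^ n) (max a c)" for n
  have t_Suc: "t (Suc n) = g (t n)" for n by (simp add: t_def)
  have t\<beta>: "\<beta> < t n" for n
  proof (induction n)
    case 0
    show ?case using c by (simp add: t_def less_max_iff_disj)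
  next
    case (Suc n)
    then show ?case using g(1)[of "t n"] t_Suc by (metis less_trans)
  qed
  have step: "t n < t (Suc n)" for n using g(1)[OF t\<beta>] t_Suc by simp
  obtain l where l: "\<And>n. t n < l" "\<And>b. b < l \<Longrightarrow> \<exists>n. b < t n"
    by (rule increasing_limit_long_ray[of t, OF step]) blast
  have inc: "m \<le> n \<Longrightarrow> t m \<le> t n" for m n
    using lift_Suc_mono_le[of t] step by (simp add: less_imp_le)
  have \<beta>l: "\<beta> < l" using t\<beta>[of 0] l(1)[of 0] by simp
  have noless: "\<not> u \<gamma> (x, l) < u \<gamma> (y, l)" if \<gamma>: "l < \<gamma>" and xy: "x \<in> A" "y \<in> A" for \<gamma> x y
  proof
    assume "u \<gamma> (x, l) < u \<gamma> (y, l)"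
    then obtain r where r: "u \<gamma> (x, l) < r" "r < u \<gamma> (y, l)" using dense by blast
    have cont: "continuous_on {\<beta><..<\<gamma>} (\<lambda>t. u \<gamma> (z, t))" if "z \<in> A" for z
    proof (rule continuous_on_compose2[OF continuous_u])
      show "\<beta> < \<gamma>" using \<gamma> \<beta>l by simp
    qed (use that in \<open>auto intro!: continuous_intros\<close>)
    have "open ({\<beta><..<\<gamma>} \<inter> (\<lambda>t. u \<gamma> (x, t)) -` {..<r})"
      using continuous_openin_preimage_gen[OF cont[OF xy(1)], of "{..<r}"]
      by (auto intro: openin_open_trans)
    moreover have "open ({\<beta><..<\<gamma>} \<inter> (\<lambda>t. u \<gamma> (y, t)) -` {r<..})"
      using continuous_openin_preimage_gen[OF cont[OF xy(2)], of "{r<..}"]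
      by (auto intro: openin_open_trans)
    ultimately have "open ({\<beta><..<\<gamma>} \<inter> (\<lambda>t. u \<gamma> (x, t)) -` {..<r} \<inter> ({\<beta><..<\<gamma>} \<inter> (\<lambda>t. u \<gamma> (y, t)) -` {r<..}))"
      by (rule open_Int)
    moreover have "l \<in> {\<beta><..<\<gamma>} \<inter> (\<lambda>t. u \<gamma> (x, t)) -` {..<r} \<inter> ({\<beta><..<\<gamma>} \<inter> (\<lambda>t. u \<gamma> (y, t)) -` {r<..})"
      using r \<gamma> \<beta>l by auto
    ultimately obtain b where b: "b < l"
      "{b<..l} \<subseteq> {\<beta><..<\<gamma>} \<inter> (\<lambda>t. u \<gamma> (x, t)) -` {..<r} \<inter> ({\<beta><..<\<gamma>} \<inter> (\<lambda>t. u \<gamma> (y, t)) -` {r<..})"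
      using open_left[OF _ _ \<beta>l] by blast
    obtain n where n: "b < t n" using l(2)[OF b(1)] by blast
    \<comment> \<open>The strict inequalities at \<open>l\<close> persist on \<open>{b<..l}\<close>,
      so at every late height \<open>t m\<close> the coordinate takes values on both sides of
      \<open>r\<close>; connectedness of \<open>A\<close> yields \<open>r\<close> itself.\<close>
    have hit: "\<exists>z\<in>A. u \<gamma> (z, t m) = r" if m: "n \<le> m" for m
    proof -
      have "t m \<in> {b<..l}" using n inc[OF m] l(1)[of m] by auto
      then have tm: "u \<gamma> (x, t m) < r" "r < u \<gamma> (y, t m)" "t m < \<gamma>" using b(2) by auto
      have "continuous_on A (\<lambda>z. u \<gamma> (z, t m))"
      proof (rule continuous_on_compose2[OF continuous_u])
        show "\<beta> < \<gamma>" using \<gamma> \<beta>l by simp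
      qed (use tm(3) t\<beta> in \<open>auto intro!: continuous_intros\<close>)
      then have "connected ((\<lambda>z. u \<gamma> (z, t m)) ` A)"
        using connected_A by (rule connected_continuous_image)
      then have "r \<in> (\<lambda>z. u \<gamma> (z, t m)) ` A"
        using connectedD_interval[of "(\<lambda>z. u \<gamma> (z, t m)) ` A"] tm xy by (meson imageI less_imp_le)
      then show ?thesis by blast
    qed
    \<comment> \<open>The indices differ by two: \<open>T (t (Suc n))\<close> is open at the top and
      contains the height \<open>t n\<close>, while escape from it is guaranteed only from
      \<open>g (t (Suc n)) = t (Suc (Suc n))\<close> on.\<close>
    obtain z where z: "z \<in> A" "u \<gamma> (z, t n) = r" using hit[of n] by blast
    obtain z' where z': "z' \<in> A" "u \<gamma> (z', t (Suc (Suc n))) = r" using hit[of "Suc (Suc n)"] by auto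
    have "(z', t (Suc (Suc n))) \<in> T \<gamma>" "t (Suc n) \<le> \<gamma>" "(z, t n) \<in> T (t (Suc n))"
      using z z' t\<beta> l(1)[of "Suc (Suc n)"] l(1)[of "Suc n"] \<gamma> step by auto
    then have "(z', t (Suc (Suc n))) \<in> vis (t (Suc n)) UNIV"
      using vis_UNIV_iff[of "(z', t (Suc (Suc n)))" \<gamma> "t (Suc n)"] z(2) z'(2) by metis
    then show False using g(2)[OF t\<beta>, of "Suc n" "t (Suc (Suc n))" z'] z'(1) t_Suc by auto
  qed
  have "horizontal_at l"
    unfolding horizontal_at_def using noless by (meson linorder_cases)
  moreover have "max a c < l" using l(1)[of 0] by (simp add: t_def)
  ultimately show "\<exists>t\<in>{t. c \<le> t \<and> horizontal_at t}. a < t" by (intro bexI[of _ l]) auto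
qed

end

section \<open>Arcs, boxes and strips in the long cylinder\<close>

definition circle_arc :: "real \<Rightarrow> real \<Rightarrow> complex set"
  where "circle_arc \<theta> d = cis ` {\<theta> - d<..<\<theta> + d}"

lemma circle_arc_subset: "circle_arc \<theta> d \<subseteq> circle"
  by (auto simp: circle_arc_def)

lemma connected_circle_arc: "connected (circle_arc \<theta> d)"
  unfolding circle_arc_def
  by (intro connected_continuous_image continuous_intros) simp

lemma circle_arc_centre: "0 < d \<Longrightarrow> cis \<theta> \<in> circle_arc \<theta> d"
  by (auto simp: circle_arc_def)

lemma circle_eq_cis: "z \<in> circle \<Longrightarrow> \<exists>\<theta>. z = cis \<theta>"
  using cis_Arg_unique rcis_cmod_Arg[of z] by (auto simp: rcis_def intro: sym)

text \<open>Rotation by \<open>- \<theta>\<close> moves the centre to \<open>1\<close>, and cosine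
  decreases on \<open>[0, pi]\<close>. The right-hand side exhibits the arc as cut out by an open
  condition.\<close>

lemma circle_arc_eq:
  assumes "0 < d" "d \<le> pi"
  shows "circle_arc \<theta> d = {z \<in> circle. cos d < Re (z * cis (- \<theta>))}"
proof (intro equalityI subsetI)
  fix z assume "z \<in> circle_arc \<theta> d"
  then obtain s where s: "z = cis s" "\<bar>s - \<theta>\<bar> < d" by (auto simp: circle_arc_def)
  have "cos d < cos \<bar>s - \<theta>\<bar>" using s(2) assms by (intro cos_monotone_0_pi) auto
  moreover have "Re (z * cis (- \<theta>)) = cos (s - \<theta>)"
    using s by (simp add: cis_mult)
  ultimately show "z \<in> {z \<in> circle. cos d < Re (z * cis (- \<theta>))}"
    using s by (simp add: cos_abs_real)
next
  fix z assume z: "z \<in> {z \<in> circle. cos d < Re (z * cis (- \<theta>))}"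
  let ?w = "z * cis (- \<theta>)"
  let ?a = "Arg ?w"
  have "norm ?w = 1" using z by (simp add: norm_mult)
  then have w: "?w = cis ?a" using rcis_cmod_Arg[of ?w] by (simp add: rcis_def)
  have bnd: "\<bar>?a\<bar> \<le> pi" using Arg_bounded[of ?w] by auto
  have "cos d < cos ?a" using z w by (metis (mono_tags, lifting) cis.sel(1) mem_Collect_eq)
  then have "cos d < cos \<bar>?a\<bar>" by (simp add: cos_abs_real)
  then have "\<bar>?a\<bar> < d" using assms bnd cos_mono_less_eq[of d "\<bar>?a\<bar>"] by auto
  moreover have "z = cis (?a + \<theta>)"
  proof -
    have "cis (?a + \<theta>) = ?w * cis \<theta>" using w by (metis cis_mult)
    also have "\<dots> = z" by (simp add: mult.assoc cis_mult)
    finally show ?thesis by simp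
  qed
  ultimately show "z \<in> circle_arc \<theta> d" unfolding circle_arc_def by (intro image_eqI[of _ _ "?a + \<theta>"]) auto
qed

lemma openin_circle_arc:
  assumes "0 < d" "d \<le> pi"
  shows "openin (top_of_set circle) (circle_arc \<theta> d)"
proof -
  have "open ((\<lambda>z. Re (z * cis (- \<theta>))) -` {cos d<..})"
    by (intro open_vimage continuous_intros open_greaterThan)
  moreover have "circle_arc \<theta> d = circle \<inter> (\<lambda>z. Re (z * cis (- \<theta>))) -` {cos d<..}"
    using circle_arc_eq[OF assms] by auto
  ultimately show ?thesis by (metis openin_open)
qed

text \<open>The rotated imaginary part is the sine of the angle from the centre, and sine is
  injective within \<open>pi / 2\<close> of zero. This is one source of the bound
  \<open>d \<le> pi / 2\<close> on arcs.\<close>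

lemma circle_arc_coordinate_inj:
  assumes "d \<le> pi / 2"
  shows "inj_on (\<lambda>z. Im (z * cis (- \<theta>))) (circle_arc \<theta> d)"
proof (rule inj_onI)
  fix z w assume "z \<in> circle_arc \<theta> d" "w \<in> circle_arc \<theta> d"
    and eq: "Im (z * cis (- \<theta>)) = Im (w * cis (- \<theta>))"
  then obtain s t where s: "z = cis s" "\<bar>s - \<theta>\<bar> < d" and t: "w = cis t" "\<bar>t - \<theta>\<bar> < d"
    by (auto simp: circle_arc_def)
  have "sin (s - \<theta>) = sin (t - \<theta>)" using eq s(1) t(1) by (simp add: cis_mult)
  then have "s - \<theta> = t - \<theta>" using s(2) t(2) assms sin_inj_pi[of "s - \<theta>" "t - \<theta>"] by auto
  then show "z = w" using s t by simp
qed

lemma circle_arc_small: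
  assumes "0 < e"
  shows "\<exists>d. 0 < d \<and> d \<le> pi / 2 \<and> (\<forall>\<theta>. circle_arc \<theta> d \<subseteq> ball (cis \<theta>) e)"
proof -
  have "isCont cis 0" using continuous_on_cis[of UNIV "\<lambda>x. x"] by (simp add: continuous_on_eq_continuous_at)
  then obtain d where d: "0 < d" "\<And>h. \<bar>h\<bar> < d \<Longrightarrow> norm (cis h - 1) < e"
    using assms unfolding continuous_at_eps_delta by (auto simp: dist_norm)
  have "circle_arc \<theta> (min d (pi / 2)) \<subseteq> ball (cis \<theta>) e" for \<theta>
  proof
    fix z assume "z \<in> circle_arc \<theta> (min d (pi / 2))"
    then obtain s where s: "z = cis s" "\<bar>s - \<theta>\<bar> < d" by (auto simp: circle_arc_def)
    have "z - cis \<theta> = cis \<theta> * (cis (s - \<theta>) - 1)"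
      using s by (simp add: right_diff_distrib cis_mult)
    then have "norm (z - cis \<theta>) = norm (cis (s - \<theta>) - 1)" by (simp add: norm_mult)
    then show "z \<in> ball (cis \<theta>) e" using d(2)[OF s(2)] by (simp add: dist_norm norm_minus_commute)
  qed
  then show ?thesis using d(1) by (intro exI[of _ "min d (pi / 2)"]) auto
qed

lemma circle_arcs_cover:
  assumes "0 < d"
  shows "\<exists>I. finite I \<and> (\<forall>z\<in>circle. \<exists>\<theta>\<in>I. z \<in> circle_arc \<theta> d)"
proof -
  \<comment> \<open>The centres are multiples of \<open>d\<close>. Rounding \<open>Arg z / d\<close>
    down gives a centre at angular distance less than \<open>d\<close>, and finitely many suffice
    because \<open>Arg\<close> lies between \<open>- pi\<close> and \<open>pi\<close>.\<close>
  let ?I = "(\<lambda>k. real_of_int k * d) ` {\<lfloor>- pi / d\<rfloor>..\<lfloor>pi / d\<rfloor>}"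
  have "\<exists>\<theta>\<in>?I. z \<in> circle_arc \<theta> d" if z: "z \<in> circle" for z
  proof -
    have zA: "z = cis (Arg z)" using z rcis_cmod_Arg[of z] by (simp add: rcis_def)
    define k where "k = \<lfloor>Arg z / d\<rfloor>"
    have "- pi / d \<le> Arg z / d" "Arg z / d \<le> pi / d"
      using Arg_bounded[of z] assms divide_right_mono[of "- pi" "Arg z" d]
        divide_right_mono[of "Arg z" pi d] by auto
    then have "k \<in> {\<lfloor>- pi / d\<rfloor>..\<lfloor>pi / d\<rfloor>}" unfolding k_def by (auto intro: floor_mono)
    moreover have "of_int k \<le> Arg z / d" "Arg z / d < of_int k + 1" unfolding k_def by linarith+
    then have "of_int k * d \<le> Arg z" "Arg z < of_int k * d + d"
      using assms by (auto simp: field_simps)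
    then have "z \<in> circle_arc (of_int k * d) d"
      unfolding circle_arc_def using assms by (subst zA, intro imageI) auto
    ultimately show ?thesis by blast
  qed
  then show ?thesis by (intro exI[of _ ?I]) auto
qed

text \<open>\<open>cis\<close> unrolls the arc to an interval of length at most \<open>pi\<close>,
  on which it is injective; invariance of domain then applies on the line to
  \<open>f \<circ> cis\<close>.\<close>

lemma circle_arc_open_map:
  fixes f :: "complex \<Rightarrow> real"
  assumes d: "d \<le> pi / 2" and f: "continuous_on (circle_arc \<theta> d) f" "inj_on f (circle_arc \<theta> d)"
    and W: "openin (top_of_set circle) W" "W \<subseteq> circle_arc \<theta> d"
  shows "open (f ` W)"
proof -
  let ?I = "{\<theta> - d<..<\<theta> + d}"
  obtain O' where O': "open O'" "W = circle \<inter> O'" using W(1) by (auto simp: openin_open)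
  let ?V = "?I \<inter> cis -` O'"
  have injc: "inj_on cis ?I"
  proof (rule inj_onI)
    fix s t assume st: "s \<in> ?I" "t \<in> ?I" "cis s = cis t"
    then have "cis (s - t) = 1" by (simp flip: cis_divide)
    then have "sin (s - t) = 0" by (metis cis.sel(2) one_complex.sel(2))
    moreover have "- pi < s - t" "s - t < pi" using st d by auto
    ultimately have "s - t = 0" using sin_eq_0_pi by blast
    then show "s = t" by simp
  qed
  have "open ?V" by (intro open_Int open_vimage O'(1) continuous_intros open_greaterThanLessThan)
  moreover have "continuous_on ?V (f \<circ> cis)"
    by (intro continuous_on_compose continuous_intros continuous_on_subset[OF f(1)])
       (auto simp: circle_arc_def)
  moreover have "inj_on (f \<circ> cis) ?V"
    using injc f(2) by (intro comp_inj_on) (auto simp: circle_arc_def intro: inj_on_subset)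
  ultimately have "open ((f \<circ> cis) ` ?V)" using invariance_of_domain by blast
  moreover have "W = cis ` ?V" using W(2) O'(2) by (auto simp: circle_arc_def)
  ultimately show ?thesis by (simp add: image_comp)
qed

text \<open>The domain is an order interval, so openness comes from the order: a continuous
  injection puts its values at \<open>c1\<close> and \<open>d1\<close> on opposite sides of
  \<open>f s\<close>, and the image of \<open>{c1..d1}\<close> is connected.\<close>

lemma injective_interval_open_map:
  fixes f :: "'a::linear_continuum_topology \<Rightarrow> real"
  assumes f: "continuous_on {a<..<b} f" "inj_on f {a<..<b}" and W: "open W" "W \<subseteq> {a<..<b}"
  shows "open (f ` W)"
proof (subst open_subopen, intro ballI)
  fix y assume "y \<in> f ` W"
  then obtain s where s: "s \<in> W" "y = f s" by blast
  then have ab: "a < s" "s < b" using W(2) by auto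
  obtain c where c: "c < s" "{c<..s} \<subseteq> W" using open_left[OF W(1) s(1) ab(1)] by blast
  obtain d where d: "s < d" "{s..<d} \<subseteq> W" using open_right[OF W(1) s(1) ab(2)] by blast
  obtain c1 where c1: "c < c1" "c1 < s" using dense c(1) by blast
  obtain d1 where d1: "s < d1" "d1 < d" using dense d(1) by blast
  have sub: "{c1..d1} \<subseteq> W"
  proof
    fix z assume z: "z \<in> {c1..d1}"
    show "z \<in> W"
    proof (cases "z \<le> s")
      case True
      then have "z \<in> {c<..s}" using z c1 by auto
      then show ?thesis using c(2) by blast
    next
      case False
      then have "z \<in> {s..<d}" using z d1 by auto
      then show ?thesis using d(2) by blast
    qed
  qed
  then have sub': "{c1..d1} \<subseteq> {a<..<b}" using W(2) by blast
  have cont: "continuous_on {c1..d1} f" using f(1) sub' by (rule continuous_on_subset)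
  have conn: "connected (f ` {c1..d1})" using cont by (intro connected_continuous_image) auto
  have ends: "f c1 \<in> f ` {c1..d1}" "f d1 \<in> f ` {c1..d1}"
    using c1 d1 by (auto intro!: imageI)
  have "f c1 < f s \<and> f s < f d1 \<or> f d1 < f s \<and> f s < f c1"
    using c1(2) d1(1) cont inj_on_subset[OF f(2) sub'] by (rule continuous_inj_imp_mono)
  then have "\<exists>p q. p \<in> f ` {c1..d1} \<and> q \<in> f ` {c1..d1} \<and> p < y \<and> y < q"
    using ends s(2) by blast
  then obtain p q where pq: "p \<in> f ` {c1..d1}" "q \<in> f ` {c1..d1}" "p < y" "y < q" by blast
  have "{p<..<q} \<subseteq> f ` {c1..d1}"
    using connectedD_interval[OF conn pq(1,2)] by auto
  then show "\<exists>T. open T \<and> y \<in> T \<and> T \<subseteq> f ` W"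
    using pq sub by (intro exI[of _ "{p<..<q}"]) auto
qed

section \<open>Boxes and charts of the cylinder\<close>

lemma openin_cylinder_Times:
  assumes "openin (top_of_set circle) A" "open B" "B \<subseteq> long_ray"
  shows "openin long_cylinder (A \<times> B)"
proof -
  obtain O' where O': "open O'" "A = circle \<inter> O'" using assms(1) by (auto simp: openin_open)
  have "A \<times> B = (circle \<times> long_ray) \<inter> (O' \<times> B)" using O'(2) assms(3) by auto
  then show ?thesis using O'(1) assms(2) open_Times openin_open by metis
qed

lemma open_box:
  assumes "openin long_cylinder U" "(x, t) \<in> U"
  obtains e b b' where "0 < e" "b < t" "t < b'" "(ball x e \<inter> circle) \<times> {b<..<b'} \<subseteq> U"
proof -
  obtain O' where O': "open O'" "U = (circle \<times> long_ray) \<inter> O'" using assms(1) by (auto simp: openin_open)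
  then have "(x, t) \<in> O'" using assms(2) by blast
  then obtain M N where MN: "open M" "open N" "(x, t) \<in> M \<times> N" "M \<times> N \<subseteq> O'"
    using open_prod_elim[OF O'(1)] by metis
  obtain e where e: "0 < e" "ball x e \<subseteq> M" using MN(1,3) openE by blast
  have t: "0 < t" using O'(2) assms(2) by (auto simp: long_ray_eq)
  obtain b where b: "b < t" "{b<..t} \<subseteq> N" using open_left[OF MN(2) _ t] MN(3) by blast
  obtain a where "t < a" using gt_ex by blast
  then obtain b' where b': "t < b'" "{t..<b'} \<subseteq> N" using open_right[OF MN(2), of t a] MN(3) by blast
  have "{b<..<b'} \<subseteq> N"
  proof
    fix s assume "s \<in> {b<..<b'}"
    then show "s \<in> N" using b(2) b'(2) by (cases "s \<le> t") (auto simp: subset_iff)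
  qed
  moreover have "{b<..<b'} \<subseteq> long_ray"
    using greaterThan_subset_long_ray[of b] by auto
  ultimately have "(ball x e \<inter> circle) \<times> {b<..<b'} \<subseteq> U" using e(2) MN(4) O'(2) by blast
  then show thesis using that e(1) b(1) b'(1) by blast
qed

lemma open_arc_box:
  assumes "openin long_cylinder U" "(x, t) \<in> U"
  obtains \<theta> d b b' where "0 < d" "d \<le> pi / 2" "x = cis \<theta>" "x \<in> circle_arc \<theta> d" "b < t" "t < b'"
    "circle_arc \<theta> d \<times> {b<..<b'} \<subseteq> U"
proof -
  obtain e b b' where e: "0 < e" "b < t" "t < b'" "(ball x e \<inter> circle) \<times> {b<..<b'} \<subseteq> U"
    using open_box[OF assms] .
  have "x \<in> circle" using openin_subset[OF assms(1)] assms(2) by auto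
  then obtain \<theta> where \<theta>: "x = cis \<theta>" using circle_eq_cis by blast
  obtain d where d: "0 < d" "d \<le> pi / 2" "circle_arc \<theta> d \<subseteq> ball (cis \<theta>) e"
    using circle_arc_small[OF e(1)] by blast
  then have "circle_arc \<theta> d \<times> {b<..<b'} \<subseteq> U" using e(4) circle_arc_subset \<theta> by blast
  then show thesis using that d e \<theta> circle_arc_centre by blast
qed

lemma cylinder_chart_continuous:
  assumes "chart_on long_cylinder U \<phi>"
  shows "continuous_on U \<phi>"
proof -
  have "U \<subseteq> circle \<times> long_ray" using chart_on_subset_topspace[OF assms] by simp
  then show ?thesis
    using chart_on_continuous[OF assms] by (simp add: subtopology_subtopology Int_absorb1)
qed

text \<open>Pressing down is applied with the radius discretised to \<open>1 / (real n + 1)\<close>,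
  so that one pair of radius and lower height serves unboundedly many upper heights
  \<open>a\<close>; every \<open>\<alpha>\<close> lies below one of those.\<close>

lemma cylinder_uniform_boxes:
  fixes F :: "(complex \<times> closed_long_ray, real, real) fchart set"
  assumes F: "foliated_atlas long_cylinder F"
  obtains \<beta> e where "0 < e"
    "\<And>x \<alpha>. \<lbrakk>x \<in> circle; \<beta> < \<alpha>\<rbrakk> \<Longrightarrow> \<exists>(U, \<phi>)\<in>F. (ball x e \<inter> circle) \<times> {\<beta><..<\<alpha>} \<subseteq> U"
proof -
  \<comment> \<open>Including \<open>a\<close> in the interval is what yields some
    \<open>b < a\<close>: a chart around a point at height \<open>a\<close> reaches strictly below
    it.\<close>
  define P where "P n b a \<longleftrightarrow>
    (\<forall>x\<in>circle. \<exists>(U, \<phi>)\<in>F. (ball x (1 / (real n + 1)) \<inter> circle) \<times> {b<..a} \<subseteq> U)" for n b a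
  have "\<exists>n b. unbounded_above {a. P n b a}"
  proof (rule pressing_down_long_ray)
    fix m n b c a assume P: "P m b a" and le: "m \<le> n" "b \<le> c"
    have "ball x (1 / (real n + 1)) \<subseteq> ball x (1 / (real m + 1))" for x :: complex
      using le(1) by (intro subset_ball) (simp add: frac_le)
    moreover have "{c<..a} \<subseteq> {b<..a}" using le(2) by auto
    ultimately have "(ball x (1 / (real n + 1)) \<inter> circle) \<times> {c<..a} \<subseteq> (ball x (1 / (real m + 1)) \<inter> circle) \<times> {b<..a}"
      for x :: complex by blast
    note sub = this
    show "P n c a"
      unfolding P_def
    proof
      fix x :: complex assume "x \<in> circle"
      then obtain U \<phi> where "(U, \<phi>) \<in> F" "(ball x (1 / (real m + 1)) \<inter> circle) \<times> {b<..a} \<subseteq> U"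
        using P unfolding P_def by blast
      then show "\<exists>(U, \<phi>)\<in>F. (ball x (1 / (real n + 1)) \<inter> circle) \<times> {c<..a} \<subseteq> U"
        using sub[of x] by blast
    qed
  next
    fix a :: closed_long_ray assume a: "0 < a"
    have "\<exists>e b. 0 < e \<and> b < a \<and> (\<exists>(U, \<phi>)\<in>F. (ball x e \<inter> circle) \<times> {b<..a} \<subseteq> U)"
      if x: "x \<in> circle" for x
    proof -
      obtain U \<phi> where U: "(U, \<phi>) \<in> F" "(x, a) \<in> U"
        using foliated_atlas_cover[OF F, of "(x, a)"] x a by (auto simp: long_ray_eq)
      obtain e b b' where e: "0 < e" "b < a" "a < b'" "(ball x e \<inter> circle) \<times> {b<..<b'} \<subseteq> U"
        using open_box[OF chart_on_openin[OF foliated_atlas_chart[OF F U(1)]] U(2)] .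
      have "{b<..a} \<subseteq> {b<..<b'}" using e(3) by auto
      then have "(ball x e \<inter> circle) \<times> {b<..a} \<subseteq> U" using e(4) by blast
      then show ?thesis using e(1,2) U(1) by blast
    qed
    then obtain e b where eb: "\<And>x. x \<in> circle \<Longrightarrow> 0 < e x \<and> b x < a \<and>
        (\<exists>(U, \<phi>)\<in>F. (ball x (e x) \<inter> circle) \<times> {b x<..a} \<subseteq> U)" by metis
    then have pos: "\<And>x. x \<in> circle \<Longrightarrow> 0 < e x" and below: "\<And>x. x \<in> circle \<Longrightarrow> b x < a" by blast+
    \<comment> \<open>Half radii leave room: a ball of radius at most \<open>e x / 2\<close> about a
      point of \<open>ball x (e x / 2)\<close> stays inside \<open>ball x (e x)\<close>.\<close>
    have "circle \<subseteq> (\<Union>x\<in>circle. ball x (e x / 2))" using pos by force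
    then obtain D where D: "D \<subseteq> circle" "finite D" "circle \<subseteq> (\<Union>x\<in>D. ball x (e x / 2))"
      by (rule compactE_image[OF compact_sphere open_ball])
    have D0: "D \<noteq> {}" using D(3) by fastforce
    define e0 where "e0 = Min ((\<lambda>x. e x / 2) ` D)"
    define b0 where "b0 = Max (b ` D)"
    have "0 < e0" unfolding e0_def using D D0 pos by (subst Min_gr_iff) auto
    then obtain n where n: "1 / (real n + 1) < e0"
      using reals_Archimedean[of e0] by (auto simp: inverse_eq_divide add.commute)
    have "b0 \<in> b ` D" unfolding b0_def using D(2) D0 by (intro Max_in) auto
    then have b0: "b0 < a" using below D(1) by blast
    have "P n b0 a"
      unfolding P_def
    proof
      fix y :: complex assume "y \<in> circle"
      then obtain x where x: "x \<in> D" "dist x y < e x / 2" using D(3) by auto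
      have "e0 \<le> e x / 2" unfolding e0_def using D(2) x(1) by (intro Min_le) auto
      have "b x \<le> b0" unfolding b0_def using D(2) x(1) by (intro Max_ge) auto
      have "ball y (1 / (real n + 1)) \<subseteq> ball x (e x)"
      proof
        fix z assume "z \<in> ball y (1 / (real n + 1))"
        then have "dist y z < e x / 2" using n \<open>e0 \<le> e x / 2\<close> by simp
        then show "z \<in> ball x (e x)" using x(2) dist_triangle[of x z y] by simp
      qed
      moreover obtain U \<phi> where U: "(U, \<phi>) \<in> F" "(ball x (e x) \<inter> circle) \<times> {b x<..a} \<subseteq> U"
        using eb x(1) D(1) by blast
      moreover have "{b0<..a} \<subseteq> {b x<..a}" using \<open>b x \<le> b0\<close> by auto
      ultimately have "(ball y (1 / (real n + 1)) \<inter> circle) \<times> {b0<..a} \<subseteq> U" by blast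
      then show "\<exists>(U, \<phi>)\<in>F. (ball y (1 / (real n + 1)) \<inter> circle) \<times> {b0<..a} \<subseteq> U"
        using U(1) by blast
    qed
    then show "\<exists>n. \<exists>b<a. P n b a" using b0 by blast
  qed
  then obtain n \<beta> where unb: "unbounded_above {a. P n \<beta> a}" by blast
  show thesis
  proof (rule that[of "1 / (real n + 1)" \<beta>])
    fix x :: complex and \<alpha> assume x: "x \<in> circle" and "\<beta> < \<alpha>"
    obtain a where a: "\<alpha> < a" "P n \<beta> a" using unb by (auto simp: unbounded_above_def)
    then obtain U \<phi> where U: "(U, \<phi>) \<in> F" "(ball x (1 / (real n + 1)) \<inter> circle) \<times> {\<beta><..a} \<subseteq> U"
      using x unfolding P_def by blast
    have "{\<beta><..<\<alpha>} \<subseteq> {\<beta><..a}" using a(1) by auto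
    then have "(ball x (1 / (real n + 1)) \<inter> circle) \<times> {\<beta><..<\<alpha>} \<subseteq> U" using U(2) by blast
    then show "\<exists>(U, \<phi>)\<in>F. (ball x (1 / (real n + 1)) \<inter> circle) \<times> {\<beta><..<\<alpha>} \<subseteq> U"
      using U(1) by blast
  qed simp
qed

lemma foliated_strip_of_charts:
  fixes F :: "(complex \<times> closed_long_ray, real, real) fchart set"
  assumes F: "foliated_atlas long_cylinder F"
    and A: "openin (top_of_set circle) A" "connected A"
    and c: "\<And>\<alpha>. \<beta> < \<alpha> \<Longrightarrow> (U \<alpha>, \<phi> \<alpha>) \<in> F" "\<And>\<alpha>. \<beta> < \<alpha> \<Longrightarrow> A \<times> {\<beta><..<\<alpha>} \<subseteq> U \<alpha>"
  shows "foliated_strip A \<beta> (\<lambda>\<alpha> p. snd (\<phi> \<alpha> p))"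
proof
  show "connected A" by (rule A(2))
  have ray: "{\<beta><..<\<alpha>} \<subseteq> long_ray" for \<alpha>
    using greaterThan_subset_long_ray[of \<beta>] by auto
  fix \<alpha> assume \<alpha>: "\<beta> < \<alpha>"
  have ch: "chart_on long_cylinder (U \<alpha>) (\<phi> \<alpha>)" using F c(1)[OF \<alpha>] by (rule foliated_atlas_chart)
  show "continuous_on (A \<times> {\<beta><..<\<alpha>}) (\<lambda>p. snd (\<phi> \<alpha> p))"
    by (intro continuous_intros continuous_on_subset[OF cylinder_chart_continuous[OF ch] c(2)[OF \<alpha>]])
  have "open (\<phi> \<alpha> ` (A \<times> {\<beta><..<\<alpha>}))"
    by (rule chart_on_open_image[OF ch openin_cylinder_Times[OF A(1) _ ray] c(2)[OF \<alpha>]]) simp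
  then have "open (snd ` \<phi> \<alpha> ` (A \<times> {\<beta><..<\<alpha>}))" by (rule open_image_snd)
  then show "open ((\<lambda>p. snd (\<phi> \<alpha> p)) ` (A \<times> {\<beta><..<\<alpha>}))" by (simp add: image_image)
  fix \<gamma> assume \<gamma>: "\<alpha> \<le> \<gamma>"
  then have \<beta>\<gamma>: "\<beta> < \<gamma>" using \<alpha> by simp
  obtain h where h: "\<And>m. m \<in> U \<alpha> \<Longrightarrow> m \<in> U \<gamma> \<Longrightarrow> snd (\<phi> \<gamma> m) = h (snd (\<phi> \<alpha> m))"
    "embedding_map (top_of_set (snd ` \<phi> \<alpha> ` (U \<alpha> \<inter> U \<gamma>))) euclidean h"
    by (rule foliated_atlas_transition[OF F c(1)[OF \<alpha>] c(1)[OF \<beta>\<gamma>]]) blast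
  let ?Q = "(\<lambda>p. snd (\<phi> \<alpha> p)) ` (A \<times> {\<beta><..<\<alpha>})"
  have sub: "A \<times> {\<beta><..<\<alpha>} \<subseteq> U \<alpha> \<inter> U \<gamma>" using c(2)[OF \<alpha>] c(2)[OF \<beta>\<gamma>] \<gamma> by fastforce
  then have "?Q \<subseteq> snd ` \<phi> \<alpha> ` (U \<alpha> \<inter> U \<gamma>)" by (auto simp: image_image)
  then have emb: "embedding_map (top_of_set ?Q) euclidean h" using h(2) embedding_map_subset by blast
  then have "continuous_on ?Q h"
    using homeomorphic_imp_continuous_map unfolding embedding_map_def by fastforce
  moreover have "inj_on h ?Q"
    using emb homeomorphic_imp_injective_map unfolding embedding_map_def by fastforce
  moreover have "\<forall>p\<in>A \<times> {\<beta><..<\<alpha>}. snd (\<phi> \<gamma> p) = h (snd (\<phi> \<alpha> p))" using h(1) sub by blast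
  ultimately show "\<exists>h. continuous_on ?Q h \<and> inj_on h ?Q \<and>
      (\<forall>p\<in>A \<times> {\<beta><..<\<alpha>}. snd (\<phi> \<gamma> p) = h (snd (\<phi> \<alpha> p)))" by blast
qed

section \<open>Horizontal leaves\<close>

text \<open>The level curve \<open>\<sigma>\<close> through \<open>(x, t)\<close> lies in a plaque,
  hence in the leaf, hence at height \<open>t\<close>. Its angular coordinate is a continuous
  injective function of one real variable, so by invariance of domain it sweeps out a neighbourhood
  of \<open>x\<close> in the arc. The transverse coordinate is therefore locally constant on the
  connected arc.\<close>

lemma leaf_circle_horizontal:
  fixes F :: "(complex \<times> closed_long_ray, real, real) fchart set"
  assumes F: "foliation long_cylinder F" and leaf: "circle \<times> {t} \<in> leaves long_cylinder F"
    and U: "(U, \<phi>) \<in> F" "circle_arc \<theta> d \<times> {t} \<subseteq> U" and d: "0 < d" "d \<le> pi / 2"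
    and xy: "x \<in> circle_arc \<theta> d" "y \<in> circle_arc \<theta> d"
  shows "snd (\<phi> (x, t)) = snd (\<phi> (y, t))"
proof (rule connected_local_const[OF connected_circle_arc xy(1,2)], rule ballI)
  fix x assume x: "x \<in> circle_arc \<theta> d"
  let ?k = "\<lambda>z. Im (z * cis (- \<theta>))"
  have at: "foliated_atlas long_cylinder F" using F by (simp add: foliation_def)
  have d': "d \<le> pi" using d pi_gt_zero by simp
  \<comment> \<open>Over the arc the coordinate \<open>?k\<close> is injective, so at height
    \<open>t\<close> it determines the point.\<close>
  define U' where "U' = U \<inter> (circle_arc \<theta> d \<times> long_ray)"
  have U'_open: "openin long_cylinder U'"
    unfolding U'_def
    by (intro openin_Int openin_cylinder_Times openin_circle_arc open_long_ray subset_refl d(1) d'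
        chart_on_openin[OF foliated_atlas_chart[OF at U(1)]])
  have U'F: "(U', \<phi>) \<in> F"
    using foliation_restrict[OF F U(1) U'_open] by (simp add: U'_def)
  have ch: "chart_on long_cylinder U' \<phi>" using at U'F by (rule foliated_atlas_chart)
  have "U \<subseteq> circle \<times> long_ray"
    using chart_on_subset_topspace[OF foliated_atlas_chart[OF at U(1)]] by simp
  then have xU': "(x, t) \<in> U'" using x U(2) by (auto simp: U'_def)
  obtain P where P: "P \<in> plaques long_cylinder F" "(x, t) \<in> P"
    "\<And>C. \<lbrakk>connectedin long_cylinder C; (x, t) \<in> C;
      C \<subseteq> {m \<in> U'. snd (\<phi> m) = snd (\<phi> (x, t))}\<rbrakk> \<Longrightarrow> C \<subseteq> P"
    by (rule plaque_at[OF U'F chart_on_subset_topspace[OF ch] xU']) blast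
  have "(x, t) \<in> circle \<times> {t}" using x circle_arc_subset by blast
  then have Pt: "P \<subseteq> circle \<times> {t}" using plaque_subset_leaf[OF at P(1) leaf P(2)] by blast
  define r where "r = fst (\<phi> (x, t))"
  define v where "v = snd (\<phi> (x, t))"
  have "(r, v) \<in> \<phi> ` U'" using xU' by (force simp: r_def v_def)
  then obtain J K where JK: "open J" "open K" "(r, v) \<in> J \<times> K" "J \<times> K \<subseteq> \<phi> ` U'"
    using open_prod_elim[OF chart_on_open_image[OF ch U'_open subset_refl]] by metis
  obtain \<epsilon> where \<epsilon>: "0 < \<epsilon>" "ball r \<epsilon> \<subseteq> J" using JK(1,3) openE by blast
  have img: "(\<rho>, v) \<in> \<phi> ` U'" if "\<rho> \<in> ball r \<epsilon>" for \<rho> using that \<epsilon>(2) JK(3,4) by blast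
  define \<sigma> where "\<sigma> \<rho> = inv_into U' \<phi> (\<rho>, v)" for \<rho>
  have \<sigma>U: "\<sigma> \<rho> \<in> U'" "\<phi> (\<sigma> \<rho>) = (\<rho>, v)" if "\<rho> \<in> ball r \<epsilon>" for \<rho>
    using inv_into_into[OF img[OF that]] f_inv_into_f[OF img[OF that]] by (auto simp: \<sigma>_def)
  have \<sigma>r: "\<sigma> r = (x, t)"
    using chart_on_inj[OF ch] xU' by (simp add: \<sigma>_def r_def v_def)
  have "continuous_map (top_of_set (ball r \<epsilon>)) (top_of_set (\<phi> ` U')) (\<lambda>\<rho>. (\<rho>, v))"
    using img by (fastforce intro!: continuous_intros)
  then have "continuous_map (top_of_set (ball r \<epsilon>)) (subtopology long_cylinder U') (inv_into U' \<phi> \<circ> (\<lambda>\<rho>. (\<rho>, v)))"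
    using chart_on_inverse[OF ch] by (rule continuous_map_compose)
  moreover have "inv_into U' \<phi> \<circ> (\<lambda>\<rho>. (\<rho>, v)) = \<sigma>" by (simp add: fun_eq_iff \<sigma>_def)
  moreover have U'_sub: "U' \<subseteq> circle \<times> long_ray" using chart_on_subset_topspace[OF ch] by simp
  then have "subtopology long_cylinder U' = top_of_set U'"
    by (simp add: subtopology_subtopology Int_absorb1)
  ultimately have cont: "continuous_on (ball r \<epsilon>) \<sigma>" by simp
  then have "connected (\<sigma> ` ball r \<epsilon>)" by (rule connected_continuous_image) simp
  moreover have "\<sigma> ` ball r \<epsilon> \<subseteq> circle \<times> long_ray" using \<sigma>U(1) U'_sub by blast
  ultimately have "connectedin long_cylinder (\<sigma> ` ball r \<epsilon>)" by (simp add: connectedin_subtopology)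
  then have "\<sigma> ` ball r \<epsilon> \<subseteq> P"
  proof (rule P(3))
    show "(x, t) \<in> \<sigma> ` ball r \<epsilon>" using \<sigma>r \<epsilon>(1) by (intro image_eqI[of _ _ r]) auto
  qed (use \<sigma>U in \<open>auto simp: v_def\<close>)
  then have snd\<sigma>: "snd (\<sigma> \<rho>) = t" if "\<rho> \<in> ball r \<epsilon>" for \<rho> using that Pt by fastforce
  have arc: "fst (\<sigma> \<rho>) \<in> circle_arc \<theta> d" if "\<rho> \<in> ball r \<epsilon>" for \<rho>
    using \<sigma>U(1)[OF that] by (auto simp: U'_def)
  let ?f = "\<lambda>\<rho>. ?k (fst (\<sigma> \<rho>))"
  have "inj_on ?f (ball r \<epsilon>)"
  proof (rule inj_onI)
    fix \<rho> \<rho>' assume \<rho>: "\<rho> \<in> ball r \<epsilon>" "\<rho>' \<in> ball r \<epsilon>" "?f \<rho> = ?f \<rho>'"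
    then have "fst (\<sigma> \<rho>) = fst (\<sigma> \<rho>')"
      using inj_onD[OF circle_arc_coordinate_inj[OF d(2)]] arc by blast
    then have "\<sigma> \<rho> = \<sigma> \<rho>'" using snd\<sigma> \<rho> by (simp add: prod_eq_iff)
    then show "\<rho> = \<rho>'" using \<sigma>U(2) \<rho> by (metis prod.inject)
  qed
  moreover have "continuous_on (ball r \<epsilon>) ?f" by (intro continuous_intros cont)
  ultimately have "open (?f ` ball r \<epsilon>)" using invariance_of_domain open_ball by blast
  then have "open (?k -` ?f ` ball r \<epsilon>)" by (rule open_vimage) (intro continuous_intros)
  moreover have "x \<in> ?k -` ?f ` ball r \<epsilon>" using \<epsilon>(1) \<sigma>r by (force intro: image_eqI[of _ _ r])
  moreover have "v = snd (\<phi> (z, t))" if z: "z \<in> circle_arc \<theta> d" "z \<in> ?k -` ?f ` ball r \<epsilon>" for z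
  proof -
    obtain \<rho> where \<rho>: "\<rho> \<in> ball r \<epsilon>" "?k z = ?f \<rho>" using z(2) by blast
    then have "z = fst (\<sigma> \<rho>)"
      using inj_onD[OF circle_arc_coordinate_inj[OF d(2)]] arc z(1) by blast
    then have "(z, t) = \<sigma> \<rho>" using snd\<sigma>[OF \<rho>(1)] by (simp add: prod_eq_iff)
    then show ?thesis using \<sigma>U(2)[OF \<rho>(1)] by simp
  qed
  ultimately show "\<forall>\<^sub>F z in at x within circle_arc \<theta> d. snd (\<phi> (x, t)) = snd (\<phi> (z, t))"
    unfolding eventually_at_topological v_def by blast
qed

text \<open>\<open>leaf_of_plaques\<close> asks for plaques that lie within the circle and are open
  in it. A level of \<open>U\<close> may run beyond the arc, so the chart is cut down until the
  level through \<open>(z, t)\<close> is exactly the arc at height \<open>t\<close>.\<close>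

lemma circle_leafI:
  fixes F :: "(complex \<times> closed_long_ray, real, real) fchart set"
  assumes F: "foliation long_cylinder F" and t: "t \<in> long_ray"
    and loc: "\<And>z. z \<in> circle \<Longrightarrow> \<exists>\<theta> d U \<phi>. 0 < d \<and> d \<le> pi / 2 \<and> z \<in> circle_arc \<theta> d \<and> (U, \<phi>) \<in> F \<and>
      circle_arc \<theta> d \<times> {t} \<subseteq> U \<and> (\<forall>x\<in>circle_arc \<theta> d. snd (\<phi> (x, t)) = snd (\<phi> (z, t)))"
  shows "circle \<times> {t} \<in> leaves long_cylinder F"
proof (rule leaf_of_plaques)
  show at: "foliated_atlas long_cylinder F" using F by (simp add: foliation_def)
  have "connected (circle \<times> {t})" by (intro connected_Times connected_sphere) auto
  then show "connectedin long_cylinder (circle \<times> {t})"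
    using t by (auto simp: connectedin_subtopology)
  show "circle \<times> {t} \<noteq> {}" by (auto intro: exI[of _ 1])
next
  have at: "foliated_atlas long_cylinder F" using F by (simp add: foliation_def)
  fix p assume "p \<in> circle \<times> {t}"
  then obtain z where z: "p = (z, t)" "z \<in> circle" by blast
  obtain \<theta> d U \<phi> where d: "0 < d" "d \<le> pi / 2" "z \<in> circle_arc \<theta> d" and U: "(U, \<phi>) \<in> F"
    "circle_arc \<theta> d \<times> {t} \<subseteq> U" "\<And>x. x \<in> circle_arc \<theta> d \<Longrightarrow> snd (\<phi> (x, t)) = snd (\<phi> (z, t))"
    using loc[OF z(2)] by blast
  have d': "d \<le> pi" using d pi_gt_zero by simp
  let ?A = "circle_arc \<theta> d"
  have ch: "chart_on long_cylinder U \<phi>" using at U(1) by (rule foliated_atlas_chart)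
  have "continuous_on ?A (\<lambda>x. fst (\<phi> (x, t)))"
    by (intro continuous_intros continuous_on_compose2[OF cylinder_chart_continuous[OF ch]])
       (use U(2) in auto)
  moreover have "inj_on (\<lambda>x. fst (\<phi> (x, t))) ?A"
  proof (rule inj_onI)
    fix x y assume "x \<in> ?A" "y \<in> ?A" "fst (\<phi> (x, t)) = fst (\<phi> (y, t))"
    then have "\<phi> (x, t) = \<phi> (y, t)" "(x, t) \<in> U" "(y, t) \<in> U"
      using U(2,3) by (auto simp: prod_eq_iff)
    then show "x = y" using inj_onD[OF chart_on_inj[OF ch]] by blast
  qed
  ultimately have J: "open ((\<lambda>x. fst (\<phi> (x, t))) ` ?A)"
    using circle_arc_open_map[OF d(2)] openin_circle_arc[OF d(1) d'] by blast
  \<comment> \<open>Only leafwise coordinates attained on the arc are kept; a point of the level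
    then shares both coordinates with a point of the arc and equals it by injectivity of
    \<open>\<phi>\<close>.\<close>
  define U' where "U' = {m \<in> U. \<phi> m \<in> ((\<lambda>x. fst (\<phi> (x, t))) ` ?A) \<times> UNIV}"
  have U'_open: "openin long_cylinder U'"
    unfolding U'_def by (intro chart_on_openin_vimage[OF ch] open_Times J open_UNIV)
  then have U'F: "(U', \<phi>) \<in> F" using foliation_restrict[OF F U(1)] by (auto simp: U'_def)
  have level: "{m \<in> U'. snd (\<phi> m) = snd (\<phi> (z, t))} = ?A \<times> {t}"
  proof (intro equalityI subsetI)
    fix m assume "m \<in> {m \<in> U'. snd (\<phi> m) = snd (\<phi> (z, t))}"
    then obtain x where x: "x \<in> ?A" "fst (\<phi> m) = fst (\<phi> (x, t))" "m \<in> U" "snd (\<phi> m) = snd (\<phi> (z, t))"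
      unfolding U'_def by (auto simp: mem_Times_iff)
    then have "\<phi> m = \<phi> (x, t)" using U(3) by (simp add: prod_eq_iff)
    then have "m = (x, t)" using inj_onD[OF chart_on_inj[OF ch]] x U(2) by blast
    then show "m \<in> ?A \<times> {t}" using x by simp
  next
    fix m assume "m \<in> ?A \<times> {t}"
    then obtain x where "m = (x, t)" "x \<in> ?A" by blast
    then show "m \<in> {m \<in> U'. snd (\<phi> m) = snd (\<phi> (z, t))}"
      using U(2) U(3)[of x] unfolding U'_def by (auto simp: mem_Times_iff)
  qed
  have U'_sub: "U' \<subseteq> circle \<times> long_ray" using openin_subset[OF U'_open] by simp
  have zU': "(z, t) \<in> U'" using level d(3) by blast
  obtain P where P: "P \<in> plaques long_cylinder F" "(z, t) \<in> P"
    "P \<subseteq> {m \<in> U'. snd (\<phi> m) = snd (\<phi> (z, t))}"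
    "\<And>C. \<lbrakk>connectedin long_cylinder C; (z, t) \<in> C;
      C \<subseteq> {m \<in> U'. snd (\<phi> m) = snd (\<phi> (z, t))}\<rbrakk> \<Longrightarrow> C \<subseteq> P"
    by (rule plaque_at[OF U'F _ zU']) (use U'_sub in auto)
  have "connected (?A \<times> {t})" by (intro connected_Times connected_circle_arc) auto
  then have "connectedin long_cylinder (?A \<times> {t})"
    using t circle_arc_subset by (auto simp: connectedin_subtopology)
  then have "?A \<times> {t} \<subseteq> P" using P(4) level d(3) by blast
  then have PA: "P = ?A \<times> {t}" using P(3) level by blast
  obtain O' where O': "open O'" "?A = circle \<inter> O'"
    using openin_circle_arc[OF d(1) d'] by (auto simp: openin_open)
  have "openin (top_of_set (circle \<times> {t})) ((circle \<times> {t}) \<inter> (O' \<times> UNIV))"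
    using O'(1) by (intro openin_open_Int open_Times) auto
  moreover have "P = (circle \<times> {t}) \<inter> (O' \<times> UNIV)" using PA O'(2) by auto
  moreover have "subtopology long_cylinder (circle \<times> {t}) = top_of_set (circle \<times> {t})"
    using t by (simp add: subtopology_subtopology Int_absorb1 Sigma_mono)
  ultimately have P_open: "openin (subtopology long_cylinder (circle \<times> {t})) P" by simp
  show "\<exists>P\<in>plaques long_cylinder F. p \<in> P \<and> P \<subseteq> circle \<times> {t} \<and>
      openin (subtopology long_cylinder (circle \<times> {t})) P"
  proof (intro bexI[of _ P] conjI)
    show "p \<in> P" using P(2) z(1) by simp
    show "P \<subseteq> circle \<times> {t}" unfolding PA using circle_arc_subset[of \<theta> d] by blast
  qed (rule P_open P(1))+
next
  have at: "foliated_atlas long_cylinder F" using F by (simp add: foliation_def)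
  fix p assume p: "p \<in> topspace long_cylinder - circle \<times> {t}"
  then have pX: "p \<in> topspace long_cylinder" by blast
  obtain U \<phi> where U: "(U, \<phi>) \<in> F" "p \<in> U"
    by (rule foliated_atlas_cover[OF at pX])
  \<comment> \<open>Deleting the height \<open>t\<close> from the chart keeps the plaque of
    \<open>p\<close> away from the circle.\<close>
  define U' where "U' = U \<inter> (circle \<times> (long_ray - {t}))"
  have U'_open: "openin long_cylinder U'"
    unfolding U'_def
    by (intro openin_Int chart_on_openin[OF foliated_atlas_chart[OF at U(1)]] openin_cylinder_Times
        open_Diff open_long_ray closed_singleton Diff_subset openin_subtopology_self)
  then have U'F: "(U', \<phi>) \<in> F" using foliation_restrict[OF F U(1)] by (auto simp: U'_def)
  have pU': "p \<in> U'" using p U(2) by (auto simp: U'_def)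
  obtain P where "P \<in> plaques long_cylinder F" "p \<in> P" "P \<subseteq> {m \<in> U'. snd (\<phi> m) = snd (\<phi> p)}"
    by (rule plaque_at[OF U'F openin_subset[OF U'_open] pU']) blast
  then show "\<exists>P\<in>plaques long_cylinder F. p \<in> P \<and> P \<inter> (circle \<times> {t}) = {}"
    unfolding U'_def by blast
qed

text \<open>If the circle at height \<open>t\<close> is not a leaf, \<open>circle_leafI\<close>
  provides an arc with two points on different levels. They stay on different levels at nearby
  heights, which by \<open>leaf_circle_horizontal\<close> carry no circle leaf either.\<close>

lemma closedin_circle_leaves:
  fixes F :: "(complex \<times> closed_long_ray, real, real) fchart set"
  assumes F: "foliation long_cylinder F"
  shows "closedin (top_of_set long_ray) {t \<in> long_ray. circle \<times> {t} \<in> leaves long_cylinder F}"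
    (is "closedin _ ?C")
proof -
  have at: "foliated_atlas long_cylinder F" using F by (simp add: foliation_def)
  have "open (long_ray - ?C)"
  proof (subst open_subopen, intro ballI)
    fix t assume "t \<in> long_ray - ?C"
    then have t: "t \<in> long_ray" "circle \<times> {t} \<notin> leaves long_cylinder F" by auto
    then obtain z where z: "z \<in> circle" "\<not> (\<exists>\<theta> d U \<phi>. 0 < d \<and> d \<le> pi / 2 \<and> z \<in> circle_arc \<theta> d \<and> (U, \<phi>) \<in> F \<and>
        circle_arc \<theta> d \<times> {t} \<subseteq> U \<and> (\<forall>x\<in>circle_arc \<theta> d. snd (\<phi> (x, t)) = snd (\<phi> (z, t))))"
      using circle_leafI[OF F t(1)] by blast
    have ztX: "(z, t) \<in> topspace long_cylinder" using z t by simp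
    obtain U \<phi> where U: "(U, \<phi>) \<in> F" "(z, t) \<in> U"
      using foliated_atlas_cover[OF at ztX] by blast
    have ch: "chart_on long_cylinder U \<phi>" using at U(1) by (rule foliated_atlas_chart)
    obtain \<theta> d b b' where d: "0 < d" "d \<le> pi / 2" "z \<in> circle_arc \<theta> d" and b: "b < t" "t < b'"
      and sub: "circle_arc \<theta> d \<times> {b<..<b'} \<subseteq> U"
      by (rule open_arc_box[OF chart_on_openin[OF ch] U(2)]) blast
    have "circle_arc \<theta> d \<times> {t} \<subseteq> U" using sub b by auto
    then obtain x where x: "x \<in> circle_arc \<theta> d" "snd (\<phi> (x, t)) \<noteq> snd (\<phi> (z, t))"
      using z(2) d U(1) by blast
    have cont: "continuous_on {b<..<b'} (\<lambda>s. snd (\<phi> (w, s)))" if "w \<in> circle_arc \<theta> d" for w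
      by (intro continuous_intros continuous_on_compose2[OF cylinder_chart_continuous[OF ch]])
         (use sub that in auto)
    let ?N = "{b<..<b'} \<inter> (\<lambda>s. snd (\<phi> (x, s)) - snd (\<phi> (z, s))) -` (- {0})"
    have "openin (top_of_set {b<..<b'}) ?N"
      by (intro continuous_openin_preimage_gen continuous_on_diff cont x(1) d(3)) auto
    then have N: "open ?N" by (rule openin_open_trans) simp
    have "?N \<subseteq> long_ray - ?C"
    proof
      fix s assume s: "s \<in> ?N"
      then have arcs: "circle_arc \<theta> d \<times> {s} \<subseteq> U" using sub by auto
      then have "(z, s) \<in> U" using d(3) by blast
      then have "s \<in> long_ray" using openin_subset[OF chart_on_openin[OF ch]] by auto
      moreover have "circle \<times> {s} \<notin> leaves long_cylinder F"
        using leaf_circle_horizontal[OF F _ U(1) arcs d(1,2) x(1) d(3)] s by auto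
      ultimately show "s \<in> long_ray - ?C" by simp
    qed
    then show "\<exists>T. open T \<and> t \<in> T \<and> T \<subseteq> long_ray - ?C"
      using N b x(2) by (intro exI[of _ ?N]) auto
  qed
  then have "openin (top_of_set long_ray) (long_ray - ?C)"
    by (intro open_openin_trans[OF open_long_ray] Diff_subset)
  then show ?thesis by (simp add: closedin_def)
qed

section \<open>The dichotomy\<close>

text \<open>Quantifying over all charts of \<open>F\<close>, instead of the charts of one strip,
  makes the notion independent of the arc; this is what lets overlapping arcs be compared.\<close>

definition vertical_past ::
  "(complex \<times> closed_long_ray, real, real) fchart set \<Rightarrow> closed_long_ray \<Rightarrow> complex \<Rightarrow> bool"
  where "vertical_past F b z \<longleftrightarrow>
    (\<forall>U \<phi> s s'. (U, \<phi>) \<in> F \<longrightarrow> b < s \<longrightarrow> b < s' \<longrightarrow> (z, s) \<in> U \<longrightarrow> (z, s') \<in> U \<longrightarrow>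
      snd (\<phi> (z, s)) = snd (\<phi> (z, s')))"

lemma vertical_pastD:
  "\<lbrakk>vertical_past F b z; (U, \<phi>) \<in> F; b < s; b < s'; (z, s) \<in> U; (z, s') \<in> U\<rbrakk>
    \<Longrightarrow> snd (\<phi> (z, s)) = snd (\<phi> (z, s'))"
  unfolding vertical_past_def by blast

lemma vertical_past_mono: "vertical_past F b z \<Longrightarrow> b \<le> c \<Longrightarrow> vertical_past F c z"
  unfolding vertical_past_def by (meson le_less_trans)

lemma vertical_or_horizontal:
  fixes F :: "(complex \<times> closed_long_ray, real, real) fchart set"
  assumes F: "foliation long_cylinder F"
  shows "(\<exists>b. \<forall>z\<in>circle. vertical_past F b z) \<or>
    unbounded_above {t \<in> long_ray. circle \<times> {t} \<in> leaves long_cylinder F}"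
proof -
  have at: "foliated_atlas long_cylinder F" using F by (simp add: foliation_def)
  obtain \<beta> e where e: "0 < e" and box:
    "\<And>x \<alpha>. \<lbrakk>x \<in> circle; \<beta> < \<alpha>\<rbrakk> \<Longrightarrow> \<exists>(U, \<phi>)\<in>F. (ball x e \<inter> circle) \<times> {\<beta><..<\<alpha>} \<subseteq> U"
    by (rule cylinder_uniform_boxes[OF at]) blast
  obtain d where d: "0 < d" "d \<le> pi / 2" "\<And>\<theta>. circle_arc \<theta> d \<subseteq> ball (cis \<theta>) e"
    using circle_arc_small[OF e] by blast
  have d': "d \<le> pi" using d pi_gt_zero by simp
  let ?A = "\<lambda>\<theta>. circle_arc \<theta> d"
  have "\<exists>c. c \<in> F \<and> ?A \<theta> \<times> {\<beta><..<\<alpha>} \<subseteq> fst c" if \<alpha>: "\<beta> < \<alpha>" for \<theta> \<alpha>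
  proof -
    obtain U \<phi> where "(U, \<phi>) \<in> F" "(ball (cis \<theta>) e \<inter> circle) \<times> {\<beta><..<\<alpha>} \<subseteq> U"
      using box[of "cis \<theta>" \<alpha>] \<alpha> by auto
    then show ?thesis
      using d(3)[of \<theta>] circle_arc_subset[of \<theta> d] by (intro exI[of _ "(U, \<phi>)"]) auto
  qed
  then have "\<forall>\<theta> \<alpha>. \<exists>c. \<beta> < \<alpha> \<longrightarrow> c \<in> F \<and> ?A \<theta> \<times> {\<beta><..<\<alpha>} \<subseteq> fst c" by blast
  then have "\<exists>c. \<forall>\<theta> \<alpha>. \<beta> < \<alpha> \<longrightarrow> c \<theta> \<alpha> \<in> F \<and> ?A \<theta> \<times> {\<beta><..<\<alpha>} \<subseteq> fst (c \<theta> \<alpha>)"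
    by (simp only: choice_iff)
  then obtain c where c: "\<And>\<theta> \<alpha>. \<beta> < \<alpha> \<Longrightarrow> c \<theta> \<alpha> \<in> F"
    "\<And>\<theta> \<alpha>. \<beta> < \<alpha> \<Longrightarrow> ?A \<theta> \<times> {\<beta><..<\<alpha>} \<subseteq> fst (c \<theta> \<alpha>)" by blast
  define u where "u \<theta> \<alpha> p = snd (snd (c \<theta> \<alpha>) p)" for \<theta> \<alpha> p
  have cF: "(fst (c \<theta> \<alpha>), snd (c \<theta> \<alpha>)) \<in> F" if "\<beta> < \<alpha>" for \<theta> \<alpha> using c(1)[OF that] by simp
  have strip: "foliated_strip (?A \<theta>) \<beta> (u \<theta>)" for \<theta>
    unfolding u_def
    by (rule foliated_strip_of_charts[OF at openin_circle_arc[OF d(1) d'] connected_circle_arc cF c(2)])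
  \<comment> \<open>Both points lie in the strip chart \<open>c \<theta> \<gamma>\<close> as well as
    in \<open>U\<close>, so equality of levels transfers between the two charts.\<close>
  have to_past: "vertical_past F b z"
    if z: "z \<in> ?A \<theta>" and v: "foliated_strip.vertical_beyond \<beta> (u \<theta>) b z" for \<theta> b z
    unfolding vertical_past_def
  proof (intro allI impI)
    fix U \<phi> s s' assume U: "(U, \<phi>) \<in> F" "b < s" "b < s'" "(z, s) \<in> U" "(z, s') \<in> U"
    obtain \<gamma> where "max s s' < \<gamma>" using gt_ex by blast
    then have \<gamma>: "s < \<gamma>" "s' < \<gamma>" by auto
    have \<beta>b: "\<beta> \<le> b" and eq: "u \<theta> \<gamma> (z, s) = u \<theta> \<gamma> (z, s')"
      using v U \<gamma> unfolding foliated_strip.vertical_beyond_def[OF strip] by blast+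
    then have \<beta>: "\<beta> < s" "\<beta> < s'" using U by auto
    then have \<beta>\<gamma>: "\<beta> < \<gamma>" using \<gamma> by simp
    have "(z, s) \<in> fst (c \<theta> \<gamma>)" "(z, s') \<in> fst (c \<theta> \<gamma>)"
      using c(2)[OF \<beta>\<gamma>, of \<theta>] z \<beta> \<gamma> by auto
    then show "snd (\<phi> (z, s)) = snd (\<phi> (z, s'))"
      using foliated_atlas_same_level[OF at cF[OF \<beta>\<gamma>] U(1)] U(4,5) eq by (simp add: u_def)
  qed
  have from_past: "foliated_strip.vertical_beyond \<beta> (u \<theta>) (max b \<beta>) z"
    if z: "z \<in> ?A \<theta>" and v: "vertical_past F b z" for \<theta> b z
    unfolding foliated_strip.vertical_beyond_def[OF strip]
  proof (intro conjI allI impI)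
    fix s s' \<gamma> assume s: "max b \<beta> < s \<and> max b \<beta> < s' \<and> s < \<gamma> \<and> s' < \<gamma>"
    then have \<beta>\<gamma>: "\<beta> < \<gamma>" by auto
    then have "(z, s) \<in> fst (c \<theta> \<gamma>)" "(z, s') \<in> fst (c \<theta> \<gamma>)"
      using c(2)[OF \<beta>\<gamma>, of \<theta>] z s by auto
    then show "u \<theta> \<gamma> (z, s) = u \<theta> \<gamma> (z, s')"
      using vertical_pastD[OF v cF[OF \<beta>\<gamma>]] s unfolding u_def by simp
  qed simp
  have ev_iff: "foliated_strip.ev_vertical \<beta> (u \<theta>) z \<longleftrightarrow> (\<exists>b. vertical_past F b z)"
    if "z \<in> ?A \<theta>" for \<theta> z
    unfolding foliated_strip.ev_vertical_def[OF strip] using to_past from_past that by blast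
  have spread: "\<exists>b. \<forall>z\<in>?A \<theta>. vertical_past F b z"
    if z: "z \<in> ?A \<theta>" "vertical_past F b z" for \<theta> z b
  proof -
    have "foliated_strip.ev_vertical \<beta> (u \<theta>) w" if "w \<in> ?A \<theta>" for w
      using foliated_strip.ev_vertical_all[OF strip z(1) _ that] ev_iff[OF z(1)] z(2) by blast
    then obtain b where "\<forall>w\<in>?A \<theta>. foliated_strip.vertical_beyond \<beta> (u \<theta>) b w"
      using foliated_strip.ev_vertical_uniform[OF strip] by blast
    then show ?thesis using to_past by blast
  qed
  obtain I where I: "finite I" "\<And>z. z \<in> circle \<Longrightarrow> \<exists>\<theta>\<in>I. z \<in> ?A \<theta>"
    using circle_arcs_cover[OF d(1)] by blast
  show ?thesis
  proof (cases "\<exists>z\<in>circle. \<exists>b. vertical_past F b z")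
    case True
    \<comment> \<open>By \<open>spread\<close>, an arc that meets \<open>?V\<close> lies inside it,
      so \<open>?V\<close> and its complement are both unions of arcs.\<close>
    let ?V = "{z \<in> circle. \<exists>b. vertical_past F b z}"
    have near: "\<exists>\<theta>. z \<in> ?A \<theta>" if "z \<in> circle" for z using I(2)[OF that] by blast
    have "openin (top_of_set circle) ?V"
    proof (subst openin_subopen, intro ballI)
      fix z assume z: "z \<in> ?V"
      then obtain \<theta> where \<theta>: "z \<in> ?A \<theta>" using near by blast
      obtain b where "vertical_past F b z" using z by blast
      then obtain b' where "\<forall>w\<in>?A \<theta>. vertical_past F b' w" using spread[OF \<theta>] by blast
      then have "?A \<theta> \<subseteq> ?V" using circle_arc_subset[of \<theta> d] by blast
      then show "\<exists>T. openin (top_of_set circle) T \<and> z \<in> T \<and> T \<subseteq> ?V"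
        using \<theta> openin_circle_arc[OF d(1) d', of \<theta>] by blast
    qed
    moreover have "openin (top_of_set circle) (circle - ?V)"
    proof (subst openin_subopen, intro ballI)
      fix z assume z: "z \<in> circle - ?V"
      then obtain \<theta> where \<theta>: "z \<in> ?A \<theta>" using near by blast
      have "w \<in> circle - ?V" if w: "w \<in> ?A \<theta>" for w
      proof -
        have "\<not> vertical_past F b w" for b
        proof
          assume "vertical_past F b w"
          then obtain b' where "\<forall>w\<in>?A \<theta>. vertical_past F b' w" using spread[OF w] by blast
          then show False using \<theta> z by blast
        qed
        then show ?thesis using w circle_arc_subset[of \<theta> d] by blast
      qed
      then have "?A \<theta> \<subseteq> circle - ?V" by (rule subsetI)
      then show "\<exists>T. openin (top_of_set circle) T \<and> z \<in> T \<and> T \<subseteq> circle - ?V"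
        using openin_circle_arc[OF d(1) d', of \<theta>] \<theta> by blast
    qed
    then have "closedin (top_of_set circle) ?V" by (auto simp: closedin_def)
    moreover have "connected circle" by (rule connected_sphere) simp
    ultimately have "?V = {} \<or> ?V = circle" unfolding connected_clopen by blast
    then have all: "\<exists>b. vertical_past F b z" if "z \<in> circle" for z using True that by blast
    have "\<exists>b. \<forall>z\<in>?A \<theta>. vertical_past F b z" for \<theta>
      using spread[OF circle_arc_centre[OF d(1)]] all[of "cis \<theta>"] by auto
    then obtain b where b: "\<And>\<theta> z. z \<in> ?A \<theta> \<Longrightarrow> vertical_past F (b \<theta>) z" by metis
    obtain B where B: "\<forall>x\<in>b ` I. x < B"
      using countable_bounded_long_ray[of "b ` I"] I(1) by (auto simp: countable_finite)
    have "vertical_past F B z" if z: "z \<in> circle" for z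
    proof -
      obtain \<theta> where \<theta>: "\<theta> \<in> I" "z \<in> ?A \<theta>" using I(2)[OF z] by blast
      then have "b \<theta> \<le> B" using B by (simp add: less_imp_le)
      then show ?thesis using vertical_past_mono[OF b[OF \<theta>(2)]] by blast
    qed
    then show ?thesis by blast
  next
    case False
    obtain b where b: "\<beta> < b" using gt_ex by blast
    let ?H = "\<lambda>\<theta>. {t. b \<le> t \<and> foliated_strip.horizontal_at (?A \<theta>) (u \<theta>) t}"
    have "unbounded_above (\<Inter>\<theta>\<in>I. ?H \<theta>)"
    proof (rule unbounded_above_closed_INT[OF I(1)])
      fix \<theta>
      show "closed (?H \<theta>)" by (rule foliated_strip.closed_horizontal_at[OF strip b])
      have "\<not> foliated_strip.ev_vertical \<beta> (u \<theta>) z" if "z \<in> ?A \<theta>" for z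
        using False ev_iff[OF that] that circle_arc_subset[of \<theta> d] by blast
      then show "unbounded_above (?H \<theta>)"
        by (rule foliated_strip.unbounded_above_horizontal_at[OF strip _ b])
    qed
    \<comment> \<open>The additional cut supplies \<open>b \<le> t\<close> directly, without a
      member of \<open>I\<close> at hand to read it off.\<close>
    then have "unbounded_above {t \<in> \<Inter>\<theta>\<in>I. ?H \<theta>. b \<le> t}" by (rule unbounded_above_atLeast_Int)
    then have "unbounded_above {t \<in> long_ray. circle \<times> {t} \<in> leaves long_cylinder F}"
    proof (rule unbounded_above_mono, intro subsetI)
      fix t assume t: "t \<in> {t \<in> \<Inter>\<theta>\<in>I. ?H \<theta>. b \<le> t}"
      then have \<beta>t: "\<beta> < t" using b by auto
      then have tL: "t \<in> long_ray" using greaterThan_subset_long_ray[of \<beta>] by auto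
      obtain \<gamma> where \<gamma>: "t < \<gamma>" using gt_ex by blast
      then have \<beta>\<gamma>: "\<beta> < \<gamma>" using \<beta>t by simp
      have "circle \<times> {t} \<in> leaves long_cylinder F"
      proof (rule circle_leafI[OF F tL])
        fix z :: complex assume "z \<in> circle"
        then obtain \<theta> where \<theta>: "\<theta> \<in> I" "z \<in> ?A \<theta>" using I(2) by blast
        then have "foliated_strip.horizontal_at (?A \<theta>) (u \<theta>) t" using t by blast
        then have "\<forall>x\<in>?A \<theta>. u \<theta> \<gamma> (x, t) = u \<theta> \<gamma> (z, t)"
          using \<gamma> \<theta>(2) unfolding foliated_strip.horizontal_at_def[OF strip] by blast
        moreover have "?A \<theta> \<times> {t} \<subseteq> fst (c \<theta> \<gamma>)" using c(2)[OF \<beta>\<gamma>, of \<theta>] \<beta>t \<gamma> by auto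
        ultimately show "\<exists>\<theta> d U \<phi>. 0 < d \<and> d \<le> pi / 2 \<and> z \<in> circle_arc \<theta> d \<and> (U, \<phi>) \<in> F \<and>
            circle_arc \<theta> d \<times> {t} \<subseteq> U \<and> (\<forall>x\<in>circle_arc \<theta> d. snd (\<phi> (x, t)) = snd (\<phi> (z, t)))"
          using d(1,2) \<theta>(2) cF[OF \<beta>\<gamma>, of \<theta>] unfolding u_def by blast
      qed
      then show "t \<in> {t \<in> long_ray. circle \<times> {t} \<in> leaves long_cylinder F}" using tL by simp
    qed
    then show ?thesis by blast
  qed
qed

section \<open>Ultimately vertical foliations\<close>

text \<open>Above \<open>b\<close> the transverse coordinate depends on the circle point alone and,
  in a chart whose image is a box, determines it. Keeping that coordinate and replacing the leafwise
  one by its values over the single fibre of \<open>x\<close> gives a product chart;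
  \<open>foliation_refine\<close> admits it because transverse coordinates are unchanged.\<close>

lemma vertical_chart:
  fixes F :: "(complex \<times> closed_long_ray, real, real) fchart set"
  assumes F: "foliation long_cylinder F" and V: "\<And>z. z \<in> circle \<Longrightarrow> vertical_past F b z"
    and x: "x \<in> circle" and t: "b < t"
  obtains A B \<theta> \<psi> where "x \<in> A" "t \<in> B" "A \<subseteq> circle" "open B" "connected B" "B \<subseteq> {b<..}"
    "chart_on (top_of_set circle) A \<theta>" "inj_on \<theta> A"
    "continuous_on B \<psi>" "inj_on \<psi> B" "\<forall>W. open W \<longrightarrow> W \<subseteq> B \<longrightarrow> open (\<psi> ` W)"
    "(A \<times> B, \<lambda>(x, t). (\<psi> t, \<theta> x)) \<in> F"
proof -
  have at: "foliated_atlas long_cylinder F" using F by (simp add: foliation_def)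
  have ray: "{b<..} \<subseteq> long_ray" by (rule greaterThan_subset_long_ray)
  have "(x, t) \<in> topspace long_cylinder" using x t ray by auto
  then obtain U0 \<phi> where U0: "(U0, \<phi>) \<in> F" "(x, t) \<in> U0" by (rule foliated_atlas_cover[OF at])
  define U1 where "U1 = U0 \<inter> (circle \<times> {b<..})"
  have U1_open: "openin long_cylinder U1"
    unfolding U1_def
    by (intro openin_Int chart_on_openin[OF foliated_atlas_chart[OF at U0(1)]] openin_cylinder_Times
        open_greaterThan ray openin_subtopology_self)
  have U1F: "(U1, \<phi>) \<in> F" using foliation_restrict[OF F U0(1) U1_open] by (simp add: U1_def)
  have ch1: "chart_on long_cylinder U1 \<phi>" using at U1F by (rule foliated_atlas_chart)
  have "\<phi> (x, t) \<in> \<phi> ` U1" using U0(2) x t by (auto simp: U1_def)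
  then obtain J0 K where JK: "open J0" "open K" "\<phi> (x, t) \<in> J0 \<times> K" "J0 \<times> K \<subseteq> \<phi> ` U1"
    using open_prod_elim[OF chart_on_open_image[OF ch1 U1_open subset_refl]] by metis
  obtain \<epsilon> where \<epsilon>: "0 < \<epsilon>" "ball (fst (\<phi> (x, t))) \<epsilon> \<subseteq> J0"
    using JK(1,3) openE by (metis mem_Times_iff)
  \<comment> \<open>Shrinking to a box whose leafwise factor \<open>J\<close> is an interval makes
    every level of the chart connected.\<close>
  define J where "J = ball (fst (\<phi> (x, t))) \<epsilon>"
  define U where "U = {m \<in> U1. \<phi> m \<in> J \<times> K}"
  have U_open: "openin long_cylinder U"
    unfolding U_def J_def by (intro chart_on_openin_vimage[OF ch1] open_Times open_ball JK(2))
  have UF: "(U, \<phi>) \<in> F" using foliation_restrict[OF F U1F U_open] by (auto simp: U_def)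
  have ch: "chart_on long_cylinder U \<phi>" using at UF by (rule foliated_atlas_chart)
  have inj: "inj_on \<phi> U" by (rule chart_on_inj[OF ch])
  have cont: "continuous_on U \<phi>" by (rule cylinder_chart_continuous[OF ch])
  have Usub: "U \<subseteq> circle \<times> {b<..}" by (auto simp: U_def U1_def)
  have img: "(r, y) \<in> \<phi> ` U" if "r \<in> J" "y \<in> K" for r y
  proof -
    have "(r, y) \<in> \<phi> ` U1" using that JK(4) \<epsilon>(2) by (auto simp: J_def)
    then obtain m where "m \<in> U1" "\<phi> m = (r, y)" by auto
    then show ?thesis using that by (intro image_eqI[of _ _ m]) (auto simp: U_def)
  qed
  have xtU: "(x, t) \<in> U"
    using U0(2) x t JK(3) \<epsilon>(1) by (auto simp: U_def U1_def J_def mem_Times_iff)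
  have level: "snd (\<phi> (z, s)) = snd (\<phi> (z, s'))" if "(z, s) \<in> U" "(z, s') \<in> U" for z s s'
    using vertical_pastD[OF V UF, of z s s'] that Usub by blast
  have vert_open: "open ((\<lambda>s. fst (\<phi> (z, s))) ` W)"
    if z: "{z} \<times> {c<..<c'} \<subseteq> U" and W: "open W" "W \<subseteq> {c<..<c'}" for z c c' W
  proof (rule injective_interval_open_map[OF _ _ W])
    show "continuous_on {c<..<c'} (\<lambda>s. fst (\<phi> (z, s)))"
      by (intro continuous_intros continuous_on_compose2[OF cont]) (use z in auto)
    show "inj_on (\<lambda>s. fst (\<phi> (z, s))) {c<..<c'}"
    proof (rule inj_onI)
      fix s s' assume s: "s \<in> {c<..<c'}" "s' \<in> {c<..<c'}" "fst (\<phi> (z, s)) = fst (\<phi> (z, s'))"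
      then have U: "(z, s) \<in> U" "(z, s') \<in> U" using z by auto
      then have "\<phi> (z, s) = \<phi> (z, s')" using level[OF U] s(3) by (simp add: prod_eq_iff)
      then show "s = s'" using inj_onD[OF inj] U by blast
    qed
  qed
  text \<open>Plaques of \<open>U\<close> are locally vertical, and they are connected because \<open>\<phi> ` U\<close> is a box;
    hence each of them lies over a single point of the circle.\<close>
  have base: "z = z'"
    if zz: "(z, s) \<in> U" "(z', s') \<in> U" "snd (\<phi> (z, s)) = snd (\<phi> (z', s'))" for z z' s s'
  proof -
    define y where "y = snd (\<phi> (z, s))"
    define q where "q r = inv_into U \<phi> (r, y)" for r
    have yK: "y \<in> K" using zz(1) by (auto simp: y_def U_def mem_Times_iff)
    have q: "q r \<in> U" "\<phi> (q r) = (r, y)" if "r \<in> J" for r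
      using inv_into_into[OF img[OF that yK]] f_inv_into_f[OF img[OF that yK]] by (auto simp: q_def)
    have J: "fst (\<phi> (z, s)) \<in> J" "fst (\<phi> (z', s')) \<in> J"
      using zz(1,2) by (auto simp: U_def mem_Times_iff)
    have "fst (q (fst (\<phi> (z, s)))) = fst (q (fst (\<phi> (z', s'))))"
    proof (rule connected_local_const[OF _ J], rule_tac [2] ballI)
      show "connected J" by (simp add: J_def)
      fix r assume r: "r \<in> J"
      obtain w s0 where w: "q r = (w, s0)" by fastforce
      have wU: "(w, s0) \<in> U" using q(1)[OF r] w by simp
      obtain e c c' where c: "0 < e" "c < s0" "s0 < c'" "(ball w e \<inter> circle) \<times> {c<..<c'} \<subseteq> U"
        using open_box[OF U_open wU] .
      have wc: "{w} \<times> {c<..<c'} \<subseteq> U" using c(1,4) wU Usub by auto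
      let ?O = "(\<lambda>s. fst (\<phi> (w, s))) ` {c<..<c'}"
      have "open ?O" by (rule vert_open[OF wc]) auto
      moreover have "r \<in> ?O" using q(2)[OF r] w c(2,3) by (force intro: image_eqI[of _ _ s0])
      moreover have "fst (q r) = fst (q r')" if r': "r' \<in> J" "r' \<in> ?O" for r'
      proof -
        obtain s1 where s1: "s1 \<in> {c<..<c'}" "r' = fst (\<phi> (w, s1))" using r'(2) by blast
        have s1U: "(w, s1) \<in> U" using wc s1(1) by blast
        then have "snd (\<phi> (w, s1)) = y" using level[OF _ wU] q(2)[OF r] w by simp
        then have "\<phi> (w, s1) = (r', y)" using s1(2) by (simp add: prod_eq_iff)
        then have "\<phi> (w, s1) = \<phi> (q r')" using q(2)[OF r'(1)] by simp
        then have "(w, s1) = q r'" using inj_onD[OF inj] s1U q(1)[OF r'(1)] by blast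
        then have "fst (q r') = w" by (metis fst_conv)
        then show ?thesis using w by simp
      qed
      ultimately show "\<forall>\<^sub>F r' in at r within J. fst (q r) = fst (q r')"
        unfolding eventually_at_topological by blast
    qed
    moreover have "q (fst (\<phi> (z, s))) = (z, s)"
      using inj zz(1) by (simp add: q_def y_def)
    moreover have "q (fst (\<phi> (z', s'))) = (z', s')"
      using inj zz(2,3) by (simp add: q_def y_def)
    ultimately show ?thesis by simp
  qed
  obtain \<theta>0 d c c' where d: "0 < d" "d \<le> pi / 2" "x \<in> circle_arc \<theta>0 d" and c: "c < t" "t < c'"
    and box: "circle_arc \<theta>0 d \<times> {c<..<c'} \<subseteq> U"
    by (rule open_arc_box[OF U_open xtU]) blast
  let ?A = "circle_arc \<theta>0 d" and ?B = "{c<..<c'}"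
  \<comment> \<open>The chart is sampled along two axes through \<open>(x, t)\<close>: transverse
    coordinates at height \<open>t\<close>, leafwise ones over \<open>x\<close>. Injectivity of
    \<open>\<theta>\<close> comes from \<open>base\<close>, that of \<open>\<psi>\<close> from
    \<open>level\<close>.\<close>
  define \<theta> where "\<theta> z = snd (\<phi> (z, t))" for z
  define \<psi> where "\<psi> s = fst (\<phi> (x, s))" for s
  have d': "d \<le> pi" using d pi_gt_zero by simp
  have xB: "{x} \<times> ?B \<subseteq> U" using box d(3) by blast
  have At: "(z, t) \<in> U" if "z \<in> ?A" for z using box that c by auto
  have A_open: "openin (top_of_set circle) ?A" by (rule openin_circle_arc[OF d(1) d'])
  have \<theta>_cont: "continuous_on ?A \<theta>"
    unfolding \<theta>_def
    by (intro continuous_intros continuous_on_compose2[OF cont]) (use At in auto)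
  have \<theta>_inj: "inj_on \<theta> ?A"
    using base At unfolding \<theta>_def by (intro inj_onI) blast
  have \<theta>_open: "open (\<theta> ` W)" if "openin (top_of_set circle) W" "W \<subseteq> ?A" for W
    using circle_arc_open_map[OF d(2) \<theta>_cont \<theta>_inj that] .
  have circ: "subtopology (top_of_set circle) ?A = top_of_set ?A"
    using circle_arc_subset[of \<theta>0 d] by (simp add: subtopology_subtopology Int_absorb1)
  have \<theta>_chart: "chart_on (top_of_set circle) ?A \<theta>"
  proof (rule chart_onI[OF A_open _ \<theta>_inj \<theta>_open])
    show "continuous_map (subtopology (top_of_set circle) ?A) euclidean \<theta>"
      unfolding circ using \<theta>_cont by simp
  qed auto
  have \<psi>_cont: "continuous_on ?B \<psi>"
    unfolding \<psi>_def
    by (intro continuous_intros continuous_on_compose2[OF cont]) (use xB in auto)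
  have \<psi>_open: "open (\<psi> ` W)" if "open W" "W \<subseteq> ?B" for W
    unfolding \<psi>_def using vert_open[OF xB that] .
  have \<psi>_inj: "inj_on \<psi> ?B"
  proof (rule inj_onI)
    fix s s' assume s: "s \<in> ?B" "s' \<in> ?B" "\<psi> s = \<psi> s'"
    then have U: "(x, s) \<in> U" "(x, s') \<in> U" using xB by auto
    then have "\<phi> (x, s) = \<phi> (x, s')" using level[OF U] s(3) by (simp add: prod_eq_iff \<psi>_def)
    then show "s = s'" using inj_onD[OF inj] U by blast
  qed
  have "(x, s) \<in> circle \<times> {b<..}" if "s \<in> ?B" for s using xB Usub that by blast
  then have B: "?B \<subseteq> {b<..}" by auto
  let ?\<Phi> = "\<lambda>(z, s). (\<psi> s, \<theta> z)"
  have AB_open: "openin long_cylinder (?A \<times> ?B)"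
    using A_open B ray by (intro openin_cylinder_Times) auto
  have AB_sub: "?A \<times> ?B \<subseteq> circle \<times> long_ray" using openin_subset[OF AB_open] by simp
  have "chart_on long_cylinder (?A \<times> ?B) ?\<Phi>"
  proof (rule chart_onI[OF AB_open])
    have "continuous_on (?A \<times> ?B) (\<lambda>p. (\<psi> (snd p), \<theta> (fst p)))"
      by (intro continuous_intros continuous_on_compose2[OF \<psi>_cont] continuous_on_compose2[OF \<theta>_cont]) auto
    then show "continuous_map (subtopology long_cylinder (?A \<times> ?B)) euclidean ?\<Phi>"
      using AB_sub by (simp add: subtopology_subtopology Int_absorb1 case_prod_unfold)
    show "inj_on ?\<Phi> (?A \<times> ?B)"
      using \<psi>_inj \<theta>_inj by (auto simp: inj_on_def)
    fix W assume W: "openin long_cylinder W" "W \<subseteq> ?A \<times> ?B"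
    show "open (?\<Phi> ` W)"
    proof (subst open_subopen, intro ballI)
      fix p assume "p \<in> ?\<Phi> ` W"
      then obtain z s where zs: "(z, s) \<in> W" "p = (\<psi> s, \<theta> z)" by auto
      obtain e a a' where e: "0 < e" "a < s" "s < a'" "(ball z e \<inter> circle) \<times> {a<..<a'} \<subseteq> W"
        using open_box[OF W(1) zs(1)] .
      let ?A' = "ball z e \<inter> circle" and ?B' = "{a<..<a'}"
      have z: "z \<in> ?A'" using zs(1) openin_subset[OF W(1)] e(1) by auto
      have s: "s \<in> ?B'" using e by auto
      have "?A' \<subseteq> ?A" "?B' \<subseteq> ?B" using e(4) W(2) z s by blast+
      moreover have "openin (top_of_set circle) ?A'"
        by (metis Int_commute open_ball openin_open_Int)
      ultimately have "open (\<psi> ` ?B' \<times> \<theta> ` ?A')"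
        by (intro open_Times \<psi>_open \<theta>_open) auto
      moreover have "\<psi> ` ?B' \<times> \<theta> ` ?A' \<subseteq> ?\<Phi> ` W"
      proof
        fix m assume "m \<in> \<psi> ` ?B' \<times> \<theta> ` ?A'"
        then obtain s' z' where m: "m = (\<psi> s', \<theta> z')" "s' \<in> ?B'" "z' \<in> ?A'" by blast
        then have "(z', s') \<in> W" using e(4) by blast
        then show "m \<in> ?\<Phi> ` W" using m(1) by (intro image_eqI[of _ _ "(z', s')"]) auto
      qed
      moreover have "p \<in> \<psi> ` ?B' \<times> \<theta> ` ?A'" using zs(2) z s by blast
      ultimately show "\<exists>T. open T \<and> p \<in> T \<and> T \<subseteq> ?\<Phi> ` W" by blast
    qed
  qed
  moreover have "snd (?\<Phi> m) = snd (\<phi> m)" if m: "m \<in> ?A \<times> ?B" for m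
  proof -
    obtain z s where zs: "m = (z, s)" "z \<in> ?A" "s \<in> ?B" using m by blast
    then have "(z, s) \<in> U" using box by blast
    then show ?thesis using level[OF At[OF zs(2)], of s] zs(1) by (simp add: \<theta>_def)
  qed
  ultimately have "(?A \<times> ?B, ?\<Phi>) \<in> F" using foliation_refine[OF F UF _ box] by blast
  then show thesis
    using that[of ?A ?B \<theta> \<psi>] d(3) c circle_arc_subset[of \<theta>0 d] B \<theta>_chart \<theta>_inj \<psi>_cont \<psi>_inj \<psi>_open
    by auto
qed

lemma vertical_imp_ultimately_vertical:
  fixes F :: "(complex \<times> closed_long_ray, real, real) fchart set"
  assumes F: "foliation long_cylinder F" and V: "\<And>z. z \<in> circle \<Longrightarrow> vertical_past F b z"
  shows "ultimately_vertical F"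
proof -
  have at: "foliated_atlas long_cylinder F" using F by (simp add: foliation_def)
  \<comment> \<open>\<open>ultimately_vertical\<close> speaks of ordinals, so the height
    \<open>b\<close> is raised to an ordinal above it.\<close>
  obtain \<alpha> where \<alpha>: "b < ord_point \<alpha>" using ord_point_above_countable[of "{b}"] by auto
  define a where "a = ord_point \<alpha>"
  have Va: "vertical_past F a z" if "z \<in> circle" for z
    using vertical_past_mono[OF V[OF that]] \<alpha> by (simp add: a_def less_imp_le)
  define L where "L = {a<..}"
  define G where "G = restrict_foliation F (circle \<times> L)"
  let ?W = "top_of_set (circle \<times> L)"
  have L_ray: "L \<subseteq> long_ray" unfolding L_def by (rule greaterThan_subset_long_ray)
  have W_open: "openin long_cylinder (circle \<times> L)"
    using L_ray by (intro openin_cylinder_Times openin_subtopology_self) (auto simp: L_def)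
  have WX: "?W = subtopology long_cylinder (circle \<times> L)"
    using L_ray by (simp add: subtopology_subtopology Int_absorb1 Sigma_mono)
  have openW: "openin ?W U \<longleftrightarrow> openin long_cylinder U \<and> U \<subseteq> circle \<times> L" for U
    unfolding WX by (rule openin_open_subtopology[OF W_open])
  have chW: "chart_on ?W U \<phi> \<longleftrightarrow> chart_on long_cylinder U \<phi>" if "U \<subseteq> circle \<times> L"
    for U and \<phi> :: "complex \<times> closed_long_ray \<Rightarrow> real \<times> real"
  proof -
    have "subtopology ?W U = subtopology long_cylinder U"
      unfolding WX subtopology_subtopology using Int_absorb1[OF that] by (simp only: Int_assoc)
    then show ?thesis unfolding chart_on_def using openW that by metis
  qed
  have GF: "(U, \<phi>) \<in> G \<longleftrightarrow> (U, \<phi>) \<in> F \<and> U \<subseteq> circle \<times> L" for U \<phi>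
    by (auto simp: G_def restrict_foliation_def)
  \<comment> \<open>Beyond covering nothing new arises, since charts and transitions are inherited
    from \<open>F\<close>. This serves both \<open>G\<close> and its subset \<open>P\<close> of
    product charts.\<close>
  have sub_atlas: "foliated_atlas ?W P" if P: "P \<subseteq> G" and cov: "circle \<times> L \<subseteq> (\<Union>(U, \<phi>)\<in>P. U)" for P
    unfolding foliated_atlas_def
  proof (intro conjI)
    have inP: "(U, \<phi>) \<in> F" "U \<subseteq> circle \<times> L" if "(U, \<phi>) \<in> P" for U \<phi>
      using that P GF[of U \<phi>] by auto
    show "\<forall>(U, \<phi>)\<in>P. chart_on ?W U \<phi>"
    proof (rule ballI, clarify)
      fix U \<phi> assume "(U, \<phi>) \<in> P"
      then show "chart_on ?W U \<phi>"
        using chW[OF inP(2)] foliated_atlas_chart[OF at inP(1)] by simp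
    qed
    have "(\<Union>(U, \<phi>)\<in>P. U) \<subseteq> circle \<times> L"
    proof (rule UN_least, clarify)
      fix U \<phi> p q assume "(U, \<phi>) \<in> P" "(p, q) \<in> U"
      then show "p \<in> circle \<and> q \<in> L" using inP(2) by blast
    qed
    then show "(\<Union>(U, \<phi>)\<in>P. U) = topspace ?W" using cov by simp
    have "P \<subseteq> F" using inP(1) by auto
    moreover have "\<forall>c\<in>F. \<forall>d\<in>F. foliated_change c d" using at by (simp add: foliated_atlas_def)
    ultimately show "\<forall>c\<in>P. \<forall>d\<in>P. foliated_change c d" by blast
  qed
  define P where "P = {c \<in> G. vertical_product_chart circle L c}"
  have box: "\<exists>A B \<theta> \<psi>. x \<in> A \<and> t \<in> B \<and> A \<subseteq> circle \<and> B \<subseteq> L \<and> open B \<and> connected B \<and> inj_on \<theta> A \<and>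
      (A \<times> B, \<lambda>(x, t). (\<psi> t, \<theta> x)) \<in> P" if xt: "x \<in> circle" "t \<in> L" for x t
  proof -
    have "a < t" using xt(2) by (simp add: L_def)
    obtain A B \<theta> \<psi> where AB: "x \<in> A" "t \<in> B" "A \<subseteq> circle" "open B" "connected B" "B \<subseteq> L"
      "chart_on (top_of_set circle) A \<theta>" "inj_on \<theta> A"
      and \<psi>: "continuous_on B \<psi>" "inj_on \<psi> B" "\<forall>W. open W \<longrightarrow> W \<subseteq> B \<longrightarrow> open (\<psi> ` W)"
      and inF: "(A \<times> B, \<lambda>(x, t). (\<psi> t, \<theta> x)) \<in> F"
      unfolding L_def by (rule vertical_chart[OF F Va xt(1) \<open>a < t\<close>])
    have "chart_on (top_of_set L) B \<psi>"
    proof (rule chart_onI)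
      show "openin (top_of_set L) B" using AB(4,6) by (rule open_subset[rotated])
      show "continuous_map (subtopology (top_of_set L) B) euclidean \<psi>"
        using \<psi>(1) AB(6) by (simp add: subtopology_subtopology Int_absorb1)
      show "open (\<psi> ` W)" if "openin (top_of_set L) W" "W \<subseteq> B" for W
        using that \<psi>(3) openin_open_trans[of L W] by (simp add: L_def)
    qed (rule \<psi>(2))
    then have "vertical_product_chart circle L (A \<times> B, \<lambda>(x, t). (\<psi> t, \<theta> x))"
      unfolding vertical_product_chart_def prod.case using AB(7)
      by (intro exI[of _ A] exI[of _ B] exI[of _ \<theta>] exI[of _ \<psi>]) auto
    moreover have "A \<times> B \<subseteq> circle \<times> L" using AB by blast
    ultimately have "(A \<times> B, \<lambda>(x, t). (\<psi> t, \<theta> x)) \<in> P" using inF GF by (simp add: P_def)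
    then show ?thesis using AB by blast
  qed
  have cov: "circle \<times> L \<subseteq> (\<Union>(U, \<phi>)\<in>P. U)"
  proof
    fix p assume "p \<in> circle \<times> L"
    then obtain x t where p: "p = (x, t)" "x \<in> circle" "t \<in> L" by blast
    obtain A B \<theta> \<psi> where "x \<in> A" "t \<in> B" "(A \<times> B, \<lambda>(x, t). (\<psi> t, \<theta> x)) \<in> P"
      using box[OF p(2,3)] by blast
    then show "p \<in> (\<Union>(U, \<phi>)\<in>P. U)" using p(1) by (intro UN_I) auto
  qed
  have PG: "P \<subseteq> G" by (auto simp: P_def)
  have atP: "foliated_atlas ?W P" using PG cov by (rule sub_atlas)
  have covG: "circle \<times> L \<subseteq> (\<Union>(U, \<phi>)\<in>G. U)" using cov PG by blast
  have atG: "foliated_atlas ?W G" using subset_refl covG by (rule sub_atlas)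
  have "trivial_vertical_foliation circle L G"
    unfolding trivial_vertical_foliation_def using atG atP PG
    by (intro conjI exI[of _ P]) (auto simp: P_def)
  moreover have "leaves ?W G = {{x} \<times> L | x. x \<in> circle}"
  proof -
    have plaque: "\<exists>B. t \<in> B \<and> B \<subseteq> L \<and> open B \<and> {x} \<times> B \<in> plaques ?W G"
      if xt: "x \<in> circle" "t \<in> L" for x t
    proof -
      obtain A B \<theta> \<psi> where AB: "x \<in> A" "t \<in> B" "A \<subseteq> circle" "B \<subseteq> L" "open B" "connected B" "inj_on \<theta> A"
        and "(A \<times> B, \<lambda>(x, t). (\<psi> t, \<theta> x)) \<in> P" using box[OF xt] by blast
      then have inG: "(A \<times> B, \<lambda>(x, t). (\<psi> t, \<theta> x)) \<in> G" using PG by blast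
      let ?\<Phi> = "\<lambda>(x, t). (\<psi> t, \<theta> x)"
      have ABW: "A \<times> B \<subseteq> topspace ?W" using AB by auto
      have xtAB: "(x, t) \<in> A \<times> B" using AB by simp
      \<comment> \<open>Injectivity of \<open>\<theta>\<close> leaves a single circle point on the
        level; as \<open>B\<close> is connected, the whole level is one plaque.\<close>
      have lev: "{m \<in> A \<times> B. snd (?\<Phi> m) = snd (?\<Phi> (x, t))} = {x} \<times> B"
        using AB(1) by (auto simp: inj_on_eq_iff[OF AB(7)])
      obtain Q where Q: "Q \<in> plaques ?W G" "Q \<subseteq> {m \<in> A \<times> B. snd (?\<Phi> m) = snd (?\<Phi> (x, t))}"
        "\<And>C. \<lbrakk>connectedin ?W C; (x, t) \<in> C;
          C \<subseteq> {m \<in> A \<times> B. snd (?\<Phi> m) = snd (?\<Phi> (x, t))}\<rbrakk> \<Longrightarrow> C \<subseteq> Q"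
        by (rule plaque_at[OF inG ABW xtAB]) blast
      have "connected ({x} \<times> B)" using AB(6) by (intro connected_Times) auto
      then have "connectedin ?W ({x} \<times> B)" using AB by (auto simp: connectedin_subtopology)
      then have "{x} \<times> B \<subseteq> Q" using Q(3) AB(2) unfolding lev by blast
      then have "Q = {x} \<times> B" using Q(2) unfolding lev by blast
      then show ?thesis using Q(1) AB by blast
    qed
    have leaf: "{x} \<times> L \<in> leaves ?W G" if x: "x \<in> circle" for x
    proof (rule leaf_of_plaques[OF atG])
      have "connected L" by (simp add: L_def)
      then have "connected ({x} \<times> L)" by (intro connected_Times) auto
      then show "connectedin ?W ({x} \<times> L)" using x by (auto simp: connectedin_subtopology)
      obtain t where "a < t" using gt_ex by blast
      then show "{x} \<times> L \<noteq> {}" by (auto simp: L_def)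
    next
      fix p assume "p \<in> {x} \<times> L"
      then obtain t where p: "p = (x, t)" "t \<in> L" by blast
      obtain B where B: "t \<in> B" "B \<subseteq> L" "open B" "{x} \<times> B \<in> plaques ?W G"
        using plaque[OF x p(2)] by metis
      have "openin (top_of_set ({x} \<times> L)) (({x} \<times> L) \<inter> (UNIV \<times> B))"
        using B(3) by (intro openin_open_Int open_Times) auto
      moreover have "({x} \<times> L) \<inter> (UNIV \<times> B) = {x} \<times> B" using B(2) by auto
      moreover have "subtopology ?W ({x} \<times> L) = top_of_set ({x} \<times> L)"
        using x by (simp add: subtopology_subtopology Int_absorb1 Sigma_mono)
      ultimately have "openin (subtopology ?W ({x} \<times> L)) ({x} \<times> B)" by simp
      then show "\<exists>P\<in>plaques ?W G. p \<in> P \<and> P \<subseteq> {x} \<times> L \<and> openin (subtopology ?W ({x} \<times> L)) P"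
        using B p by (intro bexI[of _ "{x} \<times> B"]) auto
    next
      fix p assume pW: "p \<in> topspace ?W - {x} \<times> L"
      obtain x' t where px: "p = (x', t)" by (cases p)
      with pW have p: "p = (x', t)" "x' \<in> circle" "t \<in> L" "x' \<noteq> x" by auto
      obtain B where B: "t \<in> B" "{x'} \<times> B \<in> plaques ?W G"
        using plaque[OF p(2,3)] by metis
      then show "\<exists>P\<in>plaques ?W G. p \<in> P \<and> P \<inter> {x} \<times> L = {}"
        using p by (intro bexI[of _ "{x'} \<times> B"]) auto
    qed
    have "K \<in> {{x} \<times> L | x. x \<in> circle}" if K: "K \<in> leaves ?W G" for K
    proof (rule leaves_cover[OF atG K])
      show "\<exists>Z\<in>{{x} \<times> L | x. x \<in> circle}. m \<in> Z" if "m \<in> topspace ?W" for m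
        using that by (intro bexI[of _ "{fst m} \<times> L"]) auto
      show "{{x} \<times> L | x. x \<in> circle} \<subseteq> leaves ?W G" using leaf by blast
    qed
    then show ?thesis using leaf by blast
  qed
  ultimately show ?thesis
    unfolding ultimately_vertical_def Let_def long_ray_above_eq
    by (intro exI[of _ \<alpha>]) (simp add: G_def L_def a_def)
qed

text \<open>A product chart past \<open>a\<close> puts a vertical segment
  \<open>{1} \<times> {t..t1}\<close> on one level, so the plaque through \<open>(1, t)\<close>
  reaches above height \<open>t\<close> and would drag a circle leaf along. The point
  \<open>1\<close> merely serves as some point of the circle.\<close>

lemma ultimately_vertical_circle_leaves:
  fixes F :: "(complex \<times> closed_long_ray, real, real) fchart set"
  assumes F: "foliation long_cylinder F" and uv: "ultimately_vertical F"
  shows "\<exists>b. \<forall>t. circle \<times> {t} \<in> leaves long_cylinder F \<longrightarrow> t \<le> b"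
proof -
  have at: "foliated_atlas long_cylinder F" using F by (simp add: foliation_def)
  obtain \<alpha> where "trivial_vertical_foliation circle (long_ray_above (ord_point \<alpha>))
      (restrict_foliation F (circle \<times> long_ray_above (ord_point \<alpha>)))"
    using uv unfolding ultimately_vertical_def Let_def by blast
  moreover define a where "a = ord_point \<alpha>"
  ultimately obtain P where P: "P \<subseteq> restrict_foliation F (circle \<times> {a<..})"
    "foliated_atlas (top_of_set (circle \<times> {a<..})) P" "\<forall>c\<in>P. vertical_product_chart circle {a<..} c"
    unfolding trivial_vertical_foliation_def long_ray_above_eq by blast
  have "t \<le> a" if leaf: "circle \<times> {t} \<in> leaves long_cylinder F" for t
  proof (rule ccontr)
    assume "\<not> t \<le> a"
    then have "(1, t) \<in> topspace (top_of_set (circle \<times> {a<..}))" by simp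
    then obtain U \<phi> where U: "(U, \<phi>) \<in> P" "(1, t) \<in> U" by (rule foliated_atlas_cover[OF P(2)])
    have UF: "(U, \<phi>) \<in> F" using U(1) P(1) by (auto simp: restrict_foliation_def)
    have "vertical_product_chart circle {a<..} (U, \<phi>)" using U(1) P(3) by blast
    then obtain A B \<theta> \<psi> where AB: "U = A \<times> B" "chart_on (top_of_set {a<..}) B (\<psi> :: closed_long_ray \<Rightarrow> real)"
      "\<And>x t. x \<in> A \<Longrightarrow> t \<in> B \<Longrightarrow> \<phi> (x, t) = (\<psi> t, \<theta> x)"
      unfolding vertical_product_chart_def prod.case by blast
    have "open B" using chart_on_openin[OF AB(2)] by (rule openin_open_trans) simp
    moreover have "t \<in> B" using AB(1) U(2) by blast
    moreover obtain t' where "t < t'" using gt_ex by blast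
    ultimately obtain c where c: "t < c" "{t..<c} \<subseteq> B" using open_right[of B t t'] by blast
    obtain t1 where t1: "t < t1" "t1 < c" using dense c(1) by blast
    have "{t..t1} \<subseteq> {t..<c}" using t1 by auto
    then have tt: "{t..t1} \<subseteq> B" using c(2) by blast
    have UX: "U \<subseteq> topspace long_cylinder"
      using chart_on_subset_topspace[OF foliated_atlas_chart[OF at UF]] .
    obtain Q where Q: "Q \<in> plaques long_cylinder F" "(1, t) \<in> Q"
      "\<And>C. \<lbrakk>connectedin long_cylinder C; (1, t) \<in> C;
        C \<subseteq> {m \<in> U. snd (\<phi> m) = snd (\<phi> (1, t))}\<rbrakk> \<Longrightarrow> C \<subseteq> Q"
      by (rule plaque_at[OF UF UX U(2)]) blast
    have A1: "1 \<in> A" using AB(1) U(2) by blast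
    have sub: "{1} \<times> {t..t1} \<subseteq> {m \<in> U. snd (\<phi> m) = snd (\<phi> (1, t))}"
      using A1 AB(1,3) tt \<open>t \<in> B\<close> by auto
    have "connected ({1::complex} \<times> {t..t1})" by (intro connected_Times) auto
    then have "connectedin long_cylinder ({1} \<times> {t..t1})"
      using sub UX by (auto simp: connectedin_subtopology)
    then have "{1} \<times> {t..t1} \<subseteq> Q" using Q(3) sub t1(1) by auto
    moreover have "Q \<subseteq> circle \<times> {t}" using plaque_subset_leaf[OF at Q(1) leaf Q(2)] by simp
    moreover have "(1, t1) \<in> {1::complex} \<times> {t..t1}" using t1(1) by simp
    ultimately have "(1, t1) \<in> circle \<times> {t}" by blast
    then show False using t1(1) by simp
  qed
  then show ?thesis by blast
qed

theorem theorem1p3: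
  fixes F :: "(complex \<times> closed_long_ray, real, real) fchart set"
    and C :: "closed_long_ray set"
  assumes "foliation long_cylinder F"
  defines "C \<equiv> {\<alpha> \<in> long_ray. circle \<times> {\<alpha>} \<in> leaves long_cylinder F}"
  defines "club \<equiv> closedin (top_of_set long_ray) C \<and> unbounded_in_long_ray C"
  shows "(club \<and> \<not> ultimately_vertical F) \<or> (\<not> club \<and> ultimately_vertical F)"
proof -
  have unb: "unbounded_in_long_ray C \<longleftrightarrow> unbounded_above C"
  proof
    assume u: "unbounded_in_long_ray C"
    show "unbounded_above C"
      unfolding unbounded_above_def
    proof
      fix b :: closed_long_ray
      \<comment> \<open>The arbitrary bound is raised to \<open>b'\<close>, which lies in
        \<open>long_ray\<close> as \<open>unbounded_in_long_ray\<close> demands of bounds.\<close>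
      obtain b' where b': "b < b'" using gt_ex by blast
      then have "b' \<in> long_ray" using greaterThan_subset_long_ray[of b] by auto
      then obtain x where "x \<in> C" "\<not> x \<le> b'" using u unfolding unbounded_in_long_ray_def by blast
      then show "\<exists>x\<in>C. b < x" using b' by (intro bexI[of _ x]) (auto simp: not_le)
    qed
  next
    assume "unbounded_above C"
    then show "unbounded_in_long_ray C"
      unfolding unbounded_above_def unbounded_in_long_ray_def using leD by blast
  qed
  have closed: "closedin (top_of_set long_ray) C"
    unfolding C_def by (rule closedin_circle_leaves[OF assms(1)])
  show ?thesis
  proof (cases "ultimately_vertical F")
    case True
    then obtain b where "\<forall>t. circle \<times> {t} \<in> leaves long_cylinder F \<longrightarrow> t \<le> b"
      using ultimately_vertical_circle_leaves[OF assms(1)] by blast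
    then have "\<not> unbounded_above C"
      unfolding unbounded_above_def C_def by (auto simp: not_less)
    then show ?thesis using True unb by (simp add: club_def)
  next
    case False
    then have "\<not> (\<exists>b. \<forall>z\<in>circle. vertical_past F b z)"
      using vertical_imp_ultimately_vertical[OF assms(1)] by blast
    then have "unbounded_above C"
      using vertical_or_horizontal[OF assms(1)] unfolding C_def by blast
    then show ?thesis using False closed unb by (simp add: club_def)
  qed
qed

end
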